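(* Let $\Gamma$ be a finite connected graph with at least two vertices and of valency at most four, and let $G\leqslant\mathrm{Aut}(\Gamma)$ be a group of automorphisms of $\Gamma$ that is transitive on the vertices of $\Gamma$. Then $G$ contains a nontrivial semiregular element.
   Context: A digraph consists of a finite non-empty set of vertices together with an irreflexive binary relation (the set of arcs) on it; it is a graph if the relation is symmetric. The valency of a vertex is the number of its (out-)neighbours. An automorphism is a permutation of the vertices preserving the arc relation. A permutation is semiregular if all its cycles (including cycles of length one) have the same length. *)

theory Defs
  imports
    "Graph_Theory.Digraph_Component"
    "HOL-Combinatorics.Orbits"
    "HOL-Algebra.Group"
begin

text \<open>
  A finite graph is a \<^locale>\<open>pair_graph\<close>: a finite set of vertices with an irreflexive, symmetric
  arc relation contained in it.  The empty graph is not excluded there.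
  Permutations of the vertex set are total functions fixing everything outside it (\<open>permutes\<close>),
  so that the identity permutation is \<^term>\<open>id\<close> and the product is composition.
\<close>

definition automorphisms :: "'a pair_pre_digraph \<Rightarrow> ('a \<Rightarrow> 'a) set" where
  "automorphisms \<Gamma> =
    {f. f permutes pverts \<Gamma> \<and>
        (\<forall>u \<in> pverts \<Gamma>. \<forall>v \<in> pverts \<Gamma>. (f u, f v) \<in> parcs \<Gamma> \<longleftrightarrow> (u, v) \<in> parcs \<Gamma>)}"

definition Aut :: "'a pair_pre_digraph \<Rightarrow> ('a \<Rightarrow> 'a) monoid" where
  "Aut \<Gamma> = \<lparr>carrier = automorphisms \<Gamma>, mult = (\<circ>), one = id\<rparr>"

definition transitive_on :: "'a set \<Rightarrow> ('a \<Rightarrow> 'a) set \<Rightarrow> bool" where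
  "transitive_on V G \<longleftrightarrow> (\<forall>u \<in> V. \<forall>v \<in> V. \<exists>g \<in> G. g u = v)"

text \<open>
  For a permutation \<open>f\<close> of a finite set \<open>V\<close>, the orbits \<^term>\<open>Orbits.orbit f x\<close> with \<open>x \<in> V\<close> are the
  supports of the cycles of \<open>f\<close> on \<open>V\<close>; a fixed point contributes a cycle of length one.
\<close>

definition semiregular_on :: "'a set \<Rightarrow> ('a \<Rightarrow> 'a) \<Rightarrow> bool" where
  "semiregular_on V f \<longleftrightarrow>
    f permutes V \<and>
    (\<forall>x \<in> V. \<forall>y \<in> V. card (Orbits.orbit f x) = card (Orbits.orbit f y))"

lemma group_Aut: "group (Aut \<Gamma>)"
proof (rule groupI)
  fix f assume "f \<in> carrier (Aut \<Gamma>)"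
  then have f: "f permutes pverts \<Gamma>"
    and arcs: "\<And>u v. u \<in> pverts \<Gamma> \<Longrightarrow> v \<in> pverts \<Gamma> \<Longrightarrow>
      (f u, f v) \<in> parcs \<Gamma> \<longleftrightarrow> (u, v) \<in> parcs \<Gamma>"
    by (auto simp: Aut_def automorphisms_def)
  have "Hilbert_Choice.inv f \<in> automorphisms \<Gamma>"
    unfolding automorphisms_def
  proof (intro CollectI conjI ballI)
    show i: "Hilbert_Choice.inv f permutes pverts \<Gamma>"
      using f by (rule permutes_inv)
    fix u v assume "u \<in> pverts \<Gamma>" "v \<in> pverts \<Gamma>"
    then show "(Hilbert_Choice.inv f u, Hilbert_Choice.inv f v) \<in> parcs \<Gamma> \<longleftrightarrow> (u, v) \<in> parcs \<Gamma>"
      using arcs[of "Hilbert_Choice.inv f u" "Hilbert_Choice.inv f v"] permutes_in_image[OF i] permutes_inverses(1)[OF f]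
      by simp
  qed
  moreover have "Hilbert_Choice.inv f \<circ> f = id"
    using f by (rule permutes_inv_o)
  ultimately show "\<exists>g \<in> carrier (Aut \<Gamma>). g \<otimes>\<^bsub>Aut \<Gamma>\<^esub> f = \<one>\<^bsub>Aut \<Gamma>\<^esub>"
    by (auto simp: Aut_def)
qed (auto simp: Aut_def automorphisms_def permutes_compose permutes_id permutes_in_image o_assoc)

end

theory Submission
  imports
    "Jordan_Normal_Form.Schur_Decomposition"
    "HOL-Library.Function_Algebras"
    "HOL-Algebra.Multiplicative_Group"
    "HOL-Algebra.Solvable_Groups"
    "HOL-Algebra.Group_Action"
    "HOL-Algebra.Sylow"
    Defs
begin

text \<open>
  Suppose that \<open>G\<close> contains no nontrivial semiregular element.  A permutation of prime order without
  fixed vertices is semiregular (\<open>prime_order_semiregular\<close>), so every element of prime order fixes a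
  vertex; such an action is called elusive below.  The proof shows that an elusive group is trivial
  (\<open>trivial_group\<close>), which is absurd for a transitive group on two or more vertices.

  \<^bold>\<open>An abelian normal subgroup.\<close>  An element of prime order at least \<open>5\<close> that fixes a vertex fixes its
  at most four neighbours too, hence by connectedness all vertices.  So \<open>\<bar>G\<bar> = 2\<^sup>a3\<^sup>b\<close>, and by
  Burnside's theorem \<open>G\<close> is soluble; it therefore has a nontrivial abelian normal subgroup \<open>N\<close> of
  exponent \<open>r \<in> {2, 3}\<close> (\<open>two_prime_group_abelian_normal\<close>).  Burnside's theorem rests on the fact that
  a simple group has no conjugacy class of prime power size greater than one (\<open>burnside_class_size\<close>).
  This is usually proved with irreducible characters.  Here the eigenprojections of the class sum,
  acting on the complex functions on the group, take their place: they commute with left and right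
  translations, and traces of translations on their images are algebraic integers.

  \<^bold>\<open>The local action.\<close>  All vertex stabilisers in \<open>N\<close> are nontrivial and move some neighbour.  As \<open>N\<close> is
  abelian, \<open>N\<^sub>v\<close> fixes the \<open>N\<close>-orbit of \<open>v\<close> pointwise.  If \<open>N\<^sub>v\<close> were transitive on the neighbours of
  \<open>v\<close>, then \<open>N\<close> would have at most two orbits, and the product of a nontrivial element of \<open>N\<^sub>v\<close> and one
  of \<open>N\<^sub>w\<close>, with \<open>w\<close> a neighbour of \<open>v\<close>, would fix no vertex (\<open>not_locally_transitive\<close>).  What remains
  is \<open>r = 3\<close> and a stabiliser \<open>N\<^sub>v\<close> with orbits of sizes \<open>1\<close> and \<open>3\<close> on the neighbours: each vertex has
  one mate and a triple of further neighbours.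

  \<^bold>\<open>Signs along a cycle.\<close>  The \<open>N\<close>-orbits are paired in two ways, by the mates and by the triples, so
  they are arranged in a cycle on which \<open>G\<close> acts as a dihedral group.  Let \<open>K\<close> be the kernel of this
  action.  An element \<open>c\<close> of \<open>K\<close> permutes the edges of \<open>\<Gamma>\<close> between any two consecutive orbits; the
  signs of these permutations form a sequence of numbers \<open>\<plusminus>1\<close>.  Since orbits have odd size, an
  involution in \<open>K\<close> with constant signs is the identity (\<open>constant_signs_involution\<close>).  Hence the
  elements of \<open>K\<close> with all signs \<open>1\<close> form a group \<open>D\<close> of odd order, no element of \<open>K\<close> has all signs
  \<open>-1\<close>, and, as involutions fix vertices, any \<open>h \<in> G\<close> with \<open>h\<^sup>2 \<in> D\<close> belongs to \<open>K\<close>.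

  Now choose \<open>x\<close> and \<open>y\<close> in \<open>G\<close> that reflect the cycle in a mate edge and in a triple edge.  The signs
  of \<open>x\<^sup>2\<close> and \<open>y\<^sup>2\<close> are symmetric about their centres of reflection and are \<open>1\<close> there.  A purely
  combinatorial statement about groups of sign sequences (\<open>symmetric_is_norm\<close>) now yields \<open>c \<in> K\<close> such
  that the signs of \<open>x\<^sup>2\<close> are those of \<open>c\<close> times their mirror image, or the same for \<open>y\<close>.  Then
  \<open>(xc)\<^sup>2\<close> or \<open>(yc)\<^sup>2\<close> lies in \<open>D\<close>, so \<open>x\<close> or \<open>y\<close> lies in \<open>K\<close>; but neither of them fixes the orbit at
  which the cycle starts.
\<close>

section \<open>Algebraic integers\<close>

text \<open>
  The characteristic polynomial of an integer matrix is monic with integer coefficients.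
\<close>
lemma algebraic_int_eigenvalue:
  fixes z :: complex and A :: "int mat"
  assumes A: "A \<in> carrier_mat n n" and ev: "eigenvalue (map_mat of_int A) z"
  shows "algebraic_int z"
proof -
  have A': "map_mat complex_of_int A \<in> carrier_mat n n" using A by simp
  have "poly (char_poly (map_mat of_int A)) z = 0"
    using eigenvalue_root_char_poly[OF A'] ev by simp
  then have "poly (map_poly of_int (char_poly A)) z = 0"
    by (simp add: of_int_hom.char_poly_hom[OF A])
  moreover have "lead_coeff (char_poly A) = 1"
    using degree_monic_char_poly[OF A] by simp
  ultimately show ?thesis
    unfolding algebraic_int_altdef_ipoly by blast
qed

inductive_set int_span :: "complex set \<Rightarrow> complex set" for S where
  zero: "0 \<in> int_span S"
| base: "s \<in> S \<Longrightarrow> s \<in> int_span S"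
| add: "a \<in> int_span S \<Longrightarrow> b \<in> int_span S \<Longrightarrow> a + b \<in> int_span S"
| minus: "a \<in> int_span S \<Longrightarrow> - a \<in> int_span S"

lemma int_span_of_nat_mult: "a \<in> int_span S \<Longrightarrow> of_nat n * a \<in> int_span S"
  by (induction n) (auto simp: algebra_simps intro: int_span.intros)

lemma int_span_of_int_mult: "a \<in> int_span S \<Longrightarrow> of_int k * a \<in> int_span S"
  by (cases k) (auto simp: algebra_simps dest: int_span_of_nat_mult 
     intro!: int_span_of_nat_mult int_span.minus int_span.add simp del: of_nat_Suc)

lemma int_span_sum: "(\<And>i. i \<in> I \<Longrightarrow> f i \<in> int_span S) \<Longrightarrow> sum f I \<in> int_span S"
  by (induction I rule: infinite_finite_induct) (auto intro: int_span.intros)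

lemma int_span_mult_closed:
  assumes "\<And>s. s \<in> S \<Longrightarrow> z * s \<in> int_span S" and "a \<in> int_span S"
  shows "z * a \<in> int_span S"
  using assms(2) by induction (auto simp: distrib_left assms(1) intro: int_span.intros)

lemma int_span_combination:
  assumes "finite S" "a \<in> int_span S"
  shows "\<exists>c :: complex \<Rightarrow> int. a = (\<Sum>s\<in>S. of_int (c s) * s)"
  using assms(2)
proof induction
  case zero
  show ?case by (rule exI[of _ "\<lambda>_. 0"]) simp
next
  case (base s)
  show ?case using assms(1) base
    by (intro exI[of _ "\<lambda>t. if t = s then 1 else 0"]) (simp add: if_distrib[of of_int] if_distrib[of "\<lambda>x. x * _"] sum.delta cong: if_cong)
next
  case (add a b)
  then obtain c d :: "complex \<Rightarrow> int" where "a = (\<Sum>s\<in>S. of_int (c s) * s)" "b = (\<Sum>s\<in>S. of_int (d s) * s)" by blast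
  then show ?case by (intro exI[of _ "\<lambda>s. c s + d s"]) (simp add: sum.distrib algebra_simps)
next
  case (minus a)
  then obtain c :: "complex \<Rightarrow> int" where "a = (\<Sum>s\<in>S. of_int (c s) * s)" by blast
  then show ?case by (intro exI[of _ "\<lambda>s. - c s"]) (simp add: sum_negf)
qed

text \<open>
  The determinant trick: multiplication by \<open>z\<close> on the finitely generated group \<open>int_span S\<close> is given
  by an integer matrix with \<open>z\<close> as an eigenvalue, the tuple of the elements of \<open>S\<close> being an
  eigenvector.  It is not zero because \<open>1 \<in> S\<close>.
\<close>
lemma algebraic_int_if_int_span_stable:
  assumes fin: "finite S" and one: "1 \<in> S" and stable: "\<And>s. s \<in> S \<Longrightarrow> z * s \<in> int_span S"
  shows "algebraic_int z"
proof -
  obtain h n where bij: "bij_betw h {..<n::nat} S"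
    using fin ex_bij_betw_nat_finite[of S] atLeast0LessThan by metis
  have "\<forall>s\<in>S. \<exists>c :: complex \<Rightarrow> int. z * s = (\<Sum>t\<in>S. of_int (c t) * t)"
    using int_span_combination[OF fin] stable by blast
  then obtain c :: "complex \<Rightarrow> complex \<Rightarrow> int" where c: "\<And>s. s \<in> S \<Longrightarrow> z * s = (\<Sum>t\<in>S. of_int (c s t) * t)"
    by metis
  define A where "A = mat n n (\<lambda>(i,j). c (h i) (h j))"
  define v where "v = vec n h"
  have A: "A \<in> carrier_mat n n" by (simp add: A_def)
  have "map_mat of_int A *\<^sub>v v = z \<cdot>\<^sub>v v"
  proof (rule eq_vecI)
    fix i assume "i < dim_vec (z \<cdot>\<^sub>v v)"
    then have i: "i < n" by (simp add: v_def)
    then have hi: "h i \<in> S" using bij by (auto simp: bij_betw_def)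
    have "(map_mat of_int A *\<^sub>v v) $ i = (\<Sum>j<n. of_int (c (h i) (h j)) * h j)"
      using i by (simp add: A_def v_def scalar_prod_def atLeast0LessThan)
    also have "\<dots> = (\<Sum>t\<in>S. of_int (c (h i) t) * t)"
      by (rule sum.reindex_bij_betw[OF bij])
    finally show "(map_mat of_int A *\<^sub>v v) $ i = (z \<cdot>\<^sub>v v) $ i"
      using c[OF hi] i by (simp add: v_def)
  qed (simp add: A_def v_def)
  moreover obtain i where "i < n" "h i = 1" using one bij by (auto simp: bij_betw_def)
  then have "v \<noteq> 0\<^sub>v n" by (auto simp: v_def vec_eq_iff)
  ultimately have "eigenvalue (map_mat of_int A) z"
    unfolding eigenvalue_def eigenvector_def by (intro exI[of _ v]) (auto simp: v_def A_def)
  then show ?thesis using algebraic_int_eigenvalue[OF A] by blast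
qed

lemma algebraic_int_powers_stable:
  assumes "algebraic_int (x::complex)"
  obtains n where "n > 0" "\<And>i. i < n \<Longrightarrow> x * x ^ i \<in> int_span ((\<lambda>i. x ^ i) ` {..<n})"
proof -
  obtain p :: "int poly" where p: "lead_coeff p = 1" "poly (map_poly of_int p) x = 0"
    using assms unfolding algebraic_int_altdef_ipoly by blast
  define n where "n = degree p"
  have n: "n > 0"
  proof (rule ccontr)
    assume "\<not> n > 0"
    then obtain c where "p = [:c:]" using degree_eq_zeroE by (auto simp: n_def)
    with p show False by simp
  qed
  have "(\<Sum>i\<le>n. of_int (Polynomial.coeff p i) * x ^ i) = 0"
    using p(2) by (simp add: poly_altdef n_def degree_map_poly)
  then have "x ^ n = - (\<Sum>i<n. of_int (Polynomial.coeff p i) * x ^ i)"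
    using p(1) by (simp add: n_def lessThan_Suc_atMost[symmetric] add_eq_0_iff2)
  then have pow_n: "x ^ n \<in> int_span ((\<lambda>i. x ^ i) ` {..<n})"
    by (simp only:) (intro int_span.minus int_span_sum int_span_of_int_mult int_span.base imageI)
  have "x * x ^ i \<in> int_span ((\<lambda>i. x ^ i) ` {..<n})" if "i < n" for i
  proof (cases "Suc i = n")
    case True
    with pow_n show ?thesis by (simp only: power_Suc[symmetric])
  next
    case False
    then have "x ^ Suc i \<in> (\<lambda>i. x ^ i) ` {..<n}" using that by (intro imageI) simp
    then show ?thesis unfolding power_Suc[symmetric] by (rule int_span.base)
  qed
  with n show ?thesis using that by blast
qed

text \<open>
  The products of powers of \<open>x\<close> and of \<open>y\<close> below the degrees of monic equations for them span a group
  that is stable under multiplication by \<open>x\<close> and by \<open>y\<close>, hence by their sum and product.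
\<close>
lemma algebraic_int_add_mult:
  assumes x: "algebraic_int (x::complex)" and y: "algebraic_int y"
  shows "algebraic_int (x + y)" "algebraic_int (x * y)"
proof -
  obtain n where n: "n > 0" "\<And>i. i < n \<Longrightarrow> x * x ^ i \<in> int_span ((\<lambda>i. x ^ i) ` {..<n})"
    using algebraic_int_powers_stable[OF x] by blast
  obtain m where m: "m > 0" "\<And>i. i < m \<Longrightarrow> y * y ^ i \<in> int_span ((\<lambda>i. y ^ i) ` {..<m})"
    using algebraic_int_powers_stable[OF y] by blast
  define S where "S = (\<lambda>(i,j). x ^ i * y ^ j) ` ({..<n} \<times> {..<m})"
  have fin: "finite S" and one: "1 \<in> S"
    using n(1) m(1) by (auto simp: S_def image_iff intro!: bexI[of _ 0])
  have mem: "x ^ i * y ^ j \<in> S" if "i < n" "j < m" for i j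
    using that by (auto simp: S_def)
  have left: "a * y ^ j \<in> int_span S" if "a \<in> int_span ((\<lambda>i. x ^ i) ` {..<n})" "j < m" for a j
    using that(1) by induction (use that(2) in \<open>auto simp: distrib_left distrib_right intro: int_span.intros mem\<close>)
  have right: "x ^ i * a \<in> int_span S" if "a \<in> int_span ((\<lambda>i. y ^ i) ` {..<m})" "i < n" for a i
    using that(1) by induction (use that(2) in \<open>auto simp: distrib_left distrib_right intro: int_span.intros mem\<close>)
  have X: "x * s \<in> int_span S" and Y: "y * s \<in> int_span S" if s: "s \<in> S" for s
  proof -
    obtain i j where s: "s = x ^ i * y ^ j" "i < n" "j < m" using s by (auto simp: S_def)
    show "x * s \<in> int_span S" using left[OF n(2)[OF s(2)] s(3)] s(1) by (simp add: algebra_simps)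
    show "y * s \<in> int_span S" using right[OF m(2)[OF s(3)] s(2)] s(1) by (simp add: algebra_simps)
  qed
  show "algebraic_int (x + y)"
    using fin one by (rule algebraic_int_if_int_span_stable) (simp add: X Y int_span.add distrib_right)
  show "algebraic_int (x * y)"
    using fin one
    by (rule algebraic_int_if_int_span_stable) (simp add: mult.assoc int_span_mult_closed[OF X Y])
qed

lemma algebraic_int_sum: "(\<And>i. i \<in> I \<Longrightarrow> algebraic_int (f i :: complex)) \<Longrightarrow> algebraic_int (sum f I)"
  by (induction I rule: infinite_finite_induct) (auto intro: algebraic_int_add_mult)

lemma algebraic_int_prod_list: "(\<And>x. x \<in> set xs \<Longrightarrow> algebraic_int (x :: complex)) \<Longrightarrow> algebraic_int (prod_list xs)"
  by (induction xs) (auto intro: algebraic_int_add_mult)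

lemma algebraic_int_power: "algebraic_int (x::complex) \<Longrightarrow> algebraic_int (x ^ n)"
  by (induction n) (auto intro: algebraic_int_add_mult)

lemma algebraic_int_root_of_unity:
  assumes "x ^ n = 1" "n > 0"
  shows "algebraic_int (x::complex)"
  using algebraic_int_root[of 1 "Polynomial.monom 1 n" x] assms
  by (simp add: poly_monom degree_monom_eq)

text \<open>
  The product of the conjugates of an algebraic integer, up to sign the constant coefficient of its
  minimal polynomial, is an integer.  If all conjugates lie in the closed unit disc and the product is
  not zero, then all of them have absolute value \<open>1\<close>.
\<close>
lemma algebraic_int_conjugates_in_unit_disc:
  fixes t :: complex and F :: "rat poly"
  assumes int: "algebraic_int t" and F: "F \<noteq> 0" "poly (map_poly of_rat F) t = 0"
    and disc: "\<And>u::complex. poly (map_poly of_rat F) u = 0 \<Longrightarrow> cmod u \<le> 1"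
  shows "t = 0 \<or> cmod t = 1"
proof -
  interpret rat_poly: map_poly_inj_idom_hom "of_rat :: rat \<Rightarrow> complex" ..
  let ?c = "map_poly (of_rat :: rat \<Rightarrow> complex)"
  \<comment> \<open>a rational polynomial of least degree with root t: its complex roots are the conjugates of t\<close>
  define P where "P f \<longleftrightarrow> f \<noteq> 0 \<and> poly (?c f) t = 0" for f
  obtain f where f: "P f" and least: "\<And>g. P g \<Longrightarrow> degree f \<le> degree g"
    using ex_has_least_nat[of P F degree] F by (auto simp: P_def)
  have dvd: "f dvd g" if "poly (?c g) t = 0" for g
  proof (rule ccontr)
    assume "\<not> f dvd g"
    then have nz: "g mod f \<noteq> 0" by (simp add: mod_eq_0_iff_dvd)
    have "?c g = ?c (f * (g div f) + g mod f)" by simp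
    also have "\<dots> = ?c f * ?c (g div f) + ?c (g mod f)" by (simp only: rat_poly.hom_add rat_poly.hom_mult)
    finally have "poly (?c (g mod f)) t = 0" using that f by (simp add: P_def)
    with nz have "degree f \<le> degree (g mod f)" by (intro least) (simp add: P_def)
    with nz f show False using degree_mod_less'[of f g] by (auto simp: P_def)
  qed
  obtain as where as: "Polynomial.smult (lead_coeff (?c f)) (\<Prod>a\<leftarrow>as. [:- a, 1:]) = ?c f"
    using fundamental_theorem_algebra_factorized by blast
  have lc: "lead_coeff (?c f) \<noteq> 0" using f by (simp add: P_def)
  have root_iff: "poly (?c f) u = 0 \<longleftrightarrow> u \<in> set as" for u
    by (subst as[symmetric]) (use lc in \<open>auto simp: poly_prod_list o_def prod_list_zero_iff\<close>)
  have t: "t \<in> set as" using f root_iff by (simp add: P_def)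
  obtain h :: "int poly" where h: "lead_coeff h = 1" "poly (map_poly of_int h) t = 0"
    using int unfolding algebraic_int_altdef_ipoly by blast
  have of_int: "?c (map_poly of_int h) = map_poly of_int h"
    by (rule poly_eqI) (simp add: coeff_map_poly)
  have as_props: "algebraic_int u \<and> cmod u \<le> 1" if "u \<in> set as" for u
  proof
    have "poly (?c f) u = 0" using that root_iff by simp
    then have 1: "poly (?c g) u = 0" if "f dvd g" for g
      using that by (auto elim!: dvdE simp: rat_poly.hom_mult)
    have "poly (map_poly of_int h) u = 0"
      using 1[OF dvd, of "map_poly of_int h"] h(2) by (simp add: of_int)
    with h(1) show "algebraic_int u" unfolding algebraic_int_altdef_ipoly by blast
    show "cmod u \<le> 1" using 1[OF dvd[OF F(2)]] disc by blast
  qed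
  \<comment> \<open>a rational algebraic integer, so an integer; its absolute value is at most 1\<close>
  define c where "c = prod_list (map uminus as)"
  have coeff0: "poly (?c f) 0 = lead_coeff (?c f) * c"
    by (subst as[symmetric]) (simp add: poly_prod_list o_def c_def)
  have "c = of_rat (poly f 0 / lead_coeff f)"
    using coeff0 lc by (simp add: of_rat_divide field_simps)
  moreover have "algebraic_int c"
    unfolding c_def by (rule algebraic_int_prod_list) (use as_props in auto)
  ultimately have c_int: "c \<in> \<int>" by (intro rational_algebraic_int_is_int) auto
  show ?thesis
  proof (cases "c = 0")
    case True
    then have "poly f 0 = 0" using coeff0 by simp
    then obtain g where g: "f = [:0, 1:] * g" using poly_eq_0_iff_dvd[of f 0] by (auto elim: dvdE)
    have "t = 0"
    proof (rule ccontr)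
      assume "t \<noteq> 0"
      with f g have "P g" by (auto simp: P_def rat_poly.hom_mult)
      then have "degree f \<le> degree g" by (rule least)
      moreover have "degree f = 1 + degree g"
        using \<open>P g\<close> unfolding g P_def by (subst degree_mult_eq) auto
      ultimately show False by simp
    qed
    then show ?thesis by simp
  next
    case False
    then have "1 \<le> cmod c" using c_int by (auto elim!: Ints_cases simp: norm_of_int)
    also obtain xs ys where split: "as = xs @ t # ys" using t by (meson split_list)
    have le1: "cmod (prod_list (map uminus zs)) \<le> 1" if "set zs \<subseteq> set as" for zs
      using that by (induction zs) (auto simp: norm_mult intro!: mult_le_one as_props[THEN conjunct2])
    have "cmod c = cmod (prod_list (map uminus xs)) * cmod (prod_list (map uminus ys)) * cmod t"
      by (simp add: c_def split norm_mult)
    also have "\<dots> \<le> 1 * cmod t"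
      using le1[of xs] le1[of ys] split by (intro mult_right_mono mult_le_one) auto
    finally show ?thesis using as_props[OF t] by simp
  qed
qed

section \<open>Complex matrices on a finite index set\<close>

text \<open>
  The algebra of complex matrices with rows and columns indexed by a finite set \<open>X\<close> that need not be
  an initial segment of the natural numbers.  Matrices are functions of two arguments that vanish
  outside of \<open>X\<close>, so that equality of matrices is equality of functions.
\<close>
locale kernel_algebra =
  fixes X :: "'g set"
  assumes finite_X: "finite X"
begin

definition kernels :: "('g \<Rightarrow> 'g \<Rightarrow> complex) set" where
  "kernels = {A. \<forall>x y. A x y \<noteq> 0 \<longrightarrow> x \<in> X \<and> y \<in> X}"

definition kmult :: "('g \<Rightarrow> 'g \<Rightarrow> complex) \<Rightarrow> ('g \<Rightarrow> 'g \<Rightarrow> complex) \<Rightarrow> 'g \<Rightarrow> 'g \<Rightarrow> complex" (infixl "\<star>" 70) where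
  "A \<star> B = (\<lambda>x y. \<Sum>z\<in>X. A x z * B z y)"

definition kone :: "'g \<Rightarrow> 'g \<Rightarrow> complex" ("\<I>") where
  "\<I> = (\<lambda>x y. of_bool (x \<in> X \<and> x = y))"

definition kscale :: "complex \<Rightarrow> ('g \<Rightarrow> 'g \<Rightarrow> complex) \<Rightarrow> 'g \<Rightarrow> 'g \<Rightarrow> complex" (infixr "\<cdot>" 75) where
  "c \<cdot> A = (\<lambda>x y. c * A x y)"

definition ktrace :: "('g \<Rightarrow> 'g \<Rightarrow> complex) \<Rightarrow> complex" where
  "ktrace A = (\<Sum>x\<in>X. A x x)"

definition kadjoint :: "('g \<Rightarrow> 'g \<Rightarrow> complex) \<Rightarrow> 'g \<Rightarrow> 'g \<Rightarrow> complex" where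
  "kadjoint A = (\<lambda>x y. cnj (A y x))"

lemma kernels_outside: "A \<in> kernels \<Longrightarrow> x \<notin> X \<or> y \<notin> X \<Longrightarrow> A x y = 0"
  by (auto simp: kernels_def)

lemma kernelsI: "(\<And>x y. x \<notin> X \<or> y \<notin> X \<Longrightarrow> A x y = 0) \<Longrightarrow> A \<in> kernels"
  by (auto simp: kernels_def)

lemma kernel_eqI:
  assumes "A \<in> kernels" "B \<in> kernels" "\<And>x y. x \<in> X \<Longrightarrow> y \<in> X \<Longrightarrow> A x y = B x y"
  shows "A = B"
proof (intro ext)
  fix x y show "A x y = B x y"
    using assms unfolding kernels_def mem_Collect_eq by metis
qed

lemma kernels_closed [simp, intro]:
  "\<I> \<in> kernels" "0 \<in> kernels"
  "A \<in> kernels \<Longrightarrow> c \<cdot> A \<in> kernels"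
  "A \<in> kernels \<Longrightarrow> kadjoint A \<in> kernels"
  "A \<in> kernels \<Longrightarrow> B \<in> kernels \<Longrightarrow> A + B \<in> kernels"
  "A \<in> kernels \<Longrightarrow> B \<in> kernels \<Longrightarrow> A - B \<in> kernels"
  "A \<in> kernels \<Longrightarrow> B \<in> kernels \<Longrightarrow> A \<star> B \<in> kernels"
  by (auto intro!: kernelsI simp: kernels_outside kone_def kscale_def kadjoint_def kmult_def)

lemma kernels_sum:
  fixes f :: "'i \<Rightarrow> 'g \<Rightarrow> 'g \<Rightarrow> complex"
  shows "(\<And>i. i \<in> J \<Longrightarrow> f i \<in> kernels) \<Longrightarrow> sum f J \<in> kernels"
  by (induction J rule: infinite_finite_induct) auto

lemma sum_kernel_apply: "sum f J x y = (\<Sum>i\<in>J. f i x y)"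
  by (induction J rule: infinite_finite_induct) auto

lemma kmult_assoc: "A \<star> B \<star> C = A \<star> (B \<star> C)"
proof (intro ext)
  fix x y
  have "(A \<star> B \<star> C) x y = (\<Sum>z\<in>X. \<Sum>w\<in>X. A x w * B w z * C z y)"
    by (simp add: kmult_def sum_distrib_right)
  also have "\<dots> = (\<Sum>w\<in>X. \<Sum>z\<in>X. A x w * B w z * C z y)" by (rule sum.swap)
  also have "\<dots> = (A \<star> (B \<star> C)) x y" by (simp add: kmult_def sum_distrib_left mult.assoc)
  finally show "(A \<star> B \<star> C) x y = (A \<star> (B \<star> C)) x y" .
qed

lemma kmult_linear [simp]:
  "(A + B) \<star> C = A \<star> C + B \<star> C" "C \<star> (A + B) = C \<star> A + C \<star> B"
  "(A - B) \<star> C = A \<star> C - B \<star> C" "C \<star> (A - B) = C \<star> A - C \<star> B"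
  "(c \<cdot> A) \<star> B = c \<cdot> (A \<star> B)" "A \<star> (c \<cdot> B) = c \<cdot> (A \<star> B)"
  "0 \<star> C = 0" "C \<star> 0 = 0"
  by (auto simp: kmult_def kscale_def fun_eq_iff algebra_simps sum.distrib sum_subtractf sum_distrib_left)

lemma kscale_simps [simp]:
  "c \<cdot> d \<cdot> A = (c * d) \<cdot> A" "1 \<cdot> A = A" "0 \<cdot> A = 0" "c \<cdot> 0 = 0"
  by (auto simp: kscale_def fun_eq_iff)

lemma kscale_distrib:
  "c \<cdot> (A + B) = c \<cdot> A + c \<cdot> B" "c \<cdot> (A - B) = c \<cdot> A - c \<cdot> B" "(c + d) \<cdot> A = c \<cdot> A + d \<cdot> A"
  "(c - d) \<cdot> A = c \<cdot> A - d \<cdot> A"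
  by (auto simp: kscale_def fun_eq_iff algebra_simps)

lemma kmult_sum:
  fixes f :: "'i \<Rightarrow> 'g \<Rightarrow> 'g \<Rightarrow> complex"
  shows "sum f J \<star> C = (\<Sum>i\<in>J. f i \<star> C)" "C \<star> sum f J = (\<Sum>i\<in>J. C \<star> f i)"
  by (induction J rule: infinite_finite_induct) auto

lemma kscale_sum:
  fixes f :: "'i \<Rightarrow> 'g \<Rightarrow> 'g \<Rightarrow> complex"
  shows "c \<cdot> sum f J = (\<Sum>i\<in>J. c \<cdot> f i)"
  by (simp add: kscale_def fun_eq_iff sum_kernel_apply sum_distrib_left)

lemma kmult_one [simp]:
  assumes "A \<in> kernels" shows "\<I> \<star> A = A" "A \<star> \<I> = A"
proof -
  show "\<I> \<star> A = A"
  proof (rule kernel_eqI)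
    fix x y assume "x \<in> X"
    then show "(\<I> \<star> A) x y = A x y"
      using finite_X by (simp add: kmult_def kone_def of_bool_def if_distrib[of "\<lambda>u. u * _"] sum.delta' cong: if_cong)
  qed (use assms in auto)
  show "A \<star> \<I> = A"
  proof (rule kernel_eqI)
    fix x y assume "y \<in> X"
    then show "(A \<star> \<I>) x y = A x y"
      using finite_X by (simp add: kmult_def kone_def of_bool_def if_distrib[of "\<lambda>u. _ * u"] conj_commute
          if_if_eq_conj[symmetric] sum.delta cong: if_cong)
  qed (use assms in auto)
qed

lemma ktrace_simps [simp]:
  "ktrace (A + B) = ktrace A + ktrace B" "ktrace (c \<cdot> A) = c * ktrace A" "ktrace 0 = 0"
  by (auto simp: ktrace_def kscale_def sum.distrib sum_distrib_left)

lemma ktrace_sum: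
  fixes f :: "'i \<Rightarrow> 'g \<Rightarrow> 'g \<Rightarrow> complex"
  shows "ktrace (sum f J) = (\<Sum>i\<in>J. ktrace (f i))"
  unfolding ktrace_def sum_kernel_apply by (rule sum.swap)

lemma ktrace_commute: "ktrace (A \<star> B) = ktrace (B \<star> A)"
  unfolding ktrace_def kmult_def by (subst sum.swap) (simp add: mult.commute)

lemma kadjoint_simps [simp]: "kadjoint (kadjoint A) = A" "kadjoint (A \<star> B) = kadjoint B \<star> kadjoint A"
  "kadjoint (sum f J) = (\<Sum>i\<in>J. kadjoint (f i))"
  by (auto simp: kadjoint_def kmult_def mult.commute fun_eq_iff sum_kernel_apply)

section \<open>Triangular form\<close>

text \<open>
  The Schur decomposition, transported along an enumeration \<open>h\<close> of \<open>X\<close>.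
\<close>
lemma triangular_form:
  assumes A: "A \<in> kernels"
  obtains B P Q h where "B \<in> kernels" "P \<in> kernels" "Q \<in> kernels" "A = P \<star> B \<star> Q" "P \<star> Q = \<I>" "Q \<star> P = \<I>"
    "bij_betw h {..<card X} X" "\<And>i j. i < j \<Longrightarrow> j < card X \<Longrightarrow> B (h j) (h i) = 0"
proof -
  let ?n = "card X"
  obtain h where h: "bij_betw h {..<?n} X"
    using finite_X ex_bij_betw_nat_finite[of X] atLeast0LessThan by metis
  define g where "g = the_inv_into {..<?n} h"
  have gh: "g (h i) = i" if "i < ?n" for i
    using that h unfolding g_def by (intro the_inv_into_f_f) (auto simp: bij_betw_def)
  have hg: "h (g x) = x" and gn: "g x < ?n" if "x \<in> X" for x
  proof -
    from that h obtain i where i: "i < ?n" "x = h i" by (auto simp: bij_betw_def)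
    then show "h (g x) = x" "g x < ?n" by (simp_all add: gh)
  qed
  have hX: "h i \<in> X" if "i < ?n" for i using h that by (auto simp: bij_betw_def)
  define mat' where "mat' C = mat ?n ?n (\<lambda>(i,j). C (h i) (h j))" for C :: "'g \<Rightarrow> 'g \<Rightarrow> complex"
  define ker where "ker M = (\<lambda>x y. if x \<in> X \<and> y \<in> X then M $$ (g x, g y) else 0)" for M :: "complex mat"
  have ker_in: "ker M \<in> kernels" for M by (auto simp: ker_def kernels_def split: if_splits)
  have ker_mat: "ker (mat' C) = C" if "C \<in> kernels" for C
    by (rule kernel_eqI) (auto simp: ker_in that, auto simp: ker_def mat'_def hg gn)
  have ker_mult: "ker (M * N) = ker M \<star> ker N" if "M \<in> carrier_mat ?n ?n" "N \<in> carrier_mat ?n ?n" for M N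
  proof (rule kernel_eqI)
    fix x y assume xy: "x \<in> X" "y \<in> X"
    have "(ker M \<star> ker N) x y = (\<Sum>i<?n. ker M x (h i) * ker N (h i) y)"
      unfolding kmult_def by (rule sum.reindex_bij_betw[OF h, symmetric])
    also have "\<dots> = (\<Sum>i<?n. M $$ (g x, i) * N $$ (i, g y))"
      by (rule sum.cong) (auto simp: ker_def xy hX gh)
    also have "\<dots> = ker (M * N) x y"
      using that xy by (simp add: ker_def scalar_prod_def atLeast0LessThan gn)
    finally show "ker (M * N) x y = (ker M \<star> ker N) x y" by simp
  qed (auto simp: ker_in)
  have ker_one: "ker (1\<^sub>m ?n) = \<I>"
  proof (rule kernel_eqI)
    fix x y assume xy: "x \<in> X" "y \<in> X"
    then have "g x = g y \<longleftrightarrow> x = y" using hg by metis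
    then show "ker (1\<^sub>m ?n) x y = \<I> x y" using xy by (simp add: ker_def kone_def gn)
  qed (auto simp: ker_in)
  have carr: "mat' A \<in> carrier_mat ?n ?n" by (simp add: mat'_def)
  obtain es where es: "char_poly (mat' A) = (\<Prod>a\<leftarrow>es. [:- a, 1:])"
    using char_poly_factorized[OF carr] by blast
  obtain B P Q where sd: "schur_decomposition (mat' A) es = (B, P, Q)" by (metis prod_cases3)
  from schur_decomposition[OF carr es sd]
  have sim: "similar_mat_wit (mat' A) B P Q" and ut: "upper_triangular B" by auto
  note s = similar_mat_witD2[OF carr sim]
  show ?thesis
  proof (rule that[of "ker B" "ker P" "ker Q" h])
    have "A = ker (P * B * Q)" using s(3) ker_mat[OF A] by simp
    also have "\<dots> = ker P \<star> ker B \<star> ker Q" using s(4-) by (simp add: ker_mult kmult_assoc)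
    finally show "A = ker P \<star> ker B \<star> ker Q" .
    show "ker P \<star> ker Q = \<I>" using s ker_mult[of P Q] by (simp add: ker_one)
    show "ker Q \<star> ker P = \<I>" using s ker_mult[of Q P] by (simp add: ker_one)
    fix i j assume "i < j" "j < ?n"
    then show "ker B (h j) (h i) = 0" using ut s by (auto simp: ker_def gh)
  qed (auto simp: ker_in h)
qed

text \<open>
  For the list \<open>w\<^sub>1, \<dots>, w\<^sub>k\<close> this is the product of all \<open>A - w\<^sub>i\<close>, applied to \<open>C\<close>: a polynomial in \<open>A\<close>
  that is given by its list of roots.
\<close>
definition shift_product :: "('g \<Rightarrow> 'g \<Rightarrow> complex) \<Rightarrow> complex list \<Rightarrow> ('g \<Rightarrow> 'g \<Rightarrow> complex) \<Rightarrow> 'g \<Rightarrow> 'g \<Rightarrow> complex" where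
  "shift_product A ws C = fold (\<lambda>w D. (A - w \<cdot> \<I>) \<star> D) ws C"

lemma shift_product_simps [simp]:
  "shift_product A [] C = C"
  "shift_product A (w # ws) C = shift_product A ws ((A - w \<cdot> \<I>) \<star> C)"
  "shift_product A (ws @ vs) C = shift_product A vs (shift_product A ws C)"
  by (simp_all add: shift_product_def)

lemma shift_product_closed: "A \<in> kernels \<Longrightarrow> C \<in> kernels \<Longrightarrow> shift_product A ws C \<in> kernels"
  by (induction ws arbitrary: C) (auto simp del: kmult_linear)

lemma shift_product_mult: "shift_product A ws (C \<star> D) = shift_product A ws C \<star> D"
  by (induction ws arbitrary: C) (auto simp: kmult_assoc[symmetric] simp del: kmult_linear)

text \<open>
  The Cayley-Hamilton theorem for a triangular matrix.  The product of the first \<open>k\<close> factors vanishes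
  on the span of the first \<open>k\<close> basis vectors, since the factor number \<open>k\<close> maps the vector number \<open>k\<close>
  into the span of the previous ones.
\<close>
lemma triangular_annihilated:
  fixes B :: "'g \<Rightarrow> 'g \<Rightarrow> complex"
  assumes B: "B \<in> kernels" and h: "bij_betw h {..<card X} X"
    and tri: "\<And>i j. i < j \<Longrightarrow> j < card X \<Longrightarrow> B (h j) (h i) = 0"
  shows "shift_product B (rev (map (\<lambda>i. B (h i) (h i)) [0..<card X])) \<I> = 0"
proof -
  let ?d = "\<lambda>i. B (h i) (h i)"
  have hX: "h i \<in> X" if "i < card X" for i using h that by (auto simp: bij_betw_def)
  have hinj: "h i = h j \<longleftrightarrow> i = j" if "i < card X" "j < card X" for i j
    using h that by (auto simp: bij_betw_def inj_on_def)
  define f where "f k = shift_product B (rev (map ?d [0..<k])) \<I>" for k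
  have f_in: "f k \<in> kernels" for k using B by (auto simp: f_def intro: shift_product_closed)
  have f_Suc: "f (Suc k) = f k \<star> (B - ?d k \<cdot> \<I>)" for k
    using B by (simp add: f_def shift_product_mult[symmetric] del: kmult_linear)
  have "\<forall>x. \<forall>l<k. f k x (h l) = 0" if "k \<le> card X" for k
    using that
  proof (induction k)
    case (Suc k)
    show ?case
    proof (intro allI impI)
      fix x l assume l: "l < Suc k"
      have "f (Suc k) x (h l) = (\<Sum>z\<in>X. f k x z * (B z (h l) - ?d k * \<I> z (h l)))"
        unfolding f_Suc by (simp only: kmult_def kscale_def minus_apply)
      also have "\<dots> = (\<Sum>j<card X. f k x (h j) * (B (h j) (h l) - ?d k * \<I> (h j) (h l)))"
        by (rule sum.reindex_bij_betw[OF h, symmetric])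
      also have "\<dots> = 0"
      proof (rule sum.neutral, intro ballI)
        fix j assume "j \<in> {..<card X}"
        then have j: "j < card X" by simp
        consider "j < k" | "j \<ge> k" "l < j" | "j = k" "l = k" using l by linarith
        then show "f k x (h j) * (B (h j) (h l) - ?d k * \<I> (h j) (h l)) = 0"
        proof cases
          case 1 then show ?thesis using Suc by simp
        next
          case 2 then show ?thesis using tri[of l j] j l Suc.prems by (simp add: kone_def hinj)
        next
          case 3 then show ?thesis using j by (simp add: kone_def hX)
        qed
      qed
      finally show "f (Suc k) x (h l) = 0" .
    qed
  qed simp
  then have zero: "f (card X) x (h l) = 0" if "l < card X" for x l using that by blast
  have "f (card X) = 0"
  proof (rule kernel_eqI)
    fix x y assume "y \<in> X"
    then obtain l where "l < card X" "y = h l" using h by (auto simp: bij_betw_def)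
    then show "f (card X) x y = 0 x y" using zero by simp
  qed (auto simp: f_in)
  then show ?thesis by (simp add: f_def)
qed

lemma ex_annihilating_list:
  fixes A :: "'g \<Rightarrow> 'g \<Rightarrow> complex"
  assumes A: "A \<in> kernels"
  shows "\<exists>ws. shift_product A ws \<I> = 0"
proof -
  from triangular_form[OF A] obtain B P Q h where *: "B \<in> kernels" "P \<in> kernels" "Q \<in> kernels" "A = P \<star> B \<star> Q" "P \<star> Q = \<I>" "Q \<star> P = \<I>"
    "bij_betw h {..<card X} X" and tri: "\<And>i j. i < j \<Longrightarrow> j < card X \<Longrightarrow> B (h j) (h i) = 0" by metis
  let ?ws = "rev (map (\<lambda>i. B (h i) (h i)) [0..<card X])"
  have step: "(A - w \<cdot> \<I>) \<star> (P \<star> C) = P \<star> ((B - w \<cdot> \<I>) \<star> C)" if "C \<in> kernels" for w C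
  proof -
    have "A \<star> P = P \<star> B" using * by (simp add: kmult_assoc)
    then have "A \<star> (P \<star> C) = P \<star> (B \<star> C)" by (metis kmult_assoc)
    then show ?thesis using * that by simp
  qed
  have "shift_product A ws (P \<star> C) = P \<star> shift_product B ws C" if "C \<in> kernels" for ws C
    using that
  proof (induction ws arbitrary: C)
    case (Cons w ws)
    then show ?case using *(1) by (simp add: step del: kmult_linear)
  qed simp
  then have "shift_product A ?ws P = P \<star> shift_product B ?ws \<I>"
    using *(2) by (metis kernels_closed(1) kmult_one(2))
  then have "shift_product A ?ws P = 0"
    using triangular_annihilated[OF *(1) *(7) tri] by simp
  then have "shift_product A ?ws (P \<star> Q) = 0" by (simp add: shift_product_mult)
  then show ?thesis using *(5) by auto
qed

text \<open>
  The trace of an idempotent is its rank.  In triangular form the diagonal entries are \<open>0\<close> or \<open>1\<close>; if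
  all of them vanish, then the idempotent is nilpotent, hence zero.
\<close>
lemma ktrace_idempotent:
  fixes E :: "'g \<Rightarrow> 'g \<Rightarrow> complex"
  assumes E: "E \<in> kernels" "E \<star> E = E"
  shows "ktrace E \<in> \<nat>" and "ktrace E = 0 \<Longrightarrow> E = 0"
proof -
  from triangular_form[OF E(1)] obtain B P Q h where *: "B \<in> kernels" "P \<in> kernels" "Q \<in> kernels" "E = P \<star> B \<star> Q" "P \<star> Q = \<I>" "Q \<star> P = \<I>"
    and h: "bij_betw h {..<card X} X" and tri: "\<And>i j. i < j \<Longrightarrow> j < card X \<Longrightarrow> B (h j) (h i) = 0" by metis
  have BE: "B = Q \<star> E \<star> P"
  proof -
    have "Q \<star> E \<star> P = (Q \<star> P) \<star> B \<star> (Q \<star> P)" by (simp add: *(4) kmult_assoc)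
    then show ?thesis using * by simp
  qed
  have "B \<star> B = Q \<star> E \<star> (P \<star> Q) \<star> (E \<star> P)" by (simp add: BE kmult_assoc)
  also have "\<dots> = Q \<star> (E \<star> E) \<star> P" using * E(1) by (simp add: kmult_assoc)
  finally have BB: "B \<star> B = B" by (simp add: E(2) BE)
  have diag: "B (h i) (h i) \<in> {0, 1}" if i: "i < card X" for i
  proof -
    have "B (h i) (h i) = (B \<star> B) (h i) (h i)" by (simp add: BB)
    also have "\<dots> = (\<Sum>j<card X. B (h i) (h j) * B (h j) (h i))"
      unfolding kmult_def by (rule sum.reindex_bij_betw[OF h, symmetric])
    also have "\<dots> = (\<Sum>j\<in>{i}. B (h i) (h j) * B (h j) (h i))"
    proof (rule sum.mono_neutral_right)
      show "\<forall>j\<in>{..<card X} - {i}. B (h i) (h j) * B (h j) (h i) = 0"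
        using tri i by (metis DiffE lessThan_iff insertI1 linorder_neqE_nat mult_eq_0_iff)
    qed (use i in auto)
    finally have "B (h i) (h i) * (B (h i) (h i) - 1) = 0" by (simp add: algebra_simps)
    then show ?thesis by auto
  qed
  have "ktrace E = ktrace B"
    using ktrace_commute[of "P \<star> B" Q] * by (simp add: kmult_assoc[symmetric])
  also have "\<dots> = (\<Sum>i<card X. B (h i) (h i))"
    unfolding ktrace_def by (rule sum.reindex_bij_betw[OF h, symmetric])
  also have "\<dots> = (\<Sum>i<card X. of_nat (of_bool (B (h i) (h i) = 1)))"
    by (rule sum.cong) (use diag in auto)
  finally have tr: "ktrace E = of_nat (\<Sum>i<card X. of_bool (B (h i) (h i) = 1))" by simp
  then show "ktrace E \<in> \<nat>" by (metis of_nat_in_Nats)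
  assume "ktrace E = 0"
  then have "(\<Sum>i<card X. of_bool (B (h i) (h i) = 1)) = (0::nat)" using tr by (metis of_nat_eq_0_iff)
  then have d0: "B (h i) (h i) = 0" if "i < card X" for i
    using that diag[OF that] by auto
  have "shift_product B (rev (map (\<lambda>i. B (h i) (h i)) [0..<card X])) \<I> \<star> B = 0"
    using triangular_annihilated[OF *(1) h tri] by simp
  moreover have "rev (map (\<lambda>i. B (h i) (h i)) [0..<card X]) = replicate (card X) 0"
    using d0 by (intro nth_equalityI) (auto simp: rev_nth)
  moreover have "shift_product B (replicate k 0) \<I> \<star> B = B" for k
  proof -
    have "shift_product B (replicate k 0) B = B" by (induction k) (simp_all add: BB)
    then show ?thesis using *(1) by (simp add: shift_product_mult[symmetric])
  qed
  ultimately have "B = 0" by simp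
  then show "E = 0" using *(4) by simp
qed

section \<open>Spectral decomposition of normal kernels\<close>

lemma kadjoint_mult_self_eq_0:
  fixes A :: "'g \<Rightarrow> 'g \<Rightarrow> complex"
  assumes "A \<in> kernels" "kadjoint A \<star> A = 0"
  shows "A = 0"
proof (rule kernel_eqI)
  fix x y assume x: "x \<in> X"
  have "(\<Sum>z\<in>X. cmod (A z y) ^ 2) = 0"
  proof -
    have "complex_of_real (\<Sum>z\<in>X. cmod (A z y) ^ 2) = (kadjoint A \<star> A) y y"
      by (simp add: kmult_def kadjoint_def complex_norm_square mult.commute del: of_real_power)
    then show ?thesis using assms(2) by (metis of_real_eq_0_iff zero_fun_apply)
  qed
  then have "cmod (A x y) ^ 2 = 0"
    using x finite_X by (subst (asm) sum_nonneg_eq_0_iff) auto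
  then show "A x y = 0 x y" by simp
qed (use assms in auto)

text \<open>
  For normal \<open>A\<close> with \<open>A\<^sup>2 = 0\<close> the self-adjoint matrix \<open>H = A\<^sup>*A\<close> satisfies \<open>H\<^sup>*H = 0\<close>, and \<open>H = 0\<close>
  forces \<open>A = 0\<close>, because the diagonal of \<open>A\<^sup>*A\<close> consists of the squared norms of the columns of \<open>A\<close>.
\<close>
lemma normal_square_eq_0:
  fixes A :: "'g \<Rightarrow> 'g \<Rightarrow> complex"
  assumes A: "A \<in> kernels" and normal: "kadjoint A \<star> A = A \<star> kadjoint A" and sq: "A \<star> A = 0"
  shows "A = 0"
proof -
  let ?H = "kadjoint A \<star> A"
  have "kadjoint ?H \<star> ?H = kadjoint A \<star> (A \<star> kadjoint A) \<star> A" by (simp add: kmult_assoc)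
  also have "\<dots> = kadjoint A \<star> kadjoint A \<star> (A \<star> A)" by (subst normal[symmetric]) (simp only: kmult_assoc)
  finally have "kadjoint ?H \<star> ?H = 0" by (simp only: sq kmult_linear(8))
  then have "?H = 0" by (rule kadjoint_mult_self_eq_0[rotated]) (use A in simp)
  then show ?thesis using A by (rule kadjoint_mult_self_eq_0[rotated])
qed

lemma shift_product_commute:
  assumes "A \<in> kernels" "Z \<in> kernels" "Z \<star> A = A \<star> Z" "C \<in> kernels"
  shows "Z \<star> shift_product A ws C = shift_product A ws (Z \<star> C)"
  using assms(4)
proof (induction ws arbitrary: C)
  case (Cons w ws)
  have "Z \<star> ((A - w \<cdot> \<I>) \<star> C) = (A - w \<cdot> \<I>) \<star> (Z \<star> C)"
    using assms Cons.prems by (simp add: kmult_assoc[symmetric])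
  then show ?case using Cons assms by (simp del: kmult_linear)
qed simp

text \<open>
  The minimal polynomial of a normal matrix has simple roots: if a shortest annihilating list
  contained \<open>w\<close> twice, then the product without one of the factors \<open>A - w\<close> would be a normal matrix
  with square zero.
\<close>
lemma ex_distinct_annihilating_list:
  fixes A :: "'g \<Rightarrow> 'g \<Rightarrow> complex"
  assumes A: "A \<in> kernels" and normal: "kadjoint A \<star> A = A \<star> kadjoint A"
  shows "\<exists>ws. distinct ws \<and> shift_product A ws \<I> = 0"
proof -
  let ?p = "\<lambda>ws. shift_product A ws \<I>"
  obtain ws where ws: "?p ws = 0" and least: "\<And>vs. ?p vs = 0 \<Longrightarrow> length ws \<le> length vs"
    using ex_has_least_nat[of "\<lambda>ws. ?p ws = 0" _ length] ex_annihilating_list[OF A] by blast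
  have closed: "?p us \<in> kernels" for us using A by (simp add: shift_product_closed)
  have comm: "Z \<star> ?p us = ?p us \<star> Z" if "Z \<in> kernels" "Z \<star> A = A \<star> Z" for Z us
    using shift_product_commute[OF A that, of \<I> us] that by (simp add: shift_product_mult[symmetric])
  have compose: "shift_product A us (?p vs) = ?p us \<star> ?p vs" for us vs
    using closed[of vs] by (simp add: shift_product_mult[symmetric])
  have commA: "A \<star> ?p us = ?p us \<star> A" for us using comm[of A] A by simp
  have commp: "?p us \<star> ?p vs = ?p vs \<star> ?p us" for us vs
    using comm[OF closed commA[symmetric]] .
  have normal_p: "kadjoint (?p us) \<star> ?p us = ?p us \<star> kadjoint (?p us)" for us
  proof -
    have "kadjoint A \<star> ?p us = ?p us \<star> kadjoint A" using comm A normal by simp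
    then have "kadjoint (kadjoint A \<star> ?p us) = kadjoint (?p us \<star> kadjoint A)" by simp
    then have "kadjoint (?p us) \<star> A = A \<star> kadjoint (?p us)" by simp
    then show ?thesis using comm closed by simp
  qed
  have "distinct ws"
  proof (rule ccontr)
    assume "\<not> distinct ws"
    then obtain xs ys zs w where dec: "ws = xs @ [w] @ ys @ [w] @ zs" using not_distinct_decomp by blast
    let ?r = "xs @ ys @ zs"
    let ?S = "?p [w]"
    have S: "?S = A - w \<cdot> \<I>" using A by simp
    have app: "?p (us @ vs) = ?p us \<star> ?p vs" for us vs
      by (simp add: compose commp)
    have "?p ws = ?p xs \<star> (?S \<star> (?p ys \<star> (?S \<star> ?p zs)))" unfolding dec by (simp only: app)
    also have "\<dots> = ?S \<star> (?S \<star> (?p xs \<star> (?p ys \<star> ?p zs)))"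
      by (metis (no_types, lifting) commp kmult_assoc)
    also have "\<dots> = ?S \<star> (?S \<star> ?p ?r)" by (simp only: app)
    finally have z: "?S \<star> (?S \<star> ?p ?r) = 0" using ws by simp
    have "?p ([w] @ ?r) \<star> ?p ([w] @ ?r) = ?S \<star> ?p ?r \<star> (?S \<star> ?p ?r)" by (simp only: app)
    also have "\<dots> = (?S \<star> (?S \<star> ?p ?r)) \<star> ?p ?r" by (metis (no_types, lifting) commp kmult_assoc)
    finally have "?p ([w] @ ?r) \<star> ?p ([w] @ ?r) = 0" unfolding z kmult_linear(7) .
    then have "?p ([w] @ ?r) = 0" by (rule normal_square_eq_0[OF closed normal_p])
    then have "length ws \<le> length ([w] @ ?r)" by (rule least)
    with dec show False by simp
  qed
  with ws show ?thesis by blast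
qed

text \<open>
  Partial fractions, one factor at a time.  If \<open>(A - w)C\<close> is the sum of eigenmatrices \<open>f v\<close> with
  eigenvalues \<open>v \<noteq> w\<close>, then subtracting \<open>f v / (v - w)\<close> for all \<open>v\<close> from \<open>C\<close> leaves an eigenmatrix for \<open>w\<close>.
  The summands are polynomials in \<open>A\<close> applied to \<open>C\<close>; of this only the consequence is recorded that
  they commute with everything that commutes with \<open>A\<close> and \<open>C\<close>.
\<close>
lemma spectral_split:
  fixes C :: "'g \<Rightarrow> 'g \<Rightarrow> complex"
  assumes A: "A \<in> kernels" and "distinct ws" and "C \<in> kernels" and "shift_product A ws C = 0"
  shows "\<exists>f. (\<forall>w. f w \<in> kernels) \<and> (\<forall>w\<in>set ws. A \<star> f w = w \<cdot> f w) \<and> C = (\<Sum>w\<in>set ws. f w)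
    \<and> (\<forall>Z\<in>kernels. Z \<star> A = A \<star> Z \<longrightarrow> Z \<star> C = C \<star> Z \<longrightarrow> (\<forall>w\<in>set ws. Z \<star> f w = f w \<star> Z))"
  using assms(2-4)
proof (induction ws arbitrary: C)
  case Nil
  then show ?case by (intro exI[of _ "\<lambda>_. 0"]) auto
next
  case (Cons w ws)
  let ?D = "(A - w \<cdot> \<I>) \<star> C"
  have D: "?D \<in> kernels" using A Cons.prems by (simp del: kmult_linear)
  have "distinct ws" using Cons.prems by simp
  moreover have "shift_product A ws ?D = 0" using Cons.prems(3) unfolding shift_product_simps .
  ultimately have dz: "distinct ws" "shift_product A ws ?D = 0" by blast+
  from Cons.IH[OF dz(1) D dz(2)] obtain f where f': "\<forall>v. f v \<in> kernels"
    "\<forall>v\<in>set ws. A \<star> f v = v \<cdot> f v" and f3: "?D = (\<Sum>v\<in>set ws. f v)"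
    and comm: "\<forall>Z\<in>kernels. Z \<star> A = A \<star> Z \<longrightarrow> Z \<star> ?D = ?D \<star> Z \<longrightarrow> (\<forall>v\<in>set ws. Z \<star> f v = f v \<star> Z)"
    by (elim exE conjE)
  note f = f'[rule_format] f3
  let ?e = "\<lambda>v. (1 / (v - w)) \<cdot> f v"
  let ?R = "C - (\<Sum>v\<in>set ws. ?e v)"
  let ?g = "\<lambda>v. if v = w then ?R else ?e v"
  have w: "w \<notin> set ws" using Cons.prems by simp
  have Ae: "(A - w \<cdot> \<I>) \<star> ?e v = f v" if v: "v \<in> set ws" for v
  proof -
    have "v \<noteq> w" using v w by blast
    have "(A - w \<cdot> \<I>) \<star> ?e v = (1 / (v - w)) \<cdot> ((v - w) \<cdot> f v)"
      using f(1) by (simp add: f(2)[OF v] kscale_distrib del: kscale_simps(1))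
    then show ?thesis using \<open>v \<noteq> w\<close> by simp
  qed
  have "(A - w \<cdot> \<I>) \<star> ?R = ?D - (\<Sum>v\<in>set ws. (A - w \<cdot> \<I>) \<star> ?e v)"
    by (simp only: kmult_linear(4) kmult_sum)
  also have "\<dots> = 0" using Ae f(3) by (simp del: kmult_linear)
  finally have "A \<star> ?R - w \<cdot> (\<I> \<star> ?R) = 0" by (simp only: kmult_linear(3,5))
  then have R: "A \<star> ?R = w \<cdot> ?R"
    using Cons.prems f(1) by (subst (asm) kmult_one) (auto intro!: kernels_closed(6) kernels_sum)
  have "Z \<star> ?g v = ?g v \<star> Z" if Z: "Z \<in> kernels" "Z \<star> A = A \<star> Z" "Z \<star> C = C \<star> Z" "v \<in> insert w (set ws)" for Z v
  proof -
    have "Z \<star> ?D = (Z \<star> A) \<star> C - w \<cdot> (Z \<star> C)" using Cons.prems(2) by (simp add: kmult_assoc)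
    also have "\<dots> = ?D \<star> Z" using Z(2,3) Cons.prems(2) by (simp add: kmult_assoc)
    finally have "Z \<star> f v = f v \<star> Z" if "v \<in> set ws" for v using comm Z that by blast
    then show ?thesis using Z by (auto simp: kmult_sum)
  qed
  moreover have "(\<Sum>v\<in>set (w # ws). ?g v) = C"
  proof -
    have "(\<Sum>v\<in>set ws. ?g v) = (\<Sum>v\<in>set ws. ?e v)" by (rule sum.cong) (use w in auto)
    then show ?thesis using w by simp
  qed
  moreover have "A \<star> ?g v = v \<cdot> ?g v" if "v \<in> set (w # ws)" for v
    using that R f(2) by (auto simp: mult.commute)
  moreover have "?g v \<in> kernels" for v
    using f(1) Cons.prems by (auto intro!: kernels_closed(6) kernels_sum)
  ultimately show ?case by (intro exI[of _ ?g]) auto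
qed

text \<open>
  The eigenprojections of a normal matrix.  Splitting the identity gives eigenmatrices that commute
  with \<open>A\<close> and hence annihilate each other, so they are idempotents.
\<close>
lemma spectral_decomposition:
  fixes A :: "'g \<Rightarrow> 'g \<Rightarrow> complex"
  assumes A: "A \<in> kernels" and normal: "kadjoint A \<star> A = A \<star> kadjoint A"
  obtains W and e :: "complex \<Rightarrow> 'g \<Rightarrow> 'g \<Rightarrow> complex" where "finite W" "\<I> = (\<Sum>w\<in>W. e w)"
    "\<And>w. w \<in> W \<Longrightarrow> e w \<in> kernels" "\<And>w. w \<in> W \<Longrightarrow> e w \<noteq> 0"
    "\<And>w. w \<in> W \<Longrightarrow> A \<star> e w = w \<cdot> e w" "\<And>w. w \<in> W \<Longrightarrow> e w \<star> e w = e w"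
    "\<And>w Z. w \<in> W \<Longrightarrow> Z \<in> kernels \<Longrightarrow> Z \<star> A = A \<star> Z \<Longrightarrow> Z \<star> e w = e w \<star> Z"
proof -
  obtain ws where ws: "distinct ws" "shift_product A ws \<I> = 0"
    using ex_distinct_annihilating_list[OF assms] by blast
  from spectral_split[OF A ws(1) kernels_closed(1) ws(2)] obtain f where f': "\<forall>w. f w \<in> kernels"
    "\<forall>w\<in>set ws. A \<star> f w = w \<cdot> f w" and f3: "\<I> = (\<Sum>w\<in>set ws. f w)"
    and comm': "\<forall>Z\<in>kernels. Z \<star> A = A \<star> Z \<longrightarrow> Z \<star> \<I> = \<I> \<star> Z \<longrightarrow> (\<forall>w\<in>set ws. Z \<star> f w = f w \<star> Z)"
    by (elim exE conjE)
  note f = f'[rule_format] f3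
  have comm: "Z \<star> f w = f w \<star> Z" if "Z \<in> kernels" "Z \<star> A = A \<star> Z" "w \<in> set ws" for Z w
    using comm' that by simp
  let ?W = "{w \<in> set ws. f w \<noteq> 0}"
  have sum: "\<I> = (\<Sum>w\<in>?W. f w)"
    unfolding f(3) by (rule sum.mono_neutral_right) auto
  \<comment> \<open>v f(v) f(w) = A f(v) f(w) = f(v) A f(w) = w f(v) f(w)\<close>
  have orth: "f v \<star> f w = 0" if "v \<in> set ws" "w \<in> set ws" "v \<noteq> w" for v w
  proof -
    have "v \<cdot> (f v \<star> f w) = A \<star> f v \<star> f w" by (simp add: f(2)[OF that(1)])
    also have "\<dots> = f v \<star> (A \<star> f w)" using comm[OF A _ that(1)] by (simp add: kmult_assoc)
    also have "\<dots> = w \<cdot> (f v \<star> f w)" by (simp add: f(2)[OF that(2)])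
    finally have "(v - w) \<cdot> (f v \<star> f w) = 0" by (simp add: kscale_distrib)
    then have "(1 / (v - w)) \<cdot> (v - w) \<cdot> (f v \<star> f w) = 0" by (metis kscale_simps(4))
    then show ?thesis using that(3) by simp
  qed
  have idem: "f w \<star> f w = f w" if w: "w \<in> ?W" for w
  proof -
    have "f w = f w \<star> \<I>" using f(1) by simp
    also have "\<dots> = (\<Sum>v\<in>?W. f w \<star> f v)" by (subst sum) (rule kmult_sum)
    also have "\<dots> = (\<Sum>v\<in>{w}. f w \<star> f v)"
      by (rule sum.mono_neutral_right) (use w orth in auto)
    finally show ?thesis by simp
  qed
  show ?thesis by (rule that[of ?W f]) (use sum f comm idem in auto)
qed

end

section \<open>Traces of matrices of finite order\<close>

context kernel_algebra
begin

abbreviation kpow :: "('g \<Rightarrow> 'g \<Rightarrow> complex) \<Rightarrow> nat \<Rightarrow> 'g \<Rightarrow> 'g \<Rightarrow> complex" where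
  "kpow A n \<equiv> ((\<lambda>C. A \<star> C) ^^ n) \<I>"

text \<open>
  A matrix with \<open>A\<^sup>n = 1\<close> has \<open>n\<close>-th roots of unity as eigenvalues.
\<close>
lemma finite_order_spectrum:
  fixes A :: "'g \<Rightarrow> 'g \<Rightarrow> complex"
  assumes A: "A \<in> kernels" and normal: "kadjoint A \<star> A = A \<star> kadjoint A" and n: "kpow A n = \<I>" "n > 0"
  obtains W and f :: "complex \<Rightarrow> 'g \<Rightarrow> 'g \<Rightarrow> complex" where "finite W" "\<I> = (\<Sum>w\<in>W. f w)"
    "A = (\<Sum>w\<in>W. w \<cdot> f w)"
    "\<And>w. w \<in> W \<Longrightarrow> f w \<in> kernels" "\<And>w. w \<in> W \<Longrightarrow> w ^ n = 1" "\<And>w. w \<in> W \<Longrightarrow> f w \<star> f w = f w"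
    "\<And>w Z. w \<in> W \<Longrightarrow> Z \<in> kernels \<Longrightarrow> Z \<star> A = A \<star> Z \<Longrightarrow> Z \<star> f w = f w \<star> Z"
proof -
  obtain W and f :: "complex \<Rightarrow> 'g \<Rightarrow> 'g \<Rightarrow> complex"
    where W: "finite W" "\<I> = (\<Sum>w\<in>W. f w)"
      "\<And>w. w \<in> W \<Longrightarrow> f w \<in> kernels" "\<And>w. w \<in> W \<Longrightarrow> f w \<noteq> 0"
      "\<And>w. w \<in> W \<Longrightarrow> A \<star> f w = w \<cdot> f w" "\<And>w. w \<in> W \<Longrightarrow> f w \<star> f w = f w"
      "\<And>w Z. w \<in> W \<Longrightarrow> Z \<in> kernels \<Longrightarrow> Z \<star> A = A \<star> Z \<Longrightarrow> Z \<star> f w = f w \<star> Z"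
    by (rule spectral_decomposition[OF A normal]) (rule that; assumption)
  have "A = A \<star> \<I>" using A by simp
  also have "\<dots> = (\<Sum>w\<in>W. A \<star> f w)" by (simp only: W(2) kmult_sum)
  also have "\<dots> = (\<Sum>w\<in>W. w \<cdot> f w)" by (rule sum.cong) (simp_all add: W(5))
  finally have sum: "A = (\<Sum>w\<in>W. w \<cdot> f w)" .
  have "w ^ n = 1" if w: "w \<in> W" for w
  proof -
    have "kpow A m \<star> f w = w ^ m \<cdot> f w" for m
      by (induction m) (simp_all add: kmult_assoc W(3,5)[OF w] mult.commute)
    from this[of n] have "w ^ n \<cdot> f w = f w" using n W(3)[OF w] by simp
    moreover obtain x y where "f w x y \<noteq> 0" using W(4)[OF w] by (auto simp: fun_eq_iff)
    ultimately show ?thesis by (metis kscale_def mult_cancel_right1)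
  qed
  then show ?thesis using W(1,2,3,6,7) sum by (intro that[of W f])
qed

text \<open>
  Decompose \<open>A\<close> and \<open>B\<close> into eigenprojections.  The products of \<open>E\<close> with one projection of each are
  idempotents, so the trace of \<open>EAB\<close> is a sum of products of two roots of unity with natural numbers.
\<close>
lemma algebraic_int_ktrace:
  fixes A B E :: "'g \<Rightarrow> 'g \<Rightarrow> complex"
  assumes E: "E \<in> kernels" "E \<star> E = E"
    and A: "A \<in> kernels" "kadjoint A \<star> A = A \<star> kadjoint A" "kpow A n = \<I>" "n > 0"
    and B: "B \<in> kernels" "kadjoint B \<star> B = B \<star> kadjoint B" "kpow B m = \<I>" "m > 0"
    and comm: "E \<star> A = A \<star> E" "E \<star> B = B \<star> E" "A \<star> B = B \<star> A"
  shows "algebraic_int (ktrace (E \<star> A \<star> B))"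
proof -
  obtain W and f :: "complex \<Rightarrow> 'g \<Rightarrow> 'g \<Rightarrow> complex" where W: "A = (\<Sum>w\<in>W. w \<cdot> f w)"
    "\<And>w. w \<in> W \<Longrightarrow> f w \<in> kernels" "\<And>w. w \<in> W \<Longrightarrow> w ^ n = 1" "\<And>w. w \<in> W \<Longrightarrow> f w \<star> f w = f w"
    "\<And>w Z. w \<in> W \<Longrightarrow> Z \<in> kernels \<Longrightarrow> Z \<star> A = A \<star> Z \<Longrightarrow> Z \<star> f w = f w \<star> Z"
    by (rule finite_order_spectrum[OF A]) (rule that; assumption)
  obtain V and h :: "complex \<Rightarrow> 'g \<Rightarrow> 'g \<Rightarrow> complex" where V: "B = (\<Sum>w\<in>V. w \<cdot> h w)"
    "\<And>w. w \<in> V \<Longrightarrow> h w \<in> kernels" "\<And>w. w \<in> V \<Longrightarrow> w ^ m = 1" "\<And>w. w \<in> V \<Longrightarrow> h w \<star> h w = h w"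
    "\<And>w Z. w \<in> V \<Longrightarrow> Z \<in> kernels \<Longrightarrow> Z \<star> B = B \<star> Z \<Longrightarrow> Z \<star> h w = h w \<star> Z"
    by (rule finite_order_spectrum[OF B]) (rule that; assumption)
  have idem: "ktrace (E \<star> f v \<star> h w) \<in> \<nat>" if v: "v \<in> W" and w: "w \<in> V" for v w
  proof (rule ktrace_idempotent)
    have 1: "E \<star> f v = f v \<star> E" using W(5)[OF v E(1) comm(1)] .
    have 2: "E \<star> h w = h w \<star> E" using V(5)[OF w E(1) comm(2)] .
    have 3: "B \<star> f v = f v \<star> B" using W(5)[OF v B(1)] comm(3) by simp
    have 4: "f v \<star> h w = h w \<star> f v" using V(5)[OF w W(2)[OF v]] 3 by simp
    have "E \<star> f v \<star> h w \<star> (E \<star> f v \<star> h w) = E \<star> (f v \<star> (h w \<star> E) \<star> (f v \<star> h w))"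
      by (simp only: kmult_assoc)
    also have "\<dots> = E \<star> ((f v \<star> E) \<star> (h w \<star> f v) \<star> h w)" by (simp only: 2[symmetric] kmult_assoc)
    also have "\<dots> = (E \<star> E) \<star> (f v \<star> f v) \<star> (h w \<star> h w)" by (simp only: 1[symmetric] 4[symmetric] kmult_assoc)
    finally show "E \<star> f v \<star> h w \<star> (E \<star> f v \<star> h w) = E \<star> f v \<star> h w"
      by (simp only: E W(4)[OF v] V(4)[OF w])
  qed (use E W(2)[OF v] V(2)[OF w] in auto)
  have "E \<star> A \<star> B = (\<Sum>v\<in>W. \<Sum>w\<in>V. (v * w) \<cdot> (E \<star> f v \<star> h w))"
  proof -
    have "E \<star> A \<star> B = (\<Sum>v\<in>W. E \<star> (v \<cdot> f v)) \<star> (\<Sum>w\<in>V. w \<cdot> h w)"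
      by (simp only: W(1) V(1) kmult_sum)
    also have "\<dots> = (\<Sum>v\<in>W. \<Sum>w\<in>V. (E \<star> (v \<cdot> f v)) \<star> (w \<cdot> h w))"
      by (simp only: kmult_sum) (rule sum.swap)
    finally show ?thesis by (simp add: mult.commute)
  qed
  then have "ktrace (E \<star> A \<star> B) = (\<Sum>v\<in>W. \<Sum>w\<in>V. (v * w) * ktrace (E \<star> f v \<star> h w))"
    by (simp only: ktrace_sum ktrace_simps)
  also have "algebraic_int \<dots>"
  proof (intro algebraic_int_sum algebraic_int_add_mult(2))
    fix v w assume v: "v \<in> W" and w: "w \<in> V"
    show "algebraic_int v" "algebraic_int w"
      using W(3)[OF v] V(3)[OF w] A(4) B(4) algebraic_int_root_of_unity by auto
    show "algebraic_int (ktrace (E \<star> f v \<star> h w))"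
      using idem[OF v w] by (auto elim!: Nats_cases)
  qed
  finally show ?thesis .
qed

text \<open>
  Equality in the triangle inequality: a weighted mean of unit complex
  numbers lies on the unit circle only if all numbers of nonzero weight coincide with it.
\<close>
lemma weighted_unit_sum_extremal:
  fixes d :: "complex \<Rightarrow> real" and t w :: complex
  assumes "finite W" "\<And>w. w \<in> W \<Longrightarrow> cmod w = 1" "\<And>w. w \<in> W \<Longrightarrow> d w \<ge> 0"
    and t: "cmod t = 1" and eq: "(\<Sum>w\<in>W. d w * w) = (\<Sum>w\<in>W. d w) * t" and w: "w \<in> W" "d w \<noteq> 0"
  shows "w = t"
proof -
  have tt: "t * cnj t = 1" using t complex_norm_square[of t] by simp
  have le: "Re (v * cnj t) \<le> 1" if "v \<in> W" for v
    using complex_Re_le_cmod[of "v * cnj t"] assms(2)[OF that] t by (simp add: norm_mult)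
  have "(\<Sum>v\<in>W. d v * (v * cnj t)) = (\<Sum>v\<in>W. d v * v) * cnj t"
    by (simp add: sum_distrib_right mult.assoc)
  also have "\<dots> = complex_of_real (\<Sum>v\<in>W. d v)" unfolding eq using tt by (simp add: mult.assoc)
  finally have "Re (\<Sum>v\<in>W. d v * (v * cnj t)) = (\<Sum>v\<in>W. d v)" by simp
  then have "(\<Sum>v\<in>W. d v * (1 - Re (v * cnj t))) = 0"
    by (simp add: algebra_simps sum_subtractf)
  then have "d w * (1 - Re (w * cnj t)) = 0"
    using w assms le by (subst (asm) sum_nonneg_eq_0_iff) auto
  then have re: "Re (w * cnj t) = 1" using w by simp
  have "cmod (w * cnj t) = 1" using assms(2)[OF w(1)] t by (simp add: norm_mult)
  then have "(Re (w * cnj t))\<^sup>2 + (Im (w * cnj t))\<^sup>2 = 1" by (simp add: cmod_def del: times_complex.sel)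
  then have "w * cnj t = 1" using re by (simp add: complex_eq_iff del: times_complex.sel)
  then have "w * (t * cnj t) = t" by (simp add: mult.left_commute)
  then show ?thesis using tt by simp
qed

text \<open>
  The image of \<open>E\<close> is the direct sum of its intersections with the eigenspaces of \<open>A\<close>, and the trace of
  \<open>EA\<close> is the mean of the eigenvalues times the rank of \<open>E\<close>.  If this mean has absolute value \<open>1\<close>, then
  \<open>A\<close> acts as a scalar on the image of \<open>E\<close>.
\<close>
lemma ktrace_finite_order:
  fixes A E :: "'g \<Rightarrow> 'g \<Rightarrow> complex"
  assumes E: "E \<in> kernels" "E \<star> E = E"
    and A: "A \<in> kernels" "kadjoint A \<star> A = A \<star> kadjoint A" "kpow A n = \<I>" "n > 0"
    and comm: "E \<star> A = A \<star> E" and t: "ktrace (E \<star> A) = ktrace E * t" "cmod t = 1"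
  shows "A \<star> E = t \<cdot> E"
proof -
  obtain W and f :: "complex \<Rightarrow> 'g \<Rightarrow> 'g \<Rightarrow> complex" where W: "finite W" "\<I> = (\<Sum>w\<in>W. f w)" "A = (\<Sum>w\<in>W. w \<cdot> f w)"
    "\<And>w. w \<in> W \<Longrightarrow> f w \<in> kernels" "\<And>w. w \<in> W \<Longrightarrow> w ^ n = 1" "\<And>w. w \<in> W \<Longrightarrow> f w \<star> f w = f w"
    "\<And>w Z. w \<in> W \<Longrightarrow> Z \<in> kernels \<Longrightarrow> Z \<star> A = A \<star> Z \<Longrightarrow> Z \<star> f w = f w \<star> Z"
    by (rule finite_order_spectrum[OF A]) (rule that; assumption)
  have EA: "E \<star> A = (\<Sum>w\<in>W. w \<cdot> (E \<star> f w))" by (simp only: W(3) kmult_sum kmult_linear)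
  have E1: "E = (\<Sum>w\<in>W. E \<star> f w)"
    using kmult_one(2)[OF E(1)] by (simp only: W(2) kmult_sum)
  have idem: "E \<star> f w \<in> kernels" "E \<star> f w \<star> (E \<star> f w) = E \<star> f w" if w: "w \<in> W" for w
  proof -
    have 1: "E \<star> f w = f w \<star> E" using W(7)[OF w E(1) comm] .
    have "E \<star> f w \<star> (E \<star> f w) = E \<star> (f w \<star> E) \<star> f w" by (simp only: kmult_assoc)
    also have "\<dots> = (E \<star> E) \<star> (f w \<star> f w)" by (simp only: 1[symmetric] kmult_assoc)
    finally show "E \<star> f w \<star> (E \<star> f w) = E \<star> f w" by (simp only: E(2) W(6)[OF w])
  qed (use E W(4)[OF w] in auto)
  define d where "d w = Re (ktrace (E \<star> f w))" for w
  have d: "ktrace (E \<star> f w) = complex_of_real (d w)" "d w \<ge> 0" if "w \<in> W" for w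
    using ktrace_idempotent(1)[OF idem[OF that]] by (auto simp: d_def elim!: Nats_cases)
  have "(\<Sum>w\<in>W. complex_of_real (d w) * w) = ktrace (E \<star> A)"
    unfolding EA ktrace_sum by (rule sum.cong) (simp_all add: d mult.commute)
  also have "\<dots> = ktrace (\<Sum>w\<in>W. E \<star> f w) * t" using t(1) E1 by simp
  also have "ktrace (\<Sum>w\<in>W. E \<star> f w) = complex_of_real (\<Sum>w\<in>W. d w)"
    unfolding ktrace_sum of_real_sum by (rule sum.cong) (simp_all add: d)
  finally have sum: "(\<Sum>w\<in>W. complex_of_real (d w) * w) = complex_of_real (\<Sum>w\<in>W. d w) * t" .
  have unit: "cmod w = 1" if "w \<in> W" for w
    using W(5)[OF that] A(4) by (metis norm_one norm_power power_eq_1_iff norm_ge_zero gr_implies_not0)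
  have "w \<cdot> (E \<star> f w) = t \<cdot> (E \<star> f w)" if w: "w \<in> W" for w
  proof (cases "d w = 0")
    case True
    then have "ktrace (E \<star> f w) = 0" using d(1)[OF w] by simp
    then have "E \<star> f w = 0" by (rule ktrace_idempotent(2)[OF idem[OF w]])
    then show ?thesis by simp
  next
    case False
    then have "w = t" using weighted_unit_sum_extremal[of W d t w] W(1) unit d(2) t(2) sum w by auto
    then show ?thesis by simp
  qed
  then have "E \<star> A = (\<Sum>w\<in>W. t \<cdot> (E \<star> f w))" unfolding EA by (rule sum.cong[OF refl])
  also have "\<dots> = t \<cdot> E" using E1 by (simp only: kscale_sum[symmetric])
  finally show ?thesis using comm by simp
qed

lemma cmod_ktrace_finite_order_le:
  fixes A E :: "'g \<Rightarrow> 'g \<Rightarrow> complex"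
  assumes E: "E \<in> kernels" "E \<star> E = E"
    and A: "A \<in> kernels" "kadjoint A \<star> A = A \<star> kadjoint A" "kpow A n = \<I>" "n > 0"
    and comm: "E \<star> A = A \<star> E"
  shows "cmod (ktrace (E \<star> A)) \<le> cmod (ktrace E)"
proof -
  obtain W and f :: "complex \<Rightarrow> 'g \<Rightarrow> 'g \<Rightarrow> complex" where W: "finite W" "\<I> = (\<Sum>w\<in>W. f w)" "A = (\<Sum>w\<in>W. w \<cdot> f w)"
    "\<And>w. w \<in> W \<Longrightarrow> f w \<in> kernels" "\<And>w. w \<in> W \<Longrightarrow> w ^ n = 1" "\<And>w. w \<in> W \<Longrightarrow> f w \<star> f w = f w"
    "\<And>w Z. w \<in> W \<Longrightarrow> Z \<in> kernels \<Longrightarrow> Z \<star> A = A \<star> Z \<Longrightarrow> Z \<star> f w = f w \<star> Z"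
    by (rule finite_order_spectrum[OF A]) (rule that; assumption)
  have EA: "E \<star> A = (\<Sum>w\<in>W. w \<cdot> (E \<star> f w))" by (simp only: W(3) kmult_sum kmult_linear)
  have E1: "E = (\<Sum>w\<in>W. E \<star> f w)"
    using kmult_one(2)[OF E(1)] by (simp only: W(2) kmult_sum)
  have nat: "ktrace (E \<star> f w) \<in> \<nat>" if w: "w \<in> W" for w
  proof (rule ktrace_idempotent)
    have 1: "E \<star> f w = f w \<star> E" using W(7)[OF w E(1) comm] .
    have "E \<star> f w \<star> (E \<star> f w) = E \<star> (f w \<star> E) \<star> f w" by (simp only: kmult_assoc)
    also have "\<dots> = (E \<star> E) \<star> (f w \<star> f w)" by (simp only: 1[symmetric] kmult_assoc)
    finally show "E \<star> f w \<star> (E \<star> f w) = E \<star> f w" by (simp only: E(2) W(6)[OF w])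
  qed (use E W(4)[OF w] in auto)
  have unit: "cmod w = 1" if "w \<in> W" for w
    using W(5)[OF that] A(4) by (metis norm_one norm_power power_eq_1_iff norm_ge_zero gr_implies_not0)
  have "cmod (ktrace (E \<star> A)) \<le> (\<Sum>w\<in>W. cmod (w * ktrace (E \<star> f w)))"
    unfolding EA ktrace_sum by (simp add: sum_norm_le)
  also have "\<dots> = (\<Sum>w\<in>W. Re (ktrace (E \<star> f w)))"
  proof (rule sum.cong)
    fix w assume w: "w \<in> W"
    obtain k where "ktrace (E \<star> f w) = of_nat k" using nat[OF w] by (auto elim: Nats_cases)
    then show "cmod (w * ktrace (E \<star> f w)) = Re (ktrace (E \<star> f w))" using unit[OF w] by (simp add: norm_mult)
  qed simp
  also have "\<dots> = Re (ktrace E)" by (subst (2) E1) (simp add: ktrace_sum)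
  also have "\<dots> \<le> cmod (ktrace E)" by (rule complex_Re_le_cmod)
  finally show ?thesis .
qed

text \<open>
  This is the characteristic polynomial.  An eigenvector gives a matrix \<open>C\<close> all of whose columns are equal
  to it, and conversely a nonzero column of \<open>C\<close> is an eigenvector.
\<close>
lemma integer_kernel_char_poly:
  fixes A :: "'g \<Rightarrow> 'g \<Rightarrow> complex" and a :: "'g \<Rightarrow> 'g \<Rightarrow> int"
  assumes A: "A \<in> kernels" and a: "\<And>x y. A x y = of_int (a x y)"
  obtains \<chi> :: "int poly" where "lead_coeff \<chi> = 1"
    "\<And>z. poly (map_poly of_int \<chi>) z = 0 \<longleftrightarrow> (\<exists>C\<in>kernels. C \<noteq> 0 \<and> A \<star> C = z \<cdot> C)"
proof -
  let ?n = "card X"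
  obtain h where h: "bij_betw h {..<?n} X"
    using finite_X ex_bij_betw_nat_finite[of X] atLeast0LessThan by metis
  define g where "g = the_inv_into {..<?n} h"
  have gh: "g (h i) = i" if "i < ?n" for i
    using that h unfolding g_def by (intro the_inv_into_f_f) (auto simp: bij_betw_def)
  have hg: "h (g x) = x" and gn: "g x < ?n" if "x \<in> X" for x
  proof -
    from that h obtain i where i: "i < ?n" "x = h i" by (auto simp: bij_betw_def)
    then show "h (g x) = x" "g x < ?n" by (simp_all add: gh)
  qed
  have hX: "h i \<in> X" if "i < ?n" for i using h that by (auto simp: bij_betw_def)
  define M where "M = mat ?n ?n (\<lambda>(i,j). a (h i) (h j))"
  have M: "M \<in> carrier_mat ?n ?n" by (simp add: M_def)
  have M': "map_mat complex_of_int M \<in> carrier_mat ?n ?n" using M by simp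
  have entry: "(map_mat complex_of_int M *\<^sub>v v) $ i = (\<Sum>x\<in>X. A (h i) x * v $ g x)" if "i < ?n" "v \<in> carrier_vec ?n" for i v
  proof -
    have "(map_mat complex_of_int M *\<^sub>v v) $ i = (\<Sum>j<?n. A (h i) (h j) * v $ g (h j))"
      using that by (simp add: M_def scalar_prod_def atLeast0LessThan a gh)
    also have "\<dots> = (\<Sum>x\<in>X. A (h i) x * v $ g x)" by (rule sum.reindex_bij_betw[OF h])
    finally show ?thesis .
  qed
  have "poly (map_poly of_int (char_poly M)) z = 0 \<longleftrightarrow> (\<exists>C\<in>kernels. C \<noteq> 0 \<and> A \<star> C = z \<cdot> C)" (is "?l \<longleftrightarrow> ?r") for z :: complex
  proof -
    have "?l \<longleftrightarrow> eigenvalue (map_mat of_int M) z"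
      using eigenvalue_root_char_poly[OF M'] by (simp add: of_int_hom.char_poly_hom[OF M])
    also have "\<dots> \<longleftrightarrow> ?r"
    proof
      assume "eigenvalue (map_mat of_int M) z"
      then obtain v where v: "v \<in> carrier_vec ?n" "v \<noteq> 0\<^sub>v ?n" "map_mat of_int M *\<^sub>v v = z \<cdot>\<^sub>v v"
        using M by (auto simp: eigenvalue_def eigenvector_def)
      define C where "C x y = (if x \<in> X \<and> y \<in> X then v $ g x else 0)" for x y
      have C: "C \<in> kernels" by (auto simp: C_def intro: kernelsI)
      obtain i where i: "i < ?n" "v $ i \<noteq> 0" using v(1,2) by (auto simp: vec_eq_iff)
      then have "C (h i) (h i) \<noteq> 0" by (simp add: C_def hX gh)
      then have "C \<noteq> 0" by auto
      moreover have "A \<star> C = z \<cdot> C"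
      proof (rule kernel_eqI)
        fix x y assume xy: "x \<in> X" "y \<in> X"
        have "(A \<star> C) x y = (\<Sum>u\<in>X. A x u * v $ g u)"
          unfolding kmult_def using xy by (intro sum.cong) (auto simp: C_def)
        also have "\<dots> = (z \<cdot>\<^sub>v v) $ g x"
          using entry[OF gn[OF xy(1)] v(1)] v(3) by (simp add: hg xy)
        finally show "(A \<star> C) x y = (z \<cdot> C) x y" using v(1) xy gn by (simp add: kscale_def C_def)
      qed (use A C in auto)
      ultimately show ?r using C by blast
    next
      assume ?r
      then obtain C where C: "C \<in> kernels" "C \<noteq> 0" "A \<star> C = z \<cdot> C" by blast
      obtain x y where xy: "C x y \<noteq> 0" using C(2) by (auto simp: fun_eq_iff)
      then have x: "x \<in> X" using C(1) by (auto simp: kernels_def)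
      define v where "v = vec ?n (\<lambda>i. C (h i) y)"
      have v: "v \<in> carrier_vec ?n" by (simp add: v_def)
      have vg: "v $ g u = C u y" if "u \<in> X" for u using that by (simp add: v_def gn hg)
      have "v \<noteq> 0\<^sub>v ?n" using vg[OF x] xy gn[OF x] by auto
      moreover have "map_mat of_int M *\<^sub>v v = z \<cdot>\<^sub>v v"
      proof (rule eq_vecI)
        fix i assume "i < dim_vec (z \<cdot>\<^sub>v v)"
        then have i: "i < ?n" by (simp add: v_def)
        have "(map_mat complex_of_int M *\<^sub>v v) $ i = (\<Sum>x\<in>X. A (h i) x * C x y)"
          unfolding entry[OF i v] by (rule sum.cong) (auto simp: vg)
        also have "\<dots> = (z \<cdot> C) (h i) y" by (simp add: kmult_def flip: C(3))
        finally show "(map_mat complex_of_int M *\<^sub>v v) $ i = (z \<cdot>\<^sub>v v) $ i"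
          using i by (simp add: v_def kscale_def)
      qed (simp add: M_def v_def)
      ultimately show "eigenvalue (map_mat of_int M) z"
        unfolding eigenvalue_def eigenvector_def using M v by auto
    qed
    finally show ?thesis .
  qed
  then show ?thesis using that[of "char_poly M"] degree_monic_char_poly[OF M] by simp
qed

end

section \<open>Class sums in the regular representation\<close>

context group
begin

definition conj_class :: "'a \<Rightarrow> 'a set" where
  "conj_class g = (\<lambda>u. u \<otimes> g \<otimes> inv u) ` carrier G"

lemma conj_class_closed: "g \<in> carrier G \<Longrightarrow> conj_class g \<subseteq> carrier G"
  by (auto simp: conj_class_def)

lemma conj_class_conj:
  assumes "g \<in> carrier G" "u \<in> carrier G" "h \<in> conj_class g"
  shows "u \<otimes> h \<otimes> inv u \<in> conj_class g"
proof -
  obtain v where v: "v \<in> carrier G" "h = v \<otimes> g \<otimes> inv v" using assms by (auto simp: conj_class_def)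
  have "u \<otimes> h \<otimes> inv u = (u \<otimes> v) \<otimes> g \<otimes> inv (u \<otimes> v)"
    using assms v by (simp add: m_assoc inv_mult_group)
  then show ?thesis using assms v by (auto simp: conj_class_def)
qed

end

text \<open>
  The group acts on the complex functions on itself by left and by right translations, and the two
  actions commute.
\<close>
locale regular_representation = group G + kernel_algebra "carrier G" for G (structure)
begin

notation kmult (infixl "\<star>" 70)
notation kone ("\<I>")
notation kscale (infixr "\<cdot>" 75)

definition left_kernel :: "'a \<Rightarrow> 'a \<Rightarrow> 'a \<Rightarrow> complex" ("\<L>") where
  "\<L> h = (\<lambda>x y. of_bool (x \<in> carrier G \<and> y \<in> carrier G \<and> x = h \<otimes> y))"

definition right_kernel :: "'a \<Rightarrow> 'a \<Rightarrow> 'a \<Rightarrow> complex" ("\<R>") where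
  "\<R> h = (\<lambda>x y. of_bool (x \<in> carrier G \<and> y \<in> carrier G \<and> x = y \<otimes> h))"

lemma translation_kernels [simp]: "\<L> h \<in> kernels" "\<R> h \<in> kernels"
  by (auto simp: left_kernel_def right_kernel_def intro: kernelsI)

lemma left_kernel_mult:
  assumes "h \<in> carrier G" "x \<in> carrier G" "y \<in> carrier G"
  shows "(\<L> h \<star> A) x y = A (inv h \<otimes> x) y" "(A \<star> \<L> h) x y = A x (h \<otimes> y)"
proof -
  have "(\<L> h \<star> A) x y = (\<Sum>z\<in>carrier G. if z = inv h \<otimes> x then A z y else 0)"
    unfolding kmult_def left_kernel_def using assms
    by (intro sum.cong) (auto simp: m_assoc[symmetric] inv_solve_left)
  then show "(\<L> h \<star> A) x y = A (inv h \<otimes> x) y" using assms finite_X by simp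
  have "(A \<star> \<L> h) x y = (\<Sum>z\<in>carrier G. if z = h \<otimes> y then A x z else 0)"
    unfolding kmult_def left_kernel_def using assms by (intro sum.cong) auto
  then show "(A \<star> \<L> h) x y = A x (h \<otimes> y)" using assms finite_X by simp
qed

lemma right_kernel_mult:
  assumes "h \<in> carrier G" "x \<in> carrier G" "y \<in> carrier G"
  shows "(\<R> h \<star> A) x y = A (x \<otimes> inv h) y" "(A \<star> \<R> h) x y = A x (y \<otimes> h)"
proof -
  have "(\<R> h \<star> A) x y = (\<Sum>z\<in>carrier G. if z = x \<otimes> inv h then A z y else 0)"
    unfolding kmult_def right_kernel_def using assms
    by (intro sum.cong) (auto simp: m_assoc inv_solve_right)
  then show "(\<R> h \<star> A) x y = A (x \<otimes> inv h) y" using assms finite_X by simp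
  have "(A \<star> \<R> h) x y = (\<Sum>z\<in>carrier G. if z = y \<otimes> h then A x z else 0)"
    unfolding kmult_def right_kernel_def using assms by (intro sum.cong) auto
  then show "(A \<star> \<R> h) x y = A x (y \<otimes> h)" using assms finite_X by simp
qed

lemma left_left [simp]: "h \<in> carrier G \<Longrightarrow> k \<in> carrier G \<Longrightarrow> \<L> h \<star> \<L> k = \<L> (h \<otimes> k)"
  by (rule kernel_eqI) (auto simp: left_kernel_mult(2), auto simp: left_kernel_def m_assoc)

lemma right_right [simp]: "h \<in> carrier G \<Longrightarrow> k \<in> carrier G \<Longrightarrow> \<R> h \<star> \<R> k = \<R> (k \<otimes> h)"
  by (rule kernel_eqI) (auto simp: right_kernel_mult(2), auto simp: right_kernel_def m_assoc)

lemma left_right_commute: "h \<in> carrier G \<Longrightarrow> k \<in> carrier G \<Longrightarrow> \<R> k \<star> \<L> h = \<L> h \<star> \<R> k"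
  by (rule kernel_eqI) (simp_all add: left_kernel_mult(2) right_kernel_mult(2),
      auto simp: right_kernel_def left_kernel_def m_assoc)

lemma translation_one [simp]: "\<L> \<one> = \<I>" "\<R> \<one> = \<I>"
  by (auto simp: left_kernel_def right_kernel_def kone_def fun_eq_iff)

lemma translation_adjoint:
  assumes "h \<in> carrier G" shows "kadjoint (\<L> h) = \<L> (inv h)" "kadjoint (\<R> h) = \<R> (inv h)"
proof -
  show "kadjoint (\<L> h) = \<L> (inv h)"
    using assms by (intro ext) (auto simp: kadjoint_def left_kernel_def m_assoc[symmetric])
  show "kadjoint (\<R> h) = \<R> (inv h)"
    using assms by (intro ext) (auto simp: kadjoint_def right_kernel_def m_assoc)
qed

lemma translation_normal:
  assumes "h \<in> carrier G"
  shows "kadjoint (\<L> h) \<star> \<L> h = \<L> h \<star> kadjoint (\<L> h)" "kadjoint (\<R> h) \<star> \<R> h = \<R> h \<star> kadjoint (\<R> h)"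
  using assms by (simp_all add: translation_adjoint)

lemma translation_power:
  assumes "h \<in> carrier G"
  shows "kpow (\<L> h) (Coset.order G) = \<I>" "kpow (\<R> h) (Coset.order G) = \<I>"
proof -
  have "kpow (\<L> h) n = \<L> (h [^] n)" "kpow (\<R> h) n = \<R> (h [^] n)" for n :: nat
    using assms by (induction n) (simp_all add: nat_pow_comm[of h 1, simplified])
  then show "kpow (\<L> h) (Coset.order G) = \<I>" "kpow (\<R> h) (Coset.order G) = \<I>"
    using assms by (simp_all add: pow_order_eq_1)
qed

definition class_sum :: "'a \<Rightarrow> 'a \<Rightarrow> 'a \<Rightarrow> complex" where
  "class_sum g = (\<Sum>h\<in>conj_class g. \<L> h)"

lemma class_sum_apply:
  assumes "g \<in> carrier G" "x \<in> carrier G" "y \<in> carrier G"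
  shows "class_sum g x y = of_bool (x \<otimes> inv y \<in> conj_class g)"
proof -
  have fin: "finite (conj_class g)" using finite_X by (simp add: conj_class_def)
  have "class_sum g x y = (\<Sum>h\<in>conj_class g. if h = x \<otimes> inv y then 1 else 0)"
    unfolding class_sum_def sum_kernel_apply left_kernel_def
    using assms conj_class_closed[OF assms(1)]
    by (intro sum.cong) (auto simp: m_assoc subset_iff)
  then show ?thesis using fin by simp
qed

lemma class_sum_kernel: "class_sum g \<in> kernels"
  unfolding class_sum_def by (rule kernels_sum) simp

text \<open>
  A conjugacy class is closed under conjugation, so that \<open>xy\<^sup>-\<^sup>1\<close> belongs to it if and only if \<open>y\<^sup>-\<^sup>1x\<close> does.
  Thus the class sum lies in the algebra of left translations and in that of right translations;
  since these commute, it commutes with both.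
\<close>
lemma class_sum_right:
  assumes g: "g \<in> carrier G"
  shows "class_sum g = (\<Sum>h\<in>conj_class g. \<R> h)"
proof (rule kernel_eqI)
  fix x y assume xy: "x \<in> carrier G" "y \<in> carrier G"
  have fin: "finite (conj_class g)" using finite_X by (simp add: conj_class_def)
  have "(\<Sum>h\<in>conj_class g. \<R> h) x y = (\<Sum>h\<in>conj_class g. if h = inv y \<otimes> x then 1 else 0)"
    unfolding sum_kernel_apply right_kernel_def
    using xy conj_class_closed[OF g] by (intro sum.cong) (auto simp: m_assoc[symmetric] subset_iff)
  also have "\<dots> = of_bool (inv y \<otimes> x \<in> conj_class g)" using fin by simp
  also have "inv y \<otimes> x \<in> conj_class g \<longleftrightarrow> x \<otimes> inv y \<in> conj_class g"
  proof
    assume "inv y \<otimes> x \<in> conj_class g"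
    from conj_class_conj[OF g xy(2) this] show "x \<otimes> inv y \<in> conj_class g"
      using xy by (simp add: m_assoc[symmetric])
  next
    assume "x \<otimes> inv y \<in> conj_class g"
    from conj_class_conj[OF g inv_closed[OF xy(2)] this] show "inv y \<otimes> x \<in> conj_class g"
      using xy by (simp add: m_assoc)
  qed
  finally show "class_sum g x y = (\<Sum>h\<in>conj_class g. \<R> h) x y"
    using class_sum_apply[OF g xy] by simp
qed (auto simp: class_sum_kernel intro!: kernels_sum)

lemma class_sum_central:
  assumes g: "g \<in> carrier G" and u: "u \<in> carrier G"
  shows "\<L> u \<star> class_sum g = class_sum g \<star> \<L> u" "\<R> u \<star> class_sum g = class_sum g \<star> \<R> u"
proof -
  show "\<L> u \<star> class_sum g = class_sum g \<star> \<L> u"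
    unfolding class_sum_right[OF g] kmult_sum using conj_class_closed[OF g] u
    by (intro sum.cong) (auto simp: left_right_commute)
  show "\<R> u \<star> class_sum g = class_sum g \<star> \<R> u"
    unfolding class_sum_def kmult_sum using conj_class_closed[OF g] u
    by (intro sum.cong) (auto simp: left_right_commute)
qed

lemma class_sum_normal:
  assumes g: "g \<in> carrier G"
  shows "kadjoint (class_sum g) \<star> class_sum g = class_sum g \<star> kadjoint (class_sum g)"
proof -
  have *: "kadjoint (class_sum g) = (\<Sum>h\<in>conj_class g. \<L> (inv h))"
    unfolding class_sum_def kadjoint_simps using conj_class_closed[OF g]
    by (intro sum.cong) (auto simp: translation_adjoint)
  show ?thesis
    unfolding * kmult_sum using conj_class_closed[OF g]
    by (intro sum.cong) (auto simp: class_sum_central[OF g])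
qed

text \<open>
  If \<open>Z\<close> commutes with left translations, then the trace of \<open>ZL\<^sub>h\<close> depends only on the class of \<open>h\<close>.
\<close>
lemma ktrace_class_average:
  assumes g: "g \<in> carrier G" and Z: "\<And>u. u \<in> carrier G \<Longrightarrow> Z \<star> \<L> u = \<L> u \<star> Z"
  shows "of_nat (card (conj_class g)) * ktrace (Z \<star> \<L> g) = ktrace (Z \<star> class_sum g)"
proof -
  have "ktrace (Z \<star> \<L> h) = ktrace (Z \<star> \<L> g)" if h: "h \<in> conj_class g" for h
  proof -
    obtain u where u: "u \<in> carrier G" "h = u \<otimes> g \<otimes> inv u" using h by (auto simp: conj_class_def)
    have "Z \<star> \<L> h = Z \<star> \<L> u \<star> (\<L> g \<star> \<L> (inv u))" using u g by (simp add: kmult_assoc m_assoc)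
    also have "\<dots> = \<L> u \<star> (Z \<star> \<L> g \<star> \<L> (inv u))" using Z[OF u(1)] by (simp only: kmult_assoc)
    finally have "ktrace (Z \<star> \<L> h) = ktrace (Z \<star> \<L> g \<star> \<L> (inv u) \<star> \<L> u)"
      by (simp only: ktrace_commute[of "\<L> u"])
    also have "\<dots> = ktrace (Z \<star> \<L> g)" using u by (simp add: kmult_assoc del: left_left, simp add: kmult_assoc[symmetric])
    finally show ?thesis .
  qed
  then show ?thesis unfolding class_sum_def kmult_sum ktrace_sum by simp
qed

lemma ktrace_class_average_right:
  assumes g: "g \<in> carrier G" and Z: "\<And>u. u \<in> carrier G \<Longrightarrow> Z \<star> \<R> u = \<R> u \<star> Z"
  shows "of_nat (card (conj_class g)) * ktrace (Z \<star> \<R> g) = ktrace (Z \<star> class_sum g)"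
proof -
  have "ktrace (Z \<star> \<R> h) = ktrace (Z \<star> \<R> g)" if h: "h \<in> conj_class g" for h
  proof -
    obtain u where u: "u \<in> carrier G" "h = u \<otimes> g \<otimes> inv u" using h by (auto simp: conj_class_def)
    have "Z \<star> \<R> h = Z \<star> \<R> (inv u) \<star> (\<R> g \<star> \<R> u)" using u g by (simp add: kmult_assoc m_assoc)
    also have "\<dots> = \<R> (inv u) \<star> (Z \<star> \<R> g \<star> \<R> u)" using Z[of "inv u"] u by (simp add: kmult_assoc[symmetric])
    finally have "ktrace (Z \<star> \<R> h) = ktrace (Z \<star> \<R> g \<star> (\<R> u \<star> \<R> (inv u)))"
      by (simp only: ktrace_commute[of "\<R> (inv u)"] kmult_assoc)
    also have "\<dots> = ktrace (Z \<star> (\<R> g \<star> \<I>))" using u by (simp add: kmult_assoc)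
    finally show ?thesis by simp
  qed
  then show ?thesis unfolding class_sum_right[OF g] kmult_sum ktrace_sum by simp
qed

end

section \<open>Conjugacy classes of prime power size\<close>

context regular_representation
begin

text \<open>
  Let the simple group \<open>G\<close> act on the image of \<open>e\<close>.  The elements that act as scalars form a normal
  subgroup containing \<open>g\<close>, so all elements act as scalars.  The kernel of the action is a normal
  subgroup that contains all commutators; it is not trivial because \<open>g\<close> is not central.
\<close>
lemma scalar_left_translations:
  fixes e :: "'a \<Rightarrow> 'a \<Rightarrow> complex"
  assumes simple: "\<And>N. N \<lhd> G \<Longrightarrow> N = {\<one>} \<or> N = carrier G"
    and g: "g \<in> carrier G" "card (conj_class g) > 1"
    and e: "e \<in> kernels" "e \<noteq> 0" and central: "\<And>u. u \<in> carrier G \<Longrightarrow> \<L> u \<star> e = e \<star> \<L> u"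
    and scalar: "\<L> g \<star> e = t \<cdot> e"
  shows "\<And>h. h \<in> carrier G \<Longrightarrow> \<L> h \<star> e = e"
proof -
  have cancel: "c = d" if "c \<cdot> e = d \<cdot> e" for c d
  proof -
    obtain x y where "e x y \<noteq> 0" using e(2) by (auto simp: fun_eq_iff)
    with that show ?thesis by (metis kscale_def mult_cancel_right)
  qed
  have comm: "\<L> h \<star> (\<L> k \<star> e) = (c * d) \<cdot> e" if "\<L> h \<star> e = c \<cdot> e" "\<L> k \<star> e = d \<cdot> e" for h k c d
    using that by (simp add: mult.commute)
  have assoc: "\<L> (h \<otimes> k) \<star> A = \<L> h \<star> (\<L> k \<star> A)" if "h \<in> carrier G" "k \<in> carrier G" for h k A
    using that by (simp add: kmult_assoc[symmetric])
  have conj: "\<L> (u \<otimes> h \<otimes> inv u) \<star> e = c \<cdot> e"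
    if "u \<in> carrier G" "h \<in> carrier G" "\<L> h \<star> e = c \<cdot> e" for u h c
  proof -
    have "\<L> (u \<otimes> h \<otimes> inv u) \<star> e = \<L> u \<star> (\<L> h \<star> (\<L> (inv u) \<star> e))"
      using that by (simp add: assoc)
    also have "\<dots> = \<L> u \<star> (\<L> h \<star> (e \<star> \<L> (inv u)))" using that central[of "inv u"] by simp
    also have "\<dots> = \<L> u \<star> ((\<L> h \<star> e) \<star> \<L> (inv u))" by (simp only: kmult_assoc)
    also have "\<dots> = c \<cdot> (\<L> u \<star> e \<star> \<L> (inv u))" using that(3) by (simp add: kmult_assoc)
    also have "\<dots> = c \<cdot> (e \<star> (\<L> u \<star> \<L> (inv u)))" using central[OF that(1)] by (simp add: kmult_assoc)
    finally show ?thesis using that e(1) by simp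
  qed
  have inv: "c \<noteq> 0" "\<L> (inv h) \<star> e = (1 / c) \<cdot> e" if "h \<in> carrier G" "\<L> h \<star> e = c \<cdot> e" for h c
  proof -
    have "e = \<L> (inv h) \<star> (\<L> h \<star> e)" using that(1) e(1) by (simp add: assoc[symmetric])
    also have "\<dots> = c \<cdot> (\<L> (inv h) \<star> e)" using that by simp
    finally have *: "e = c \<cdot> (\<L> (inv h) \<star> e)" .
    then show "c \<noteq> 0" using e(2) by auto
    have "(1 / c) \<cdot> e = (1 / c) \<cdot> c \<cdot> (\<L> (inv h) \<star> e)" using * by simp
    then show "\<L> (inv h) \<star> e = (1 / c) \<cdot> e" using \<open>c \<noteq> 0\<close> by simp
  qed
  define Z where "Z = {h \<in> carrier G. \<exists>c. \<L> h \<star> e = c \<cdot> e}"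
  have "Z \<lhd> G"
  proof (rule normal_invI)
    show "subgroup Z G"
    proof
      show "\<one> \<in> Z" using e(1) by (auto simp: Z_def intro: exI[of _ 1])
      show "h \<otimes> k \<in> Z" if hk: "h \<in> Z" "k \<in> Z" for h k
      proof -
        obtain c where c: "\<L> h \<star> e = c \<cdot> e" using hk(1) by (auto simp: Z_def)
        obtain d where d: "\<L> k \<star> e = d \<cdot> e" using hk(2) by (auto simp: Z_def)
        from comm[OF c d] hk show ?thesis by (auto simp: Z_def assoc)
      qed
      show "inv h \<in> Z" if "h \<in> Z" for h using that inv(2) by (auto simp: Z_def)
    qed (auto simp: Z_def)
    show "x \<otimes> h \<otimes> inv x \<in> Z" if "x \<in> carrier G" "h \<in> Z" for x h
      using that conj by (auto simp: Z_def)
  qed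
  moreover have "g \<in> Z" using g(1) scalar by (auto simp: Z_def)
  moreover have "g \<noteq> \<one>"
  proof
    assume "g = \<one>"
    then have "conj_class g = {\<one>}" by (auto simp: conj_class_def)
    then show False using g(2) by simp
  qed
  ultimately have Z: "Z = carrier G" using simple by blast
  define N where "N = {h \<in> carrier G. \<L> h \<star> e = e}"
  have "N \<lhd> G"
  proof (rule normal_invI)
    show "subgroup N G"
    proof
      show "\<one> \<in> N" using e(1) by (auto simp: N_def)
      show "h \<otimes> k \<in> N" if "h \<in> N" "k \<in> N" for h k
        using that by (auto simp: N_def assoc)
      show "inv h \<in> N" if "h \<in> N" for h using that inv(2)[of h 1] by (auto simp: N_def)
    qed (auto simp: N_def)
    show "x \<otimes> h \<otimes> inv x \<in> N" if "x \<in> carrier G" "h \<in> N" for x h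
      using that conj[of x h 1] by (auto simp: N_def)
  qed
  moreover have "N \<noteq> {\<one>}"
  proof
    assume N: "N = {\<one>}"
    have "u \<otimes> g \<otimes> inv u = g" if u: "u \<in> carrier G" for u
    proof -
      let ?w = "u \<otimes> g \<otimes> inv u \<otimes> inv g"
      obtain c where c: "\<L> g \<star> e = c \<cdot> e" using Z g(1) by (auto simp: Z_def)
      have "\<L> ?w \<star> e = \<L> (u \<otimes> g \<otimes> inv u) \<star> (\<L> (inv g) \<star> e)" using u g(1) by (simp add: assoc)
      also have "\<dots> = e" using conj[OF u g(1) c] inv[OF g(1) c] by simp
      finally have "?w \<in> N" using u g(1) by (simp add: N_def)
      then have "?w = \<one>" using N by blast
      then show ?thesis using u g(1) inv_equality[of "u \<otimes> g \<otimes> inv u" "inv g"] by simp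
    qed
    then have "conj_class g = {g}" by (auto simp: conj_class_def)
    then show False using g(2) by simp
  qed
  ultimately have "N = carrier G" using simple by blast
  then show "\<L> h \<star> e = e" if "h \<in> carrier G" for h using that by (auto simp: N_def)
qed

text \<open>
  All entries of \<open>e\<close> are equal, because \<open>e\<close> is invariant under left translations on both sides.  So \<open>e\<close>
  is the projection to the constant functions.
\<close>
lemma invariant_idempotent:
  fixes e :: "'a \<Rightarrow> 'a \<Rightarrow> complex"
  assumes e: "e \<in> kernels" "e \<noteq> 0" "e \<star> e = e" and central: "\<And>u. u \<in> carrier G \<Longrightarrow> \<L> u \<star> e = e \<star> \<L> u"
    and inv: "\<And>h. h \<in> carrier G \<Longrightarrow> \<L> h \<star> e = e"
  shows "ktrace e = 1"
proof -
  define c where "c = e \<one> \<one>"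
  have const: "e x y = c" if "x \<in> carrier G" "y \<in> carrier G" for x y
  proof -
    have "e x y = (\<L> x \<star> e) x y" using inv that by simp
    also have "\<dots> = e \<one> y" using that by (simp add: left_kernel_mult(1))
    also have "\<dots> = (e \<star> \<L> y) \<one> \<one>" using that by (simp add: left_kernel_mult(2))
    also have "\<dots> = e \<one> \<one>" using inv central that by simp
    finally show ?thesis by (simp add: c_def)
  qed
  have "c = (e \<star> e) \<one> \<one>" using e(3) by (simp add: c_def)
  also have "\<dots> = (\<Sum>z\<in>carrier G. c * c)"
    unfolding kmult_def by (rule sum.cong) (simp_all add: const)
  finally have cc: "c = of_nat (Coset.order G) * c * c" by (simp add: Coset.order_def)
  have "c \<noteq> 0"
  proof
    assume "c = 0"
    then have "e = 0" using const by (intro kernel_eqI e(1)) auto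
    with e(2) show False by simp
  qed
  then have "of_nat (Coset.order G) * c = 1" using cc by simp
  moreover have "ktrace e = of_nat (Coset.order G) * c"
    unfolding ktrace_def Coset.order_def by (subst sum.cong[OF refl, of _ _ "\<lambda>_. c"]) (simp_all add: const)
  ultimately show ?thesis by simp
qed

text \<open>
  Let \<open>T\<close> be the class sum, \<open>q = p\<^sup>k\<close> the class size, \<open>e w\<close> the eigenprojections of \<open>T\<close>, \<open>D w\<close> their ranks
  and \<open>t w = w / q\<close>.  As \<open>e w\<close> commutes with translations, the traces of \<open>e w L\<^sub>g\<close> and \<open>e w L\<^sub>g R\<^sub>g\<close> are
  \<open>D w t w\<close> and \<open>D w (t w)\<^sup>2\<close>; they are algebraic integers.  For an irreducible character \<open>\<chi>\<close> the image of
  \<open>e w\<close> would be a sum of blocks of dimension \<open>\<chi>(1)\<^sup>2\<close>, and \<open>t w\<close> would be \<open>\<chi>(g) / \<chi>(1)\<close>.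
  
  If \<open>p\<close> does not divide \<open>D w\<close>, then \<open>t w\<close> is an integral combination of \<open>D w t w\<close> and \<open>w\<close>, hence an
  algebraic integer.  Its conjugates are again of the form \<open>t u\<close> and lie in the unit disc, so \<open>t w\<close> is zero or
  a unit complex number.  In the latter case \<open>g\<close> acts as a scalar on the image of \<open>e w\<close>, and simplicity gives
  \<open>w = q\<close> and \<open>D w = 1\<close>.  The trace of \<open>L\<^sub>g\<close> is zero, which means that the sum of \<open>D w t w\<close> over all
  \<open>w \<noteq> q\<close> is \<open>-1\<close>.  Every nonzero term has \<open>p\<close> dividing \<open>D w\<close>.  Here \<open>D w\<close> is a sum of squares of degrees and
  not a degree itself, so its divisibility by \<open>p\<close> gives less than in the usual proof: the natural number
  \<open>D w / p\<close> times the algebraic integer \<open>D w (t w)\<^sup>2\<close> is the square of \<open>D w t w / \<surd>p\<close>, which is therefore an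
  algebraic integer.  Summing up, \<open>-1 / \<surd>p\<close> is an algebraic integer, which is absurd.
\<close>
theorem burnside_class_size:
  assumes simple: "\<And>N. N \<lhd> G \<Longrightarrow> N = {\<one>} \<or> N = carrier G"
    and g: "g \<in> carrier G" and card: "card (conj_class g) = p ^ k" and p: "prime p" and k: "k > 0"
  shows False
proof -
  define q where "q = p ^ k"
  have q1: "q > 1" unfolding q_def by (rule one_less_power[OF prime_gt_1_nat[OF p] k])
  let ?T = "class_sum g"
  have T: "?T \<in> kernels" by (rule class_sum_kernel)
  have ord: "Coset.order G > 0" using finite_X by (simp add: Coset.order_def card_gt_0_iff) (use g in blast)
  obtain W and e :: "complex \<Rightarrow> 'a \<Rightarrow> 'a \<Rightarrow> complex" where W: "finite W" "\<I> = (\<Sum>w\<in>W. e w)"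
    "\<And>w. w \<in> W \<Longrightarrow> e w \<in> kernels" "\<And>w. w \<in> W \<Longrightarrow> e w \<noteq> 0"
    "\<And>w. w \<in> W \<Longrightarrow> ?T \<star> e w = w \<cdot> e w" "\<And>w. w \<in> W \<Longrightarrow> e w \<star> e w = e w"
    "\<And>w Z. w \<in> W \<Longrightarrow> Z \<in> kernels \<Longrightarrow> Z \<star> ?T = ?T \<star> Z \<Longrightarrow> Z \<star> e w = e w \<star> Z"
    by (rule spectral_decomposition[OF T class_sum_normal[OF g]]) (rule that; assumption)
  have eL: "\<L> u \<star> e w = e w \<star> \<L> u" and eR: "\<R> u \<star> e w = e w \<star> \<R> u" and eT: "e w \<star> ?T = w \<cdot> e w"
    if "w \<in> W" "u \<in> carrier G" for u w
    using W(7)[OF that(1), of "\<L> u"] W(7)[OF that(1), of "\<R> u"] W(7)[OF that(1) T] W(5)[OF that(1)]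
      class_sum_central[OF g that(2)] by simp_all
  define D where "D w = ktrace (e w)" for w
  define t where "t w = w / of_nat q" for w :: complex
  have qt: "w = of_nat q * t w" for w using q1 by (simp add: t_def)
  have q0: "complex_of_nat q \<noteq> 0" using q1 by simp
  have D_nat: "D w \<in> \<nat>" and D_nz: "D w \<noteq> 0" if "w \<in> W" for w
    using ktrace_idempotent[of "e w"] W(3,4,6)[OF that] by (auto simp: D_def)
  have tr1: "ktrace (e w \<star> \<L> g) = D w * t w" if w: "w \<in> W" for w
  proof -
    have "of_nat q * ktrace (e w \<star> \<L> g) = w * D w"
      using ktrace_class_average[OF g, of "e w"] eL[OF w] eT[OF w g] by (simp add: card q_def D_def)
    then show ?thesis using q0 by (simp add: t_def field_simps)
  qed
  have tr2: "ktrace (e w \<star> \<R> g) = D w * t w" if w: "w \<in> W" for w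
  proof -
    have "of_nat q * ktrace (e w \<star> \<R> g) = w * D w"
      using ktrace_class_average_right[OF g, of "e w"] eR[OF w] eT[OF w g] by (simp add: card q_def D_def)
    then show ?thesis using q0 by (simp add: t_def field_simps)
  qed
  have tr3: "ktrace (e w \<star> \<L> g \<star> \<R> g) = D w * t w ^ 2" if w: "w \<in> W" for w
  proof -
    let ?Z = "\<R> g \<star> e w"
    have Z: "?Z \<star> \<L> u = \<L> u \<star> ?Z" if u: "u \<in> carrier G" for u
      using eL[OF w u] left_right_commute[OF u g] by (metis kmult_assoc)
    have "of_nat q * ktrace (?Z \<star> \<L> g) = ktrace (\<R> g \<star> (e w \<star> ?T))"
      using ktrace_class_average[OF g, of ?Z] Z by (simp add: card q_def kmult_assoc)
    also have "\<dots> = w * ktrace (e w \<star> \<R> g)" using eT[OF w g] eR[OF w g] by simp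
    also have "?Z \<star> \<L> g = \<R> g \<star> (e w \<star> \<L> g)" by (rule kmult_assoc)
    also have "ktrace \<dots> = ktrace (e w \<star> \<L> g \<star> \<R> g)" by (rule ktrace_commute)
    finally show ?thesis using q0 tr2[OF w] by (simp add: t_def field_simps power2_eq_square)
  qed
  note ordL = translation_kernels(1)[of g] translation_normal(1)[OF g] translation_power(1)[OF g] ord
  note ordR = translation_kernels(2)[of g] translation_normal(2)[OF g] translation_power(2)[OF g] ord
  have kone_ord: "\<I> \<in> kernels" "kadjoint \<I> \<star> \<I> = \<I> \<star> kadjoint \<I>" "kpow \<I> 1 = \<I>" "1 > (0::nat)" by simp_all
  have int2: "algebraic_int (D w * t w ^ 2)" if w: "w \<in> W" for w
    using algebraic_int_ktrace[OF W(3)[OF w] W(6)[OF w] ordL ordR] eL[OF w g] eR[OF w g] left_right_commute[OF g g]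
      tr3[OF w] by simp
  have int1: "algebraic_int (D w * t w)" if w: "w \<in> W" for w
    using algebraic_int_ktrace[OF W(3)[OF w] W(6)[OF w] ordL kone_ord] eL[OF w g] W(3)[OF w] tr1[OF w] by simp
  have t_le: "cmod (t w) \<le> 1" if w: "w \<in> W" for w
  proof -
    have "cmod (D w) * cmod (t w) \<le> cmod (D w) * 1"
      using cmod_ktrace_finite_order_le[OF W(3)[OF w] W(6)[OF w] ordL] eL[OF w g] tr1[OF w]
      by (simp add: D_def norm_mult)
    then show ?thesis using D_nz[OF w] by (simp add: mult_le_cancel_left)
  qed
  obtain \<chi> :: "int poly" where \<chi>: "lead_coeff \<chi> = 1"
    "\<And>z. poly (map_poly of_int \<chi>) z = 0 \<longleftrightarrow> (\<exists>C\<in>kernels. C \<noteq> 0 \<and> ?T \<star> C = z \<cdot> C)"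
  proof (rule integer_kernel_char_poly[OF T, of "\<lambda>x y. of_bool (x \<in> carrier G \<and> y \<in> carrier G \<and> x \<otimes> inv y \<in> conj_class g)"])
    show "?T x y = of_int (of_bool (x \<in> carrier G \<and> y \<in> carrier G \<and> x \<otimes> inv y \<in> conj_class g))" for x y
      using class_sum_apply[OF g, of x y] kernels_outside[OF T, of x y] by (cases "x \<in> carrier G \<and> y \<in> carrier G") auto
  qed (rule that; assumption)
  have eigen_W: "z \<in> W" if C: "C \<in> kernels" "C \<noteq> 0" "?T \<star> C = z \<cdot> C" for z C
  proof -
    have sumC: "(\<Sum>w\<in>W. e w \<star> C) = C" using kmult_one(1)[OF C(1)] by (simp only: W(2) kmult_sum)
    have "\<exists>w\<in>W. e w \<star> C \<noteq> 0"
    proof (rule ccontr)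
      assume "\<not> (\<exists>w\<in>W. e w \<star> C \<noteq> 0)"
      then have "(\<Sum>w\<in>W. e w \<star> C) = 0" by (intro sum.neutral) blast
      with sumC C(2) show False by simp
    qed
    then obtain w where w: "w \<in> W" "e w \<star> C \<noteq> 0" by blast
    have "w \<cdot> (e w \<star> C) = e w \<star> ?T \<star> C" using eT[OF w(1) g] by simp
    also have "\<dots> = z \<cdot> (e w \<star> C)" by (simp add: kmult_assoc C(3))
    finally have eq: "w \<cdot> (e w \<star> C) = z \<cdot> (e w \<star> C)" .
    obtain x y where "(e w \<star> C) x y \<noteq> 0" using w(2) by (auto simp: fun_eq_iff)
    then have "w = z" using fun_cong[OF fun_cong[OF eq, of x], of y] by (simp add: kscale_def)
    with w show ?thesis by simp
  qed
  have w_root: "poly (map_poly of_int \<chi>) w = 0" if "w \<in> W" for w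
    unfolding \<chi>(2) using W(3,4,5)[OF that] by blast
  have w_int: "algebraic_int w" if "w \<in> W" for w
    using w_root[OF that] \<chi>(1) unfolding algebraic_int_altdef_ipoly by blast
  have dichotomy: "t w = 0 \<or> cmod (t w) = 1" if w: "w \<in> W" and nd: "\<not> (\<exists>m. D w = of_nat (p * m))" for w
  proof -
    obtain d where d: "D w = of_nat d" using D_nat[OF w] by (auto elim: Nats_cases)
    have "\<not> p dvd d" using nd d by (auto elim!: dvdE)
    then have "coprime p d" using p by (rule prime_imp_coprime[rotated])
    then have "gcd (int d) (int q) = 1" by (simp add: q_def coprime_commute flip: coprime_iff_gcd_eq_1)
    then obtain a b where ab: "a * int d + b * int q = 1" using bezout_int[of "int d" "int q"] by metis
    have "t w = (of_int a * of_nat d + of_int b * of_nat q) * t w"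
      using arg_cong[OF ab, of complex_of_int] by simp
    also have "\<dots> = of_int a * (D w * t w) + of_int b * w" by (subst (3) qt) (simp add: d algebra_simps)
    finally have eq: "t w = of_int a * (D w * t w) + of_int b * w" .
    have t_int: "algebraic_int (t w)"
      by (subst eq) (intro algebraic_int_add_mult int1[OF w] w_int[OF w]; simp add: int_imp_algebraic_int)
    \<comment> \<open>the characteristic polynomial of T, rescaled: its roots are the numbers u with q u an eigenvalue\<close>
    define F where "F = pcompose (map_poly of_int \<chi>) [:0, of_nat q :: rat:]"
    have "\<chi> \<noteq> 0" using \<chi>(1) by auto
    then have F0: "F \<noteq> 0" using q1 by (simp add: F_def pcompose_eq_0_iff)
    have F_root: "poly (map_poly of_rat F) u = poly (map_poly of_int \<chi>) (of_nat q * u)" for u :: complex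
    proof -
      have "poly (map_poly of_rat F) u = poly (pcompose (map_poly of_rat (map_poly of_int \<chi>)) (map_poly of_rat [:0, of_nat q :: rat:])) u"
        by (simp add: F_def of_rat_hom.map_poly_pcompose)
      also have "map_poly of_rat (map_poly of_int \<chi> :: rat poly) = (map_poly of_int \<chi> :: complex poly)"
        by (rule poly_eqI) (simp add: coeff_map_poly)
      also have "map_poly of_rat [:0, of_nat q :: rat:] = [:0, of_nat q :: complex:]"
        by (rule poly_eqI) (simp add: coeff_map_poly coeff_pCons split: nat.splits)
      finally show ?thesis by (simp add: poly_pcompose mult.commute)
    qed
    show ?thesis
    proof (rule algebraic_int_conjugates_in_unit_disc[OF t_int F0])
      show "poly (map_poly of_rat F) (t w) = 0"
        unfolding F_root using w_root[OF w] by (simp add: qt[symmetric])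
      fix u :: complex assume "poly (map_poly of_rat F) u = 0"
      then have "of_nat q * u \<in> W" unfolding F_root \<chi>(2) using eigen_W by blast
      from t_le[OF this] show "cmod u \<le> 1" using q0 by (simp add: t_def)
    qed
  qed
  have unit: "w = of_nat q \<and> D w = 1" if w: "w \<in> W" and t1: "cmod (t w) = 1" for w
  proof -
    have sc: "\<L> g \<star> e w = t w \<cdot> e w"
      by (rule ktrace_finite_order[OF W(3)[OF w] W(6)[OF w] ordL])
        (use eL[OF w g] tr1[OF w] t1 in \<open>simp_all add: D_def\<close>)
    have inv: "\<L> h \<star> e w = e w" if "h \<in> carrier G" for h
      by (rule scalar_left_translations[OF simple g _ W(3)[OF w] W(4)[OF w] eL[OF w] sc that])
        (use card q1 q_def in simp_all)
    have "w \<cdot> e w = (\<Sum>h\<in>conj_class g. \<L> h \<star> e w)"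
      unfolding W(5)[OF w, symmetric] class_sum_def by (rule kmult_sum)
    also have "\<dots> = (\<Sum>h\<in>conj_class g. e w)"
      by (rule sum.cong) (use inv conj_class_closed[OF g] in auto)
    finally have eq: "w \<cdot> e w = (\<Sum>h\<in>conj_class g. e w)" .
    obtain x y where "e w x y \<noteq> 0" using W(4)[OF w] by (auto simp: fun_eq_iff)
    moreover have "(w \<cdot> e w) x y = (\<Sum>h\<in>conj_class g. e w x y)" unfolding eq by (rule sum_kernel_apply)
    ultimately have "w = of_nat q" by (simp add: kscale_def card q_def)
    have "D w = 1" unfolding D_def
      by (rule invariant_idempotent[OF W(3)[OF w] W(4)[OF w] W(6)[OF w] eL[OF w] inv])
    with \<open>w = of_nat q\<close> show ?thesis by simp
  qed
  have qW: "of_nat q \<in> W"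
  proof -
    \<comment> \<open>the constant functions are eigenvectors of T with eigenvalue q\<close>
    define C :: "'a \<Rightarrow> 'a \<Rightarrow> complex" where "C x y = of_bool (x \<in> carrier G \<and> y \<in> carrier G)" for x y
    have C: "C \<in> kernels" by (auto simp: C_def intro: kernelsI)
    have LC: "\<L> h \<star> C = C" if "h \<in> carrier G" for h
      by (rule kernel_eqI) (use C that in \<open>auto simp: left_kernel_mult(1)\<close>, auto simp: C_def)
    have "?T \<star> C = of_nat q \<cdot> C"
      unfolding class_sum_def kmult_sum using LC conj_class_closed[OF g]
      by (auto simp: fun_eq_iff kscale_def sum_kernel_apply subset_iff card q_def)
    moreover have "C \<one> \<one> \<noteq> 0" by (simp add: C_def)
    then have "C \<noteq> 0" by auto
    ultimately show ?thesis using eigen_W C by blast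
  qed
  have t_q: "t (of_nat q) = 1" using q0 by (simp add: t_def)
  have D_q: "D (of_nat q) = 1" using unit[OF qW] t_q by simp
  define s where "s = sqrt (of_nat p)"
  have s2: "complex_of_real s * complex_of_real s = of_nat p"
    using p by (simp add: s_def flip: of_real_mult)
  have s0: "complex_of_real s \<noteq> 0" using p by (auto simp: s_def prime_gt_0_nat)
  have term_int: "algebraic_int (D w * t w / s)" if w: "w \<in> W - {of_nat q}" for w
  proof (cases "\<exists>m. D w = of_nat (p * m)")
    case True
    then obtain m where m: "D w = of_nat (p * m)" by blast
    have wW: "w \<in> W" using w by blast
    have "(D w * t w / s) ^ 2 = of_nat m * (D w * t w ^ 2)"
      using s0 by (simp add: power2_eq_square field_simps s2) (simp add: m algebra_simps s2)
    moreover have "algebraic_int (of_nat m * (D w * t w ^ 2))"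
      by (intro algebraic_int_add_mult int2[OF wW]) simp
    ultimately have "algebraic_int ((D w * t w / s) ^ 2)" by simp
    then show ?thesis
      by (rule algebraic_int_root[where p = "Polynomial.monom 1 2"]) (simp_all add: poly_monom degree_monom_eq)
  next
    case False
    have wW: "w \<in> W" "w \<noteq> of_nat q" using w by auto
    have "t w = 0" using dichotomy[OF wW(1) False] unit[OF wW(1)] wW(2) by metis
    then show ?thesis by simp
  qed
  have g1: "g \<noteq> \<one>"
  proof
    assume "g = \<one>"
    then have "conj_class g = {\<one>}" by (auto simp: conj_class_def)
    then show False using card q1 by (simp add: q_def)
  qed
  have "0 = ktrace (\<L> g)"
    unfolding ktrace_def left_kernel_def using g g1 by (auto intro!: sum.neutral)
  also have "\<dots> = ktrace (\<I> \<star> \<L> g)" by simp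
  also have "\<dots> = (\<Sum>w\<in>W. D w * t w)"
    unfolding W(2) kmult_sum ktrace_sum by (rule sum.cong) (simp_all add: tr1)
  also have "\<dots> = 1 + (\<Sum>w\<in>W - {of_nat q}. D w * t w)"
    using sum.remove[OF W(1) qW, of "\<lambda>w. D w * t w"] by (simp add: t_q D_q)
  finally have "(\<Sum>w\<in>W - {of_nat q}. D w * t w) = - 1" by (simp add: add_eq_0_iff)
  then have "(\<Sum>w\<in>W - {of_nat q}. D w * t w / s) = - 1 / s" by (simp add: sum_divide_distrib[symmetric])
  moreover have "algebraic_int (\<Sum>w\<in>W - {of_nat q}. D w * t w / s)" using term_int by (rule algebraic_int_sum)
  ultimately have "algebraic_int (- 1 / complex_of_real s)" by simp
  then have "algebraic_int ((- 1 / complex_of_real s) ^ 2)" by (rule algebraic_int_power)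
  then have "algebraic_int (1 / complex_of_nat p)" by (simp add: power2_eq_square s2)
  then have "1 / complex_of_nat p \<in> \<int>" by (rule rational_algebraic_int_is_int) simp
  then obtain z where "1 / complex_of_nat p = of_int z" by (auto elim: Ints_cases)
  then have "complex_of_int (z * int p) = of_int 1" using p by (simp add: field_simps)
  then have "z * int p = 1" by (simp only: of_int_eq_iff)
  then have "int p dvd 1" by (metis dvd_triv_right)
  then show False using p by (simp add: prime_nat_iff)
qed

end

section \<open>Groups whose order has two prime divisors\<close>

context group
begin

lemma card_conj_class_dvd:
  assumes "g \<in> carrier G" shows "card (conj_class g) dvd Coset.order G"
proof -
  interpret conj: group_action G "carrier G" "\<lambda>g. \<lambda>h\<in>carrier G. g \<otimes> h \<otimes> inv g"
    by (rule action_by_conjugation)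
  have "Group_Action.orbit G (\<lambda>g. \<lambda>h\<in>carrier G. g \<otimes> h \<otimes> inv g) g = conj_class g"
    unfolding Group_Action.orbit_def conj_class_def image_def using assms by auto
  with conj.orbit_stabilizer_theorem[OF assms] show ?thesis by (intro dvdI[OF sym]) simp
qed

lemma mem_conj_class_self: "g \<in> carrier G \<Longrightarrow> g \<in> conj_class g"
  by (auto simp: conj_class_def intro!: image_eqI[of _ _ \<one>])

lemma conj_class_eq:
  assumes g: "g \<in> carrier G" and h: "h \<in> conj_class g" shows "conj_class h = conj_class g"
proof
  have hc: "h \<in> carrier G" using conj_class_closed[OF g] h by blast
  obtain u where u: "u \<in> carrier G" "h = u \<otimes> g \<otimes> inv u" using h by (auto simp: conj_class_def)
  have "inv u \<otimes> h \<otimes> inv (inv u) \<in> conj_class h"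
    using conj_class_conj[OF hc inv_closed[OF u(1)] mem_conj_class_self[OF hc]] .
  moreover have "inv u \<otimes> h \<otimes> inv (inv u) = g"
  proof -
    have "inv u \<otimes> (u \<otimes> (g \<otimes> inv u)) = g \<otimes> inv u" using u(1) g by (simp add: m_assoc[symmetric])
    then show ?thesis using u g by (simp add: m_assoc)
  qed
  ultimately have g': "g \<in> conj_class h" by simp
  show "conj_class h \<subseteq> conj_class g"
    unfolding conj_class_def[of h] using conj_class_conj[OF g _ h] by blast
  show "conj_class g \<subseteq> conj_class h"
    unfolding conj_class_def[of g] using conj_class_conj[OF hc _ g'] by blast
qed

text \<open>
  The group without its neutral element is a disjoint union of conjugacy classes.
\<close>
lemma class_equation_mod:
  assumes fin: "finite (carrier G)" and dvd: "\<And>g. g \<in> carrier G - {\<one>} \<Longrightarrow> d dvd card (conj_class g)"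
  shows "d dvd Coset.order G - 1"
proof -
  have one: "\<one> \<notin> conj_class g" if "g \<in> carrier G - {\<one>}" for g
  proof
    assume "\<one> \<in> conj_class g"
    then have "conj_class \<one> = conj_class g" using conj_class_eq that by blast
    moreover have "conj_class \<one> = {\<one>}" by (auto simp: conj_class_def)
    ultimately show False using mem_conj_class_self[of g] that by auto
  qed
  have U: "\<Union> (conj_class ` (carrier G - {\<one>})) = carrier G - {\<one>}"
    using conj_class_closed one mem_conj_class_self by blast
  have "d dvd card (\<Union> (conj_class ` (carrier G - {\<one>})))"
  proof (rule dvd_partition)
    show "finite (\<Union> (conj_class ` (carrier G - {\<one>})))" unfolding U using fin by simp
    show "\<forall>c\<in>conj_class ` (carrier G - {\<one>}). d dvd card c" using dvd by blast
    show "\<forall>c1\<in>conj_class ` (carrier G - {\<one>}). \<forall>c2\<in>conj_class ` (carrier G - {\<one>}). c1 \<noteq> c2 \<longrightarrow> c1 \<inter> c2 = {}"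
    proof (intro ballI impI)
      fix c1 c2 assume c: "c1 \<in> conj_class ` (carrier G - {\<one>})" "c2 \<in> conj_class ` (carrier G - {\<one>})" "c1 \<noteq> c2"
      show "c1 \<inter> c2 = {}"
      proof (rule ccontr)
        assume "c1 \<inter> c2 \<noteq> {}"
        then obtain h where h: "h \<in> c1" "h \<in> c2" by blast
        obtain g1 g2 where g: "c1 = conj_class g1" "g1 \<in> carrier G" "c2 = conj_class g2" "g2 \<in> carrier G"
          using c by blast
        have "conj_class h = c1" using conj_class_eq[OF g(2), of h] h(1) unfolding g(1) .
        moreover have "conj_class h = c2" using conj_class_eq[OF g(4), of h] h(2) unfolding g(3) .
        ultimately show False using c(3) by simp
      qed
    qed
  qed
  then show ?thesis unfolding U using fin by (simp add: Coset.order_def)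
qed

lemma cauchy_prime_order:
  assumes fin: "finite (carrier G)" and r: "prime r" "r dvd Coset.order G"
  shows "\<exists>x\<in>carrier G. x \<noteq> \<one> \<and> x [^] r = \<one>"
proof -
  obtain m where "Coset.order G = r ^ 1 * m" using r(2) by (auto elim: dvdE)
  from sylow_thm[OF r(1) is_group this fin] obtain H where H: "subgroup H G" "card H = r" by auto
  interpret H: group "G\<lparr>carrier := H\<rparr>" using H(1) by (rule subgroup_imp_group)
  have "\<not> H \<subseteq> {\<one>}"
  proof
    assume "H \<subseteq> {\<one>}"
    then have "card H \<le> 1" using card_mono[of "{\<one>}" H] by simp
    then show False using H(2) prime_gt_1_nat[OF r(1)] by simp
  qed
  then obtain x where x: "x \<in> H" "x \<noteq> \<one>" by blast
  have "x [^]\<^bsub>G\<lparr>carrier := H\<rparr>\<^esub> Coset.order (G\<lparr>carrier := H\<rparr>) = \<one>"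
    using H.pow_order_eq_1[of x] x(1) by simp
  then have "x [^] r = \<one>" using H x by (simp add: Coset.order_def nat_pow_consistent[symmetric])
  then show ?thesis using x subgroup.mem_carrier[OF H(1) x(1)] by (intro bexI[of _ x] conjI)
qed

end

text \<open>
  The case \<open>p = q\<close> is included; then \<open>p\<^sup>2\<close> does not divide \<open>n\<close>.
\<close>
lemma dvd_two_prime_powers:
  fixes p q n :: nat
  assumes p: "prime p" and q: "prime q" and n: "n dvd p ^ a * q ^ b" and pq: "\<not> p * q dvd n"
  shows "\<exists>k. n = p ^ k \<or> n = q ^ k"
proof (cases "p dvd n")
  case False
  then have "coprime p n" using p by (rule prime_imp_coprime[rotated])
  then have "coprime n (p ^ a)" by (simp add: coprime_commute)
  then have "n dvd q ^ b" using n by (simp add: coprime_dvd_mult_right_iff)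
  then show ?thesis using divides_primepow_nat[OF q] by blast
next
  case True
  show ?thesis
  proof (cases "p = q \<or> \<not> q dvd n")
    case True
    then have "n dvd p ^ (a + b) \<or> coprime q n"
      using n prime_imp_coprime[OF q, of n] by (auto simp: power_add)
    then have "n dvd p ^ (a + b) \<or> coprime n (q ^ b)" by (auto simp: coprime_commute)
    then have "\<exists>c. n dvd p ^ c" using n by (auto simp: coprime_dvd_mult_left_iff)
    then show ?thesis using divides_primepow_nat[OF p] by blast
  next
    case False
    then have "coprime p q" using p q primes_coprime by blast
    then have "p * q dvd n" using False True by (simp add: divides_mult)
    with pq show ?thesis by blast
  qed
qed

context group
begin

lemma finite_subgroup_normal_max:
  assumes fin: "finite (carrier G)" and nontriv: "carrier G \<noteq> {\<one>}"
  obtains K where "K \<lhd> G" "K \<noteq> carrier G" "\<And>H. H \<lhd> G \<Longrightarrow> K \<subseteq> H \<Longrightarrow> H = K \<or> H = carrier G"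
proof -
  let ?P = "\<lambda>K. K \<lhd> G \<and> K \<noteq> carrier G"
  have P1: "?P {\<one>}" using one_is_normal nontriv by auto
  have bound: "card K < card (carrier G) + 1" if "?P K" for K
    using card_mono[OF fin subgroup.subset[OF normal_imp_subgroup]] that by (simp add: less_Suc_eq_le)
  obtain K where K: "?P K" and max: "\<And>H. ?P H \<Longrightarrow> card H \<le> card K"
    using ex_has_greatest_nat[of ?P "{\<one>}" card "card (carrier G) + 1", OF P1] bound by (auto dest: less_imp_le)
  show ?thesis
  proof (rule that[of K])
    fix H assume H: "H \<lhd> G" "K \<subseteq> H"
    show "H = K \<or> H = carrier G"
    proof (rule ccontr)
      assume *: "\<not> (H = K \<or> H = carrier G)"
      have "finite H" using finite_subset[OF subgroup.subset[OF normal_imp_subgroup[OF H(1)]] fin] .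
      then have "card K < card H" using H(2) * by (metis psubset_card_mono psubsetI)
      with max[of H] H * show False by auto
    qed
  qed (use K in auto)
qed

text \<open>
  The preimage in \<open>G\<close> of a normal subgroup of the quotient lies between \<open>K\<close> and \<open>G\<close>.
\<close>
lemma simple_quotient:
  assumes K: "K \<lhd> G" and max: "\<And>H. H \<lhd> G \<Longrightarrow> K \<subseteq> H \<Longrightarrow> H = K \<or> H = carrier G"
    and N: "N \<lhd> G Mod K"
  shows "N = {\<one>\<^bsub>G Mod K\<^esub>} \<or> N = carrier (G Mod K)"
proof -
  interpret K: normal K G by (rule K)
  interpret Q: group "G Mod K" by (rule K.factorgroup_is_group)
  interpret N: normal N "G Mod K" by (rule N)
  have cos: "(K #> x) \<otimes>\<^bsub>G Mod K\<^esub> (K #> y) = K #> (x \<otimes> y)" if "x \<in> carrier G" "y \<in> carrier G" for x y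
    using that by (simp add: K.rcos_sum)
  have cinv: "inv\<^bsub>G Mod K\<^esub> (K #> x) = K #> inv x" if "x \<in> carrier G" for x
    using that by (simp add: K.inv_FactGroup K.rcos_inv rcosetsI K.subset carrier_FactGroup)
  define H where "H = {x \<in> carrier G. K #> x \<in> N}"
  have "H \<lhd> G"
  proof (rule normal_invI)
    show "subgroup H G"
    proof
      show "\<one> \<in> H" using N.one_closed by (simp add: H_def coset_mult_one K.subset)
      show "x \<otimes> y \<in> H" if "x \<in> H" "y \<in> H" for x y
        using that N.m_closed[of "K #> x" "K #> y"] cos by (auto simp: H_def simp del: mult_FactGroup)
      show "inv x \<in> H" if "x \<in> H" for x
        using that N.m_inv_closed[of "K #> x"] cinv by (auto simp: H_def)
    qed (auto simp: H_def)
    show "x \<otimes> h \<otimes> inv x \<in> H" if "x \<in> carrier G" "h \<in> H" for x h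
      using that N.inv_op_closed2[of "K #> x" "K #> h"] cos cinv
      by (auto simp: H_def carrier_FactGroup simp del: mult_FactGroup)
  qed
  moreover have "K \<subseteq> H"
    using N.one_closed by (auto simp: H_def K.rcos_const[OF is_group] K.subset[THEN subsetD])
  ultimately have HK: "H = K \<or> H = carrier G" by (rule max)
  have N_eq: "N = (\<lambda>x. K #> x) ` H"
    using N.subset by (auto simp: H_def carrier_FactGroup)
  from HK show ?thesis
  proof
    assume "H = K"
    then have "N = (\<lambda>x. K) ` K" unfolding N_eq by (intro image_cong) (simp_all add: K.rcos_const[OF is_group])
    then have "N = {K}" by (simp only: image_constant[OF K.one_closed])
    then show ?thesis by simp
  next
    assume "H = carrier G"
    then show ?thesis unfolding N_eq by (simp add: carrier_FactGroup)
  qed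
qed

text \<open>
  The centre is a normal subgroup, and it contains \<open>g\<close>.
\<close>
lemma central_singleton_class:
  assumes simple: "\<And>N. N \<lhd> G \<Longrightarrow> N = {\<one>} \<or> N = carrier G"
    and g: "g \<in> carrier G" "g \<noteq> \<one>" "conj_class g = {g}"
  shows "comm_group G"
proof -
  define Z where "Z = {z \<in> carrier G. \<forall>u\<in>carrier G. u \<otimes> z = z \<otimes> u}"
  have Zc: "z \<in> carrier G" and comm: "u \<otimes> z = z \<otimes> u" if "z \<in> Z" "u \<in> carrier G" for z u
    using that unfolding Z_def by blast+
  have ZI: "z \<in> Z" if "z \<in> carrier G" "\<And>u. u \<in> carrier G \<Longrightarrow> u \<otimes> z = z \<otimes> u" for z
    using that unfolding Z_def by blast
  have "Z \<lhd> G"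
  proof (rule normal_invI)
    show "subgroup Z G"
    proof
      show "Z \<subseteq> carrier G" unfolding Z_def by blast
      show "\<one> \<in> Z" by (rule ZI) simp_all
      show "x \<otimes> y \<in> Z" if xy: "x \<in> Z" "y \<in> Z" for x y
      proof (rule ZI)
        note c = Zc[OF xy(1) one_closed] Zc[OF xy(2) one_closed]
        show "x \<otimes> y \<in> carrier G" using c by simp
        fix u assume u: "u \<in> carrier G"
        have "u \<otimes> (x \<otimes> y) = (u \<otimes> x) \<otimes> y" using c u by (simp only: m_assoc)
        also have "\<dots> = x \<otimes> (u \<otimes> y)" using c u by (simp only: comm[OF xy(1) u] m_assoc)
        also have "\<dots> = x \<otimes> y \<otimes> u" using c u by (simp only: comm[OF xy(2) u] m_assoc)
        finally show "u \<otimes> (x \<otimes> y) = x \<otimes> y \<otimes> u" .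
      qed
      show "inv x \<in> Z" if x: "x \<in> Z" for x
      proof (rule ZI)
        note c = Zc[OF x one_closed]
        show "inv x \<in> carrier G" using c by simp
        fix u assume u: "u \<in> carrier G"
        have "u \<otimes> inv x = inv x \<otimes> (x \<otimes> u) \<otimes> inv x" using c u by (simp add: m_assoc[symmetric])
        also have "\<dots> = inv x \<otimes> (u \<otimes> x) \<otimes> inv x" by (simp only: comm[OF x u])
        also have "\<dots> = inv x \<otimes> u" using c u by (simp add: m_assoc)
        finally show "u \<otimes> inv x = inv x \<otimes> u" .
      qed
    qed
    show "x \<otimes> h \<otimes> inv x \<in> Z" if "x \<in> carrier G" "h \<in> Z" for x h
    proof -
      have "x \<otimes> h \<otimes> inv x = h" using that Zc[OF that(2,1)] by (simp add: comm m_assoc)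
      then show ?thesis using that by simp
    qed
  qed
  moreover have "g \<in> Z"
  proof -
    have "u \<otimes> g = g \<otimes> u" if u: "u \<in> carrier G" for u
    proof -
      have "u \<otimes> g \<otimes> inv u = g" using g(3) u by (auto simp: conj_class_def)
      then have "u \<otimes> g \<otimes> inv u \<otimes> u = g \<otimes> u" by simp
      then show ?thesis using u g(1) by (simp add: m_assoc)
    qed
    then show ?thesis using g(1) by (intro ZI)
  qed
  ultimately have "Z = carrier G" using simple g(2) by blast
  then show ?thesis by (intro group_comm_groupI comm) simp_all
qed

text \<open>
  A quotient by a maximal normal subgroup is simple.  By the class equation it has a nontrivial class
  whose size is not divisible by \<open>pq\<close>, hence a power of one prime; by \<open>burnside_class_size\<close> this size is
  \<open>1\<close>.  So the simple quotient is abelian, and the derived subgroup is proper.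
\<close>
lemma two_prime_group_not_perfect:
  assumes pq: "prime p" "prime q" and ord: "Coset.order G dvd p ^ a * q ^ b" and nontriv: "carrier G \<noteq> {\<one>}"
  shows "derived G (carrier G) \<noteq> carrier G"
proof -
  have "Coset.order G \<noteq> 0"
  proof
    assume "Coset.order G = 0"
    with ord pq show False by (auto simp: prime_nat_iff)
  qed
  then have fin: "finite (carrier G)" by (simp add: Coset.order_def card_ge_0_finite)
  obtain K where K: "K \<lhd> G" "K \<noteq> carrier G" and max: "\<And>H. H \<lhd> G \<Longrightarrow> K \<subseteq> H \<Longrightarrow> H = K \<or> H = carrier G"
    by (rule finite_subgroup_normal_max[OF fin nontriv]) (rule that; assumption)
  interpret K: normal K G by (rule K)
  interpret Q: group "G Mod K" by (rule K.factorgroup_is_group)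
  note simple = simple_quotient[OF K(1) max]
  have finQ: "finite (carrier (G Mod K))" using fin by (simp add: carrier_FactGroup)
  have "Coset.order (G Mod K) * card K = Coset.order G"
    using lagrange[OF K.is_subgroup] by (simp add: Coset.order_def FactGroup_def)
  then have ordQ: "Coset.order (G Mod K) dvd p ^ a * q ^ b" using ord dvd_trans[OF dvdI[OF sym]] by blast
  have ordQ1: "Coset.order (G Mod K) > 1"
  proof -
    obtain x where x: "x \<in> carrier G" "x \<notin> K" using K(2) K.subset by blast
    then have "K #> x \<noteq> K" using rcos_self[OF x(1) K.is_subgroup] by blast
    then have "card {K, K #> x} = 2" by simp
    moreover have "{K, K #> x} \<subseteq> carrier (G Mod K)"
      using x Q.one_closed by (auto simp: carrier_FactGroup)
    ultimately show ?thesis using card_mono[OF finQ, of "{K, K #> x}"] by (simp add: Coset.order_def)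
  qed
  have "\<exists>g\<in>carrier (G Mod K) - {\<one>\<^bsub>G Mod K\<^esub>}. \<not> p * q dvd card (Q.conj_class g)"
  proof (rule ccontr)
    assume "\<not> ?thesis"
    then have d: "p * q dvd Coset.order (G Mod K) - 1" using Q.class_equation_mod[OF finQ, of "p * q"] by blast
    have "r = 1" if r: "prime r" "r dvd p * q" "r dvd Coset.order (G Mod K)" for r
    proof -
      have "r dvd Coset.order (G Mod K) - 1" using r(2) d by (rule dvd_trans)
      then have "r dvd Coset.order (G Mod K) - (Coset.order (G Mod K) - 1)" using r(3) by (rule dvd_diff_nat[rotated])
      then show ?thesis using ordQ1 by simp
    qed
    from this[OF pq(1)] this[OF pq(2)] have "\<not> p dvd Coset.order (G Mod K)" "\<not> q dvd Coset.order (G Mod K)" using pq by auto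
    then have "coprime (Coset.order (G Mod K)) (p ^ a * q ^ b)"
      using pq prime_imp_coprime[OF pq(1), of "Coset.order (G Mod K)"] prime_imp_coprime[OF pq(2), of "Coset.order (G Mod K)"]
      by (simp add: coprime_commute)
    from coprime_common_divisor[OF this dvd_refl ordQ] have "Coset.order (G Mod K) = 1" by simp
    then show False using ordQ1 by simp
  qed
  then obtain g where g: "g \<in> carrier (G Mod K)" "g \<noteq> \<one>\<^bsub>G Mod K\<^esub>" "\<not> p * q dvd card (Q.conj_class g)" by blast
  have "card (Q.conj_class g) dvd p ^ a * q ^ b"
    using Q.card_conj_class_dvd[OF g(1)] ordQ by (rule dvd_trans)
  from dvd_two_prime_powers[OF pq this g(3)] obtain r k where r: "prime r" "card (Q.conj_class g) = r ^ k"
    using pq by blast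
  have "k = 0"
  proof (rule ccontr)
    assume "k \<noteq> 0"
    interpret regular_representation "G Mod K" by unfold_locales (rule finQ)
    show False using burnside_class_size[OF simple g(1) r(2,1)] \<open>k \<noteq> 0\<close> by blast
  qed
  then have "card (Q.conj_class g) = 1" using r by simp
  then have "Q.conj_class g = {g}" using Q.mem_conj_class_self[OF g(1)] by (auto simp: card_1_singleton_iff)
  from Q.central_singleton_class[OF simple g(1,2) this] have "comm_group (G Mod K)" by blast
  then have "derived G (carrier G) \<subseteq> K" using derived_minimal[OF K(1)] by blast
  then show ?thesis using K(2) K.subset by blast
qed

text \<open>
  The smallest nontrivial term \<open>A\<close> of the derived series is abelian, as its derived subgroup is smaller.
  For a prime \<open>r\<close> dividing its order, the elements of \<open>A\<close> with \<open>x\<^sup>r = 1\<close> form a characteristic subgroup.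
\<close>
theorem two_prime_group_abelian_normal:
  assumes pq: "prime p" "prime q" and ord: "Coset.order G = p ^ a * q ^ b" and nontriv: "carrier G \<noteq> {\<one>}"
  obtains N r where "N \<lhd> G" "N \<noteq> {\<one>}" "r = p \<or> r = q"
    "\<And>x y. x \<in> N \<Longrightarrow> y \<in> N \<Longrightarrow> x \<otimes> y = y \<otimes> x" "\<And>x. x \<in> N \<Longrightarrow> x [^] r = \<one>"
proof -
  have "Coset.order G \<noteq> 0"
  proof
    assume "Coset.order G = 0"
    with ord pq show False by (auto simp: prime_nat_iff)
  qed
  then have fin: "finite (carrier G)" by (simp add: Coset.order_def card_ge_0_finite)
  let ?H = "\<lambda>n. (derived G ^^ n) (carrier G)"
  have normal: "?H n \<lhd> G" for n
  proof (induction n)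
    case 0
    show ?case by (simp add: normal_inv_iff subgroup_self)
  next
    case (Suc n)
    then show ?case by (simp add: derived_is_normal)
  qed
  obtain n where n: "?H n \<noteq> {\<one>}" and min: "\<And>m. ?H m \<noteq> {\<one>} \<Longrightarrow> card (?H n) \<le> card (?H m)"
    using ex_has_least_nat[of "\<lambda>n. ?H n \<noteq> {\<one>}" 0 "\<lambda>n. card (?H n)"] nontriv by auto
  let ?A = "?H n"
  have A: "subgroup ?A G" using normal normal_imp_subgroup by blast
  have finA: "finite ?A" using subgroup.subset[OF A] fin finite_subset by blast
  interpret A: group "G\<lparr>carrier := ?A\<rparr>" using A by (rule subgroup_imp_group)
  have ordA: "Coset.order (G\<lparr>carrier := ?A\<rparr>) dvd p ^ a * q ^ b"
  proof -
    have "Coset.order G = card ?A * card (rcosets ?A)" by (subst mult.commute) (rule lagrange[OF A, symmetric])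
    then have "card ?A dvd Coset.order G" by (rule dvdI)
    then show ?thesis using ord by (simp add: Coset.order_def)
  qed
  have "derived G ?A \<noteq> ?A"
    using A.two_prime_group_not_perfect[OF pq ordA] n derived_consistent[OF _ A, of ?A] by simp
  moreover have sub: "derived G ?A \<subseteq> ?A" using derived_incl[OF _ A] by blast
  ultimately have "card (derived G ?A) < card ?A" using psubset_card_mono[OF finA, of "derived G ?A"] by blast
  then have der: "derived G ?A = {\<one>}" using min[of "Suc n"] by force
  have comm: "x \<otimes> y = y \<otimes> x" if xy: "x \<in> ?A" "y \<in> ?A" for x y
  proof -
    have c: "x \<in> carrier G" "y \<in> carrier G" using xy subgroup.subset[OF A] by auto
    have "x \<otimes> y \<otimes> inv x \<otimes> inv y \<in> derived G ?A"
      unfolding derived_def[of G ?A]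
      by (rule generate.incl, rule UN_I[OF xy(1)], rule UN_I[OF xy(2)]) simp
    then have "x \<otimes> y \<otimes> inv x \<otimes> inv y = \<one>" using der by simp
    then have "x \<otimes> y \<otimes> inv (y \<otimes> x) = \<one>" using c by (simp add: inv_mult_group m_assoc)
    then have "inv (inv (y \<otimes> x)) = x \<otimes> y" using c by (intro inv_equality) auto
    then show ?thesis using c by simp
  qed
  have "card ?A \<noteq> 1"
  proof
    assume "card ?A = 1"
    then obtain y where "?A = {y}" by (auto simp: card_Suc_eq)
    then show False using n subgroup.one_closed[OF A] by auto
  qed
  then obtain r where r: "prime r" "r dvd card ?A" using prime_factor_nat by blast
  have "r dvd p ^ a * q ^ b" using r(2) ordA by (simp add: Coset.order_def dvd_trans)
  then have rpq: "r = p \<or> r = q"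
    using r(1) pq by (auto simp: prime_dvd_mult_iff dest: prime_dvd_power primes_dvd_imp_eq)
  define N where "N = {x \<in> ?A. x [^] r = \<one>}"
  have pow_conj: "(u \<otimes> x \<otimes> inv u) [^] (m::nat) = u \<otimes> x [^] m \<otimes> inv u" if "u \<in> carrier G" "x \<in> carrier G" for u x m
  proof (induction m)
    case (Suc m)
    have "inv u \<otimes> (u \<otimes> (x \<otimes> inv u)) = x \<otimes> inv u" using that by (simp add: m_assoc[symmetric])
    then show ?case using that Suc by (simp add: m_assoc)
  qed (use that in simp)
  have memA: "x \<in> carrier G" if "x \<in> ?A" for x using that subgroup.subset[OF A] by auto
  have "N \<lhd> G"
  proof (rule normal_invI)
    show "subgroup N G"
    proof
      show "x \<otimes> y \<in> N" if "x \<in> N" "y \<in> N" for x y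
        using that comm memA pow_mult_distrib[of x y r] subgroup.m_closed[OF A] by (auto simp: N_def)
      show "inv x \<in> N" if "x \<in> N" for x
        using that memA subgroup.m_inv_closed[OF A] by (auto simp: N_def nat_pow_inv)
    qed (use memA subgroup.one_closed[OF A] in \<open>auto simp: N_def\<close>)
    show "u \<otimes> x \<otimes> inv u \<in> N" if "u \<in> carrier G" "x \<in> N" for u x
      using that memA pow_conj normal.inv_op_closed2[OF normal] by (auto simp: N_def)
  qed
  moreover obtain x where x: "x \<in> ?A" "x \<noteq> \<one>" "x [^]\<^bsub>G\<lparr>carrier := ?A\<rparr>\<^esub> r = \<one>"
    using A.cauchy_prime_order[of r] finA r by (auto simp: Coset.order_def)
  then have "x \<in> N" using A by (simp add: N_def nat_pow_consistent[symmetric])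
  then have "N \<noteq> {\<one>}" using x(2) by blast
  ultimately have "N \<lhd> G" "N \<noteq> {\<one>}" by blast+
  then show ?thesis
  proof (rule that[OF _ _ rpq])
    show "x \<otimes> y = y \<otimes> x" if "x \<in> N" "y \<in> N" for x y
      using that unfolding N_def by (intro comm) simp_all
    show "x [^] r = \<one>" if "x \<in> N" for x using that unfolding N_def by simp
  qed
qed

end

section \<open>Sign sequences invariant under two reflections\<close>

text \<open>
  A group of sign sequences on the integers that is invariant under the reflections in \<open>0\<close> and in \<open>1\<close>.
  These generate the translations by even numbers, so positions of the two parities are not
  exchanged.
\<close>
locale dihedral_code =
  fixes F :: "(int \<Rightarrow> int) set"
  assumes one: "(\<lambda>_. 1) \<in> F"
    and mult: "f \<in> F \<Longrightarrow> g \<in> F \<Longrightarrow> (\<lambda>i. f i * g i) \<in> F"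
    and reflect0: "f \<in> F \<Longrightarrow> (\<lambda>i. f (- i)) \<in> F"
    and reflect1: "f \<in> F \<Longrightarrow> (\<lambda>i. f (2 - i)) \<in> F"
    and square: "f \<in> F \<Longrightarrow> f i * f i = 1"
begin

lemma sign_values: "f \<in> F \<Longrightarrow> f i = 1 \<or> f i = - 1"
  using square[of f i] by (metis square_eq_1_iff)

lemma shift: "f \<in> F \<Longrightarrow> (\<lambda>i. f (i + 2 * z)) \<in> F"
proof (induction z rule: int_induct[where k = 0])
  case base
  then show ?case by simp
next
  case (step1 z)
  from reflect0[OF reflect1[OF step1(2)[OF step1(3)]]] show ?case by (simp add: algebra_simps)
next
  case (step2 z)
  from reflect1[OF reflect0[OF step2(2)[OF step2(3)]]] show ?case by (simp add: algebra_simps)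
qed

lemma reflect: "f \<in> F \<Longrightarrow> (\<lambda>i. f (2 * c - i)) \<in> F"
proof -
  assume "f \<in> F"
  from reflect0[OF shift[OF this, of c]] show ?thesis by (simp add: algebra_simps)
qed

lemma prod_closed: "(\<And>j. j \<in> J \<Longrightarrow> f j \<in> F) \<Longrightarrow> (\<lambda>i. \<Prod>j\<in>J. f j i) \<in> F"
  by (induction J rule: infinite_finite_induct) (auto simp: one mult)

lemma ex_period:
  assumes "finite F"
  obtains n :: nat where "n > 0" "\<And>f i. f \<in> F \<Longrightarrow> f (i + 2 * int n) = f i"
proof -
  have "\<exists>n>0. \<forall>i. f (i + 2 * int n) = f i" if f: "f \<in> F" for f
  proof -
    let ?s = "\<lambda>k::nat. (\<lambda>i. f (i + 2 * int k))"
    have "?s ` UNIV \<subseteq> F" using shift[OF f] by blast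
    then have "finite (?s ` UNIV)" using assms finite_subset by blast
    then have "\<not> inj ?s" using finite_imageD by blast
    then obtain k l where kl: "?s k = ?s l" "k < l"
      by (metis (mono_tags, lifting) injI linorder_neqE_nat)
    have "f (i + 2 * int (l - k)) = f i" for i
      using fun_cong[OF kl(1), of "i - 2 * int k"] kl(2) by (simp add: algebra_simps of_nat_diff)
    then show ?thesis using kl(2) by (intro exI[of _ "l - k"]) simp
  qed
  then obtain n where n: "\<And>f. f \<in> F \<Longrightarrow> n f > 0" "\<And>f i. f \<in> F \<Longrightarrow> f (i + 2 * int (n f)) = f i" by metis
  have multiple: "f (i + 2 * int (n f * k)) = f i" if "f \<in> F" for f i k
  proof (induction k)
    case (Suc k)
    have "f (i + 2 * int (n f * Suc k)) = f ((i + 2 * int (n f * k)) + 2 * int (n f))" by (simp add: algebra_simps)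
    then show ?case using n(2)[OF that] Suc by simp
  qed simp
  show ?thesis
  proof (rule that[of "\<Prod>f\<in>F. n f"])
    show "(\<Prod>f\<in>F. n f) > 0" using n(1) by (intro prod_pos) blast
    fix f i assume f: "f \<in> F"
    have "(\<Prod>f\<in>F. n f) = n f * (\<Prod>f\<in>F - {f}. n f)" using assms f by (rule prod.remove)
    then show "f (i + 2 * int (\<Prod>f\<in>F. n f)) = f i" using multiple[OF f] by (simp only:)
  qed
qed

text \<open>
  Removing an odd factor \<open>m\<close> from the period.  The product \<open>q0\<close> of the \<open>m\<close> translates of \<open>q\<close> by multiples of
  \<open>s\<close> has period \<open>s\<close>.  By symmetry the translates other than \<open>q\<close> itself come in mirror pairs, so that
  \<open>q0\<close> and \<open>q\<close> differ by the product of some \<open>f\<close> with its mirror image.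
\<close>
lemma average_symmetric:
  assumes m: "odd m" and period: "\<And>i. q (i + int m * s) = q i" and q: "q \<in> F" and s: "even s"
    and sym: "\<And>i. q (2 * c - i) = q i" and center: "q c = 1"
  shows "\<exists>f\<in>F. \<exists>q0\<in>F. (\<forall>i. q0 (i + s) = q0 i) \<and> (\<forall>i. q0 i = q i * (f i * f (2 * c - i))) \<and>
    (\<forall>i. q0 (2 * c - i) = q0 i) \<and> q0 c = 1"
proof -
  obtain h where h: "m = 2 * h + 1" using m by (auto elim: oddE)
  define f where "f i = (\<Prod>j\<in>{1..h}. q (i + int j * s))" for i
  define q0 where "q0 i = (\<Prod>j<m. q (i + int j * s))" for i
  obtain s' where s': "s = 2 * s'" using s by (auto elim: evenE)
  have shifted: "(\<lambda>i. q (i + int j * s)) \<in> F" for j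
    using shift[OF q, of "int j * s'"] by (simp add: s' algebra_simps)
  have f: "f \<in> F" unfolding f_def by (rule prod_closed) (rule shifted)
  have q0: "q0 \<in> F" unfolding q0_def by (rule prod_closed) (rule shifted)
  have split: "q0 i = q i * (f i * f (2 * c - i))" for i
  proof -
    have "{..<m} = insert 0 ({1..h} \<union> {h+1..2*h})" by (auto simp: h)
    then have "q0 i = q i * (\<Prod>j\<in>{1..h} \<union> {h+1..2*h}. q (i + int j * s))" by (simp add: q0_def)
    also have "\<dots> = q i * (f i * (\<Prod>j\<in>{h+1..2*h}. q (i + int j * s)))"
      by (subst prod.union_disjoint) (auto simp: f_def)
    also have "(\<Prod>j\<in>{h+1..2*h}. q (i + int j * s)) = (\<Prod>j\<in>{1..h}. q (i + int (m - j) * s))"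
      by (rule prod.reindex_bij_witness[of _ "\<lambda>j. m - j" "\<lambda>j. m - j"]) (auto simp: h)
    also have "\<dots> = (\<Prod>j\<in>{1..h}. q (2 * c - i + int j * s))"
    proof (rule prod.cong[OF refl])
      fix j assume j: "j \<in> {1..h}"
      have "q (i + int (m - j) * s) = q ((i - int j * s) + int m * s)" using j h by (simp add: algebra_simps of_nat_diff)
      also have "\<dots> = q (2 * c - (i - int j * s))" by (simp only: period sym)
      finally show "q (i + int (m - j) * s) = q (2 * c - i + int j * s)" by (simp add: algebra_simps)
    qed
    finally show ?thesis by (simp add: f_def)
  qed
  have inv: "q0 (i + s) = q0 i" for i
  proof -
    have "q0 (i + s) = (\<Prod>j<m. q (i + int (Suc j) * s))" by (simp add: q0_def algebra_simps)
    also have "\<dots> * q (i + int 0 * s) = (\<Prod>j<Suc m. q (i + int j * s))" by (subst prod.lessThan_Suc_shift) (simp add: mult.commute)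
    also have "\<dots> = q0 i * q (i + int m * s)" by (simp add: q0_def)
    finally have "q0 (i + s) * q i = q0 i * q i" using period by simp
    then show ?thesis using square[OF q, of i] by auto
  qed
  have "q0 (2 * c - i) = q0 i" for i using sym by (simp add: split mult.commute)
  moreover have "q0 c = 1" using center square[OF f, of c] by (simp add: split)
  ultimately show ?thesis using f q0 inv split by blast
qed

text \<open>
  Multiplying \<open>f\<close> by its translate by half of the period halves the period; if this gives the constant
  \<open>1\<close>, then \<open>f\<close> has half of the period already.
\<close>
lemma ex_period_two:
  assumes "f \<in> F" "f \<noteq> (\<lambda>_. 1)" and "\<And>i. f (i + 2 ^ Suc k) = f i" and "\<And>i. even (i - t) \<Longrightarrow> f i = 1"
  shows "\<exists>z\<in>F. z \<noteq> (\<lambda>_. 1) \<and> (\<forall>i. z (i + 2) = z i) \<and> (\<forall>i. even (i - t) \<longrightarrow> z i = 1)"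
  using assms
proof (induction k arbitrary: f)
  case 0
  then show ?case by auto
next
  case (Suc k)
  define g where "g i = f i * f (i + 2 ^ Suc k)" for i
  have g: "g \<in> F" unfolding g_def using mult[OF Suc.prems(1) shift[OF Suc.prems(1), of "2 ^ k"]] by simp
  show ?case
  proof (cases "g = (\<lambda>_. 1)")
    case True
    have "f (i + 2 ^ Suc k) = f i" for i
      using fun_cong[OF True, of i] sign_values[OF Suc.prems(1), of i] sign_values[OF Suc.prems(1), of "i + 2 ^ Suc k"]
      by (auto simp: g_def)
    from Suc.IH[OF Suc.prems(1,2) this Suc.prems(4)] show ?thesis .
  next
    case False
    have "g (i + 2 ^ Suc k) = g i" for i
      using Suc.prems(3)[of i] by (simp add: g_def algebra_simps)
    moreover have "g i = 1" if "even (i - t)" for i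
      using Suc.prems(4)[of i] Suc.prems(4)[of "i + 2 ^ Suc k"] that by (simp add: g_def)
    ultimately show ?thesis using Suc.IH[OF g False] by blast
  qed
qed

end

locale two_periodic_code = dihedral_code +
  fixes k :: nat
  assumes period: "f \<in> F \<Longrightarrow> f (i + 2 ^ Suc k) = f i"
    and no_minus_one: "(\<lambda>_. - 1) \<notin> F"
begin

text \<open>
  Otherwise there are nontrivial elements of period \<open>2\<close> vanishing, in the sense of being \<open>1\<close>, on the
  even and on the odd positions respectively.  They are \<open>-1\<close> on the other parity, so their product is
  the constant \<open>-1\<close>.
\<close>
lemma parity_determines:
  assumes "F \<noteq> {\<lambda>_. 1}"
  obtains t :: int where "t = 0 \<or> t = 1" "\<And>f. f \<in> F \<Longrightarrow> (\<And>j. f (t + 2 * j) = 1) \<Longrightarrow> f = (\<lambda>_. 1)"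
proof -
  note result = that
  have const: "z (i + 2 * j) = z i" if "\<And>i. z (i + 2) = z i" for z :: "int \<Rightarrow> int" and i j
  proof (induction j rule: int_induct[where k = 0])
    case (step1 j)
    then show ?case using that[of "i + 2 * j"] by (simp add: algebra_simps)
  next
    case (step2 j)
    then show ?case using that[of "i + 2 * (j - 1)"] by (simp add: algebra_simps)
  qed simp
  have all: "z i = z 0 \<or> z i = z 1" if "\<And>i. z (i + 2) = z i" for z :: "int \<Rightarrow> int" and i
  proof (cases "even i")
    case True
    then obtain j where "i = 2 * j" by (auto elim: evenE)
    then show ?thesis using const[of z 0 j] that by simp
  next
    case False
    then obtain j where "i = 2 * j + 1" by (auto elim: oddE)
    then show ?thesis using const[of z 1 j] that by (simp add: add.commute)
  qed
  have ex_z: "\<exists>z\<in>F. z \<noteq> (\<lambda>_. 1) \<and> (\<forall>i. z (i + 2) = z i) \<and> z t = 1"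
    if "f \<in> F" "f \<noteq> (\<lambda>_. 1)" "\<And>j. f (t + 2 * j) = 1" for f t
  proof -
    have "f i = 1" if "even (i - t)" for i
    proof -
      from that obtain j where "i - t = 2 * j" by (rule evenE)
      then have "i = t + 2 * j" by simp
      then show ?thesis using \<open>\<And>j. f (t + 2 * j) = 1\<close> by simp
    qed
    from ex_period_two[OF that(1,2) period[OF that(1)] this] obtain z where
      "z \<in> F" "z \<noteq> (\<lambda>_. 1)" "\<forall>i. z (i + 2) = z i" "\<forall>i. even (i - t) \<longrightarrow> z i = 1" by blast
    then show ?thesis by (intro bexI[of _ z]) auto
  qed
  show ?thesis
  proof (rule ccontr)
    assume no: "\<not> thesis"
    have "\<exists>z\<in>F. z \<noteq> (\<lambda>_. 1) \<and> (\<forall>i. z (i + 2) = z i) \<and> z t = 1" if t: "t = 0 \<or> t = 1" for t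
    proof -
      have "\<exists>f\<in>F. f \<noteq> (\<lambda>_. 1) \<and> (\<forall>j. f (t + 2 * j) = 1)"
      proof (rule ccontr)
        assume "\<not> ?thesis"
        then have "f = (\<lambda>_. 1)" if "f \<in> F" "\<And>j. f (t + 2 * j) = 1" for f using that by blast
        from result[OF t this] no show False by blast
      qed
      then show ?thesis using ex_z by blast
    qed
    from this[of 0] this[of 1] obtain y z where
      y: "y \<in> F" "y \<noteq> (\<lambda>_. 1)" "\<And>i. y (i + 2) = y i" "y 0 = 1" and
      z: "z \<in> F" "z \<noteq> (\<lambda>_. 1)" "\<And>i. z (i + 2) = z i" "z 1 = 1" by blast
    have ay: "y i = y 0 \<or> y i = y 1" and az: "z i = z 0 \<or> z i = z 1" for i
      using all[of y i] all[of z i] y(3) z(3) by blast+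
    have "y 1 \<noteq> 1" "z 0 \<noteq> 1"
      using ay az y(2,4) z(2,4) by (auto simp: fun_eq_iff)
    then have y1: "y 1 = - 1" and z0: "z 0 = - 1"
      using sign_values[OF y(1), of 1] sign_values[OF z(1), of 0] by auto
    have "y i * z i = - 1" for i
    proof (cases "even i")
      case True
      then obtain j where "i = 2 * j" by (auto elim: evenE)
      then show ?thesis using const[of y 0 j] const[of z 0 j] y(3,4) z(3) z0 by simp
    next
      case False
      then obtain j where "i = 2 * j + 1" by (auto elim: oddE)
      then show ?thesis using const[of y 1 j] const[of z 1 j] y(3) z(3,4) y1 by (simp add: add.commute)
    qed
    then have "(\<lambda>i. y i * z i) = (\<lambda>_. - 1)" by blast
    then show False using mult[OF y(1) z(1)] no_minus_one by simp
  qed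
qed

text \<open>
  Take the least \<open>d\<close> such that the values at \<open>d\<close> consecutive positions of parity \<open>t\<close> determine an
  element.  By minimality some element is \<open>1\<close> at \<open>d - 1\<close> consecutive positions and \<open>-1\<close> at the next one;
  with its translates the values at \<open>d\<close> consecutive positions can be prescribed one after the other.
\<close>
lemma windows:
  assumes det: "\<And>f. f \<in> F \<Longrightarrow> (\<And>j. f (t + 2 * j) = 1) \<Longrightarrow> f = (\<lambda>_. 1)"
  obtains d :: nat where "\<And>f a. f \<in> F \<Longrightarrow> (\<And>j. a \<le> j \<Longrightarrow> j < a + int d \<Longrightarrow> f (t + 2 * j) = 1) \<Longrightarrow> f = (\<lambda>_. 1)"
    "\<And>v a. (\<And>j. v j = 1 \<or> v j = (-1::int)) \<Longrightarrow> \<exists>f\<in>F. \<forall>j. a \<le> j \<and> j < a + int d \<longrightarrow> f (t + 2 * j) = v j"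
proof -
  define P where "P d \<longleftrightarrow> (\<forall>f\<in>F. (\<forall>j. 0 \<le> j \<and> j < int d \<longrightarrow> f (t + 2 * j) = 1) \<longrightarrow> f = (\<lambda>_. 1))" for d
  have multiple: "f (i + 2 ^ Suc k * z) = f i" if f: "f \<in> F" for f i z
  proof (induction z rule: int_induct[where k = 0])
    case (step1 z)
    then show ?case using period[OF f, of "i + 2 ^ Suc k * z"] by (simp add: algebra_simps)
  next
    case (step2 z)
    then show ?case using period[OF f, of "i + 2 ^ Suc k * (z - 1)"] by (simp add: algebra_simps)
  qed simp
  have "P (2 ^ k)"
    unfolding P_def
  proof (intro ballI impI)
    fix f assume f: "f \<in> F" and 1: "\<forall>j. 0 \<le> j \<and> j < int (2 ^ k) \<longrightarrow> f (t + 2 * j) = 1"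
    show "f = (\<lambda>_. 1)"
    proof (rule det[OF f])
      fix j :: int
      obtain a b where ab: "j = a + 2 ^ k * b" "0 \<le> a" "a < 2 ^ k"
        by (rule that[of "j mod 2 ^ k" "j div 2 ^ k"]) simp_all
      have "f (t + 2 * j) = f (t + 2 * a + 2 ^ Suc k * b)" by (simp add: ab(1) algebra_simps)
      also have "\<dots> = f (t + 2 * a)" by (rule multiple[OF f])
      finally show "f (t + 2 * j) = 1" using 1 ab by simp
    qed
  qed
  then obtain d where d: "P d" "\<And>e. e < d \<Longrightarrow> \<not> P e" using exists_least_iff[of P] by blast
  have inj: "f = (\<lambda>_. 1)" if f: "f \<in> F" and 1: "\<And>j. a \<le> j \<Longrightarrow> j < a + int d \<Longrightarrow> f (t + 2 * j) = 1" for f a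
  proof -
    have "(\<lambda>i. f (i + 2 * a)) = (\<lambda>_. 1)"
      using d(1) shift[OF f, of a] 1[of "_ + a"] unfolding P_def by (auto simp: algebra_simps)
    then have "f (i - 2 * a + 2 * a) = 1" for i by meson
    then show ?thesis by auto
  qed
  have surj: "\<exists>f\<in>F. \<forall>j. a \<le> j \<and> j < a + int l \<longrightarrow> f (t + 2 * j) = v j"
    if "l \<le> d" and v: "\<And>j. v j = 1 \<or> v j = (-1::int)" for l a v
    using that(1)
  proof (induction l)
    case 0
    then show ?case using one by auto
  next
    case (Suc l)
    then obtain f where f: "f \<in> F" "\<And>j. a \<le> j \<Longrightarrow> j < a + int l \<Longrightarrow> f (t + 2 * j) = v j" by auto
    show ?case
    proof (cases "f (t + 2 * (a + int l)) = v (a + int l)")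
      case True
      have "f (t + 2 * j) = v j" if "a \<le> j" "j < a + int (Suc l)" for j
        using that f(2)[of j] True by (cases "j = a + int l") auto
      then show ?thesis using f(1) by blast
    next
      case False
      have "\<not> P (d - 1)" using d(2) Suc.prems by simp
      then obtain g where g: "g \<in> F" "\<And>j. 0 \<le> j \<Longrightarrow> j < int (d - 1) \<Longrightarrow> g (t + 2 * j) = 1" "g \<noteq> (\<lambda>_. 1)"
        unfolding P_def by blast
      have "g (t + 2 * int (d - 1)) \<noteq> 1"
      proof
        assume 1: "g (t + 2 * int (d - 1)) = 1"
        have "g (t + 2 * j) = 1" if "0 \<le> j" "j < 0 + int d" for j
          using that 1 g(2)[of j] by (cases "j = int (d - 1)") auto
        from inj[OF g(1) this] g(3) show False by blast
      qed
      then have last: "g (t + 2 * int (d - 1)) = - 1" using sign_values[OF g(1)] by blast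
      define h where "h i = g (i + 2 * (int (d - 1) - a - int l))" for i
      have h: "h \<in> F" unfolding h_def by (rule shift[OF g(1)])
      have h1: "h (t + 2 * j) = 1" if "a \<le> j" "j < a + int l" for j
        using g(2)[of "j + (int (d - 1) - a - int l)"] that Suc.prems by (simp add: h_def algebra_simps)
      have h2: "h (t + 2 * (a + int l)) = - 1" using last by (simp add: h_def algebra_simps)
      have "f (t + 2 * j) * h (t + 2 * j) = v j" if "a \<le> j" "j < a + int (Suc l)" for j
      proof (cases "j = a + int l")
        case True
        then show ?thesis using False h2 v[of j] sign_values[OF f(1), of "t + 2 * j"] by auto
      next
        case False
        then show ?thesis using that f(2)[of j] h1[of j] by auto
      qed
      then show ?thesis by (intro bexI[OF _ mult[OF f(1) h]]) simp
    qed
  qed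
  show ?thesis by (rule that[of d, OF inj surj[OF order_refl]])
qed

text \<open>
  Depending on the parity of \<open>d\<close>, a window of length \<open>d\<close> from the previous lemma is symmetric about \<open>0\<close> or
  about \<open>1\<close>.  For the corresponding symmetric sequence \<open>r\<close> choose \<open>f\<close> that agrees with \<open>r\<close> on the right
  half of the window and is \<open>1\<close> on the rest.  Then \<open>r\<close> agrees with the product of \<open>f\<close> and its mirror image
  on the window, where \<open>r c = 1\<close> is used if the centre \<open>c\<close> belongs to it, and therefore everywhere.
\<close>
lemma periodic_symmetric_is_norm:
  assumes q: "q \<in> F" "\<And>i. q (- i) = q i" "q 0 = 1" and p: "p \<in> F" "\<And>i. p (2 - i) = p i" "p 1 = 1"
  shows "\<exists>f\<in>F. (\<forall>i. q i = f i * f (- i)) \<or> (\<forall>i. p i = f i * f (2 - i))"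
proof (cases "F = {\<lambda>_. 1}")
  case True
  then show ?thesis using q(1) one by auto
next
  case False
  show ?thesis
  proof (rule parity_determines[OF False])
  fix t :: int assume t: "t = 0 \<or> t = 1" and det: "\<And>f. f \<in> F \<Longrightarrow> (\<And>j. f (t + 2 * j) = 1) \<Longrightarrow> f = (\<lambda>_. 1)"
  show ?thesis
  proof (rule windows[OF det])
  fix d :: nat
  assume inj: "\<And>f a. f \<in> F \<Longrightarrow> (\<And>j. a \<le> j \<Longrightarrow> j < a + int d \<Longrightarrow> f (t + 2 * j) = 1) \<Longrightarrow> f = (\<lambda>_. 1)"
    and surj: "\<And>v a. (\<And>j. v j = 1 \<or> v j = (-1::int)) \<Longrightarrow> \<exists>f\<in>F. \<forall>j. a \<le> j \<and> j < a + int d \<longrightarrow> f (t + 2 * j) = v j"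
  have key: "\<exists>f\<in>F. \<forall>i. r i = f i * f (2 * c - i)"
    if r: "r \<in> F" "\<And>i. r (2 * c - i) = r i" "r c = 1" and a: "2 * a + int d - 1 = c - t" for r c a
  proof -
    \<comment> \<open>the reflection in c acts on the positions t + 2 j by j -> c - t - j and preserves the window\<close>
    define v where "v j = (if 2 * j > c - t then r (t + 2 * j) else 1)" for j
    have vv: "v j = 1 \<or> v j = - 1" for j using sign_values[OF r(1)] by (simp add: v_def)
    have "\<exists>f\<in>F. \<forall>j. a \<le> j \<and> j < a + int d \<longrightarrow> f (t + 2 * j) = v j"
      by (rule surj) (rule vv)
    then obtain f where f': "f \<in> F" "\<forall>j. a \<le> j \<and> j < a + int d \<longrightarrow> f (t + 2 * j) = v j" by (elim bexE)
    have f: "f \<in> F" "f (t + 2 * j) = v j" if "a \<le> j" "j < a + int d" for j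
      using f' that by simp_all
    define g where "g i = r i * (f i * f (2 * c - i))" for i
    have g: "g \<in> F" unfolding g_def by (intro mult r(1) f'(1) reflect)
    have "g (t + 2 * j) = 1" if j: "a \<le> j" "j < a + int d" for j
    proof -
      have refl: "2 * c - (t + 2 * j) = t + 2 * (c - t - j)" by simp
      have j': "a \<le> c - t - j" "c - t - j < a + int d" using j a by linarith+
      have fj: "f (t + 2 * j) = v j" "f (2 * c - (t + 2 * j)) = v (c - t - j)"
        using f(2)[OF j] f(2)[OF j'] by (simp_all add: refl)
      have rr: "r (t + 2 * (c - t - j)) = r (t + 2 * j)" using r(2)[of "t + 2 * j"] by (simp add: refl)
      consider "2 * j > c - t" | "2 * j = c - t" | "2 * j < c - t" by linarith
      then show ?thesis
      proof cases
        case 1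
        then show ?thesis using square[OF r(1)] by (simp add: g_def fj v_def)
      next
        case 2
        then have "t + 2 * j = c" by simp
        then show ?thesis using 2 r(3) fj unfolding g_def by (simp add: v_def)
      next
        case 3
        then show ?thesis using square[OF r(1)] rr by (simp add: g_def fj v_def)
      qed
    qed
    from inj[OF g this] have g1: "g i = 1" for i by simp
    have "r i = f i * f (2 * c - i)" for i
    proof -
      have "r i = r i * g i" by (simp add: g1)
      also have "\<dots> = (r i * r i) * (f i * f (2 * c - i))" unfolding g_def by (rule mult.assoc[symmetric])
      finally show ?thesis using square[OF r(1)] by simp
    qed
    then show ?thesis by (intro bexI[OF _ f'(1)] allI)
  qed
  have q': "\<exists>f\<in>F. \<forall>i. q i = f i * f (- i)" if "2 * a + int d - 1 = 0 - t" for a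
    using key[of q 0 a] q that by simp
  have p': "\<exists>f\<in>F. \<forall>i. p i = f i * f (2 - i)" if "2 * a + int d - 1 = 1 - t" for a
    using key[of p 1 a] p that by simp
  have "\<exists>a. 2 * a = 1 - t - int d \<or> 2 * a = 2 - t - int d"
  proof (cases "even (1 - t - int d)")
    case True
    then show ?thesis by (metis evenE)
  next
    case False
    then have "even (2 - t - int d)" by simp
    then show ?thesis by (metis evenE)
  qed
  then obtain a where "2 * a = 1 - t - int d \<or> 2 * a = 2 - t - int d" by blast
  then have "2 * a + int d - 1 = 0 - t \<or> 2 * a + int d - 1 = 1 - t" by linarith
  then show ?thesis using q' p' by blast
  qed
  qed
qed

end

text \<open>
  Being a product of some \<open>f\<close> with its mirror image is the triviality of a class in the cohomology of a
  reflection acting on the code; the claim is that one of the two given classes is trivial.  A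
  common period is \<open>2\<^bsup>k+1\<^esup>m\<close> with \<open>m\<close> odd, and \<open>average_symmetric\<close> reduces to sequences of period
  \<open>2\<^bsup>k+1\<^esup>\<close>.
\<close>
theorem (in dihedral_code) symmetric_is_norm:
  assumes fin: "finite F" and no: "(\<lambda>_. - 1) \<notin> F"
    and q: "q \<in> F" "\<And>i. q (- i) = q i" "q 0 = 1" and p: "p \<in> F" "\<And>i. p (2 - i) = p i" "p 1 = 1"
  shows "\<exists>f\<in>F. (\<forall>i. q i = f i * f (- i)) \<or> (\<forall>i. p i = f i * f (2 - i))"
proof -
  obtain n :: nat where n: "n > 0" "\<And>f i. f \<in> F \<Longrightarrow> f (i + 2 * int n) = f i"
    by (rule ex_period[OF fin]) (rule that; assumption)
  obtain k m where km: "n = 2 ^ k * m" "odd m"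
  proof -
    obtain m where "n = 2 ^ multiplicity 2 n * m" "\<not> 2 dvd m"
      using multiplicity_decompose'[of n 2] n(1) by auto
    then show ?thesis using that by blast
  qed
  let ?s = "2 ^ Suc k :: int"
  have per: "f (i + int m * ?s) = f i" if "f \<in> F" for f i
    using n(2)[OF that, of i] by (simp add: km algebra_simps)
  have "\<exists>f\<in>F. \<exists>q0\<in>F. (\<forall>i. q0 (i + ?s) = q0 i) \<and> (\<forall>i. q0 i = q i * (f i * f (2 * 0 - i))) \<and>
    (\<forall>i. q0 (2 * 0 - i) = q0 i) \<and> q0 0 = 1"
    by (rule average_symmetric[OF km(2) per[OF q(1)] q(1)]) (use q in auto)
  then obtain f q0 where fq: "f \<in> F" "q0 \<in> F" "\<And>i. q0 (i + ?s) = q0 i" "\<And>i. q0 i = q i * (f i * f (2 * 0 - i))"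
    "\<And>i. q0 (2 * 0 - i) = q0 i" "q0 0 = 1" by blast
  have "\<exists>g\<in>F. \<exists>p0\<in>F. (\<forall>i. p0 (i + ?s) = p0 i) \<and> (\<forall>i. p0 i = p i * (g i * g (2 * 1 - i))) \<and>
    (\<forall>i. p0 (2 * 1 - i) = p0 i) \<and> p0 1 = 1"
    by (rule average_symmetric[OF km(2) per[OF p(1)] p(1)]) (use p in auto)
  then obtain g p0 where gp: "g \<in> F" "p0 \<in> F" "\<And>i. p0 (i + ?s) = p0 i" "\<And>i. p0 i = p i * (g i * g (2 * 1 - i))"
    "\<And>i. p0 (2 * 1 - i) = p0 i" "p0 1 = 1" by blast
  interpret F0: two_periodic_code "{f \<in> F. \<forall>i. f (i + ?s) = f i}" k
  proof
    fix h assume h: "h \<in> {f \<in> F. \<forall>i. f (i + ?s) = f i}"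
    have 1: "h (- (i + ?s)) = h (- i)" for i using h spec[of "\<lambda>i. h (i + ?s) = h i" "- (i + ?s)"] by simp
    have 2: "h (2 - (i + ?s)) = h (2 - i)" for i using h spec[of "\<lambda>i. h (i + ?s) = h i" "2 - (i + ?s)"] by simp
    show "(\<lambda>i. h (- i)) \<in> {f \<in> F. \<forall>i. f (i + ?s) = f i}" using h 1 reflect0 by blast
    show "(\<lambda>i. h (2 - i)) \<in> {f \<in> F. \<forall>i. f (i + ?s) = f i}" using h 2 reflect1 by blast
    show "h i * h i = 1" for i using h square by blast
    show "h (i + 2 ^ Suc k) = h i" for i using h by blast
  qed (use one mult no in auto)
  from F0.periodic_symmetric_is_norm[of q0 p0] fq gp obtain h where h: "h \<in> F"
    "(\<forall>i. q0 i = h i * h (- i)) \<or> (\<forall>i. p0 i = h i * h (2 - i))" by auto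
  from h(2) show ?thesis
  proof
    assume q0: "\<forall>i. q0 i = h i * h (- i)"
    have "q i = (f i * h i) * (f (- i) * h (- i))" for i
    proof -
      have "q i * ((f i * f i) * (f (- i) * f (- i))) = q0 i * (f i * f (- i))" using fq(4)[of i] by (simp add: algebra_simps)
      then show ?thesis using q0 square[OF fq(1)] by (simp add: algebra_simps)
    qed
    then show ?thesis by (intro bexI[OF _ mult[OF fq(1) h(1)]] disjI1 allI)
  next
    assume p0: "\<forall>i. p0 i = h i * h (2 - i)"
    have "p i = (g i * h i) * (g (2 - i) * h (2 - i))" for i
    proof -
      have "p i * ((g i * g i) * (g (2 - i) * g (2 - i))) = p0 i * (g i * g (2 - i))" using gp(4)[of i] by (simp add: algebra_simps)
      then show ?thesis using p0 square[OF gp(1)] by (simp add: algebra_simps)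
    qed
    then show ?thesis by (intro bexI[OF _ mult[OF gp(1) h(1)]] disjI2 allI)
  qed
qed

section \<open>Permutation groups, semiregularity and signs\<close>

abbreviation perm_inv :: "('a \<Rightarrow> 'a) \<Rightarrow> 'a \<Rightarrow> 'a" where
  "perm_inv \<equiv> Hilbert_Choice.inv"

definition perm_group :: "('a \<Rightarrow> 'a) set \<Rightarrow> ('a \<Rightarrow> 'a) monoid" where
  "perm_group H = \<lparr>carrier = H, monoid.mult = (\<circ>), one = id\<rparr>"

lemma perm_group_simps [simp]:
  "carrier (perm_group H) = H" "x \<otimes>\<^bsub>perm_group H\<^esub> y = x \<circ> y" "\<one>\<^bsub>perm_group H\<^esub> = id"
  "Coset.order (perm_group H) = card H"
  by (simp_all add: perm_group_def Coset.order_def)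

lemma perm_group_pow [simp]: "x [^]\<^bsub>perm_group H\<^esub> (n::nat) = x ^^ n"
  by (induction n) (simp_all add: perm_group_def monoid.nat_pow_0 nat_pow_def funpow_swap1 fun_eq_iff)

lemma group_perm_group:
  assumes "id \<in> H" "\<And>g h. g \<in> H \<Longrightarrow> h \<in> H \<Longrightarrow> g \<circ> h \<in> H"
    and "\<And>g. g \<in> H \<Longrightarrow> perm_inv g \<in> H" "\<And>g. g \<in> H \<Longrightarrow> bij g"
  shows "group (perm_group H)"
proof (rule groupI)
  fix x assume "x \<in> carrier (perm_group H)"
  then have "perm_inv x \<in> H" "perm_inv x \<circ> x = id" using assms(3,4) by (auto simp: bij_is_inj)
  then show "\<exists>y\<in>carrier (perm_group H). y \<otimes>\<^bsub>perm_group H\<^esub> x = \<one>\<^bsub>perm_group H\<^esub>" by auto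
qed (use assms in \<open>auto simp: o_assoc\<close>)

lemma perm_group_inv:
  assumes "group (perm_group H)" "g \<in> H" "bij g" "perm_inv g \<in> H"
  shows "inv\<^bsub>perm_group H\<^esub> g = perm_inv g"
  using assms by (intro group.inv_equality) (simp_all add: bij_is_inj)

lemma perm_group_cauchy:
  assumes "group (perm_group H)" "finite H" "prime p" "p dvd card H"
  shows "\<exists>x\<in>H. x \<noteq> id \<and> x ^^ p = id"
  using group.cauchy_prime_order[OF assms(1), of p] assms by simp

lemma perm_group_lagrange:
  assumes "group (perm_group H)" "x \<in> H"
  shows "x ^^ card H = id"
  using group.pow_order_eq_1[OF assms(1), of x] assms(2) by simp

text \<open>
  By Bezout a shorter period would imply that \<open>x\<close> is fixed by \<open>g\<close>.
\<close>
lemma prime_period_distinct: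
  assumes p: "prime p" and g: "(g ^^ p) x = x" "g x \<noteq> x" and inj: "inj g"
  shows "inj_on (\<lambda>i. (g ^^ i) x) {..<p}"
proof -
  have mult: "(g ^^ (a * k)) x = x" if "(g ^^ a) x = x" for a k
    using that by (induction k) (simp_all add: funpow_add)
  have no: "(g ^^ a) x \<noteq> x" if a: "0 < a" "a < p" for a
  proof
    assume fx: "(g ^^ a) x = x"
    have "coprime a p" using p a by (metis coprime_commute nat_dvd_not_less prime_imp_coprime)
    then obtain u w where uw: "a * u = p * w + 1"
      using coprime_bezout_strong[of a p] prime_gt_1_nat[OF p] by auto
    have "x = (g ^^ (p * w + 1)) x" using mult[OF fx, of u] uw by simp
    also have "\<dots> = g ((g ^^ (p * w)) x)" by simp
    also have "\<dots> = g x" using mult[OF g(1)] by simp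
    finally show False using g(2) by simp
  qed
  have "i = j" if ij: "i \<le> j" "j < p" "(g ^^ i) x = (g ^^ j) x" for i j
  proof (rule ccontr)
    assume "i \<noteq> j"
    have "(g ^^ i) ((g ^^ (j - i)) x) = (g ^^ i) x" using ij by (simp add: funpow_add[symmetric, THEN fun_cong, unfolded o_def])
    then have "(g ^^ (j - i)) x = x" using inj_fn[OF inj, of i] by (simp add: inj_eq)
    then show False using no[of "j - i"] ij \<open>i \<noteq> j\<close> by simp
  qed
  then show ?thesis by (intro inj_onI) (metis lessThan_iff linear)
qed

lemma prime_order_semiregular:
  assumes g: "g permutes V" and p: "prime p" "g ^^ p = id" and free: "\<And>v. v \<in> V \<Longrightarrow> g v \<noteq> v"
  shows "semiregular_on V g"
proof -
  have "card (Orbits.orbit g x) = p" if "x \<in> V" for x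
  proof -
    have "Orbits.orbit g x = (\<lambda>i. (g ^^ i) x) ` {..<p}"
      using p prime_gt_0_nat[OF p(1)] by (subst orbit_altdef_bounded[where n = p]) auto
    moreover have "inj_on (\<lambda>i. (g ^^ i) x) {..<p}"
      using prime_period_distinct[OF p(1), of g x] p(2) free[OF that] permutes_inj[OF g] by simp
    ultimately show ?thesis by (simp add: card_image)
  qed
  then show ?thesis using g by (simp add: semiregular_on_def)
qed

text \<open>
  An involution is a product of \<open>m\<close> disjoint transpositions.
\<close>
lemma involution_parity:
  assumes "finite Q" "\<And>e. e \<in> Q \<Longrightarrow> h e \<in> Q" "\<And>e. e \<in> Q \<Longrightarrow> h (h e) = e"
  shows "\<exists>m. card Q = card {e \<in> Q. h e = e} + 2 * m \<and> sign (\<lambda>e. if e \<in> Q then h e else e) = (-1) ^ m"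
  using assms
proof (induction "card Q" arbitrary: Q rule: less_induct)
  case less
  show ?case
  proof (cases "\<forall>e\<in>Q. h e = e")
    case True
    then have "{e \<in> Q. h e = e} = Q" "(\<lambda>e. if e \<in> Q then h e else e) = id" by auto
    then show ?thesis by (intro exI[of _ 0]) simp
  next
    case False
    then obtain e where e: "e \<in> Q" "h e \<noteq> e" by blast
    let ?R = "Q - {e, h e}"
    have he: "h e \<in> Q" using less.prems(2) e by blast
    have R: "finite ?R" "\<And>a. a \<in> ?R \<Longrightarrow> h a \<in> ?R" "\<And>a. a \<in> ?R \<Longrightarrow> h (h a) = a"
      using less.prems e he by auto metis+
    have card: "card Q = card ?R + 2"
      using e he less.prems(1) card_Diff_subset[of "{e, h e}" Q] card_mono[of Q "{e, h e}"] by simp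
    then obtain m where m: "card ?R = card {a \<in> ?R. h a = a} + 2 * m"
      "sign (\<lambda>a. if a \<in> ?R then h a else a) = (-1) ^ m"
      using less.hyps[OF _ R] by auto
    have fixed: "{a \<in> ?R. h a = a} = {a \<in> Q. h a = a}" using e less.prems(3) by auto
    let ?r = "\<lambda>a. if a \<in> ?R then h a else a"
    have "bij_betw ?r ?R ?R"
      by (rule bij_betw_byWitness[of _ h]) (use R in auto)
    then have "?r permutes ?R" by (rule bij_imp_permutes) auto
    then have perm: "permutation ?r" using R(1) by (auto simp: permutation_permutes)
    have "(\<lambda>a. if a \<in> Q then h a else a) = Transposition.transpose e (h e) \<circ> ?r"
    proof
      fix a
      have "h a \<noteq> e \<and> h a \<noteq> h e" if "a \<in> ?R" using R(2)[OF that] by blast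
      then show "(if a \<in> Q then h a else a) = (Transposition.transpose e (h e) \<circ> ?r) a"
        using e he less.prems(3)[OF e(1)] by (auto simp: transpose_def)
    qed
    then have "sign (\<lambda>a. if a \<in> Q then h a else a) = - ((-1) ^ m)"
      using e(2) by (simp only: sign_compose[OF permutation_swap_id perm] sign_swap_id m(2)) simp
    then show ?thesis using card m(1) fixed by (intro exI[of _ "Suc m"]) simp
  qed
qed

lemma involution_fixed_point:
  assumes "finite Q" "odd (card Q)" "\<And>e. e \<in> Q \<Longrightarrow> h e \<in> Q" "\<And>e. e \<in> Q \<Longrightarrow> h (h e) = e"
  shows "\<exists>e\<in>Q. h e = e"
proof (rule ccontr)
  assume "\<not> ?thesis"
  then have "{e \<in> Q. h e = e} = {}" by auto
  then have "card {e \<in> Q. h e = e} = 0" by (simp only: card.empty)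
  moreover obtain m where "card Q = card {e \<in> Q. h e = e} + 2 * m"
    using involution_parity[of Q h] assms by blast
  ultimately have "card Q = 2 * m" by simp
  then show False using assms(2) by simp
qed

text \<open>
  Edges are represented by the sets of their two ends, so that a permutation of the vertices acts on
  them by taking images.
\<close>
definition edge_sign :: "('a \<Rightarrow> 'a) \<Rightarrow> 'a set set \<Rightarrow> int" where
  "edge_sign g Q = sign (\<lambda>e. if e \<in> Q then g ` e else e)"

lemma image_restrict_permutes:
  assumes "inj g" "(`) g ` Q = Q"
  shows "(\<lambda>e. if e \<in> Q then g ` e else e) permutes Q"
proof -
  have "bij_betw ((`) g) Q Q" using assms by (auto simp: bij_betw_def inj_on_def inj_image_eq_iff)
  then have "bij_betw (\<lambda>e. if e \<in> Q then g ` e else e) Q Q"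
    by (subst bij_betw_cong[of _ _ "(`) g"]) auto
  then show ?thesis by (rule bij_imp_permutes) auto
qed

lemma image_restrict_permutation:
  assumes "finite Q" "inj g" "(`) g ` Q = Q"
  shows "permutation (\<lambda>e. if e \<in> Q then g ` e else e)"
  unfolding permutation_permutes using image_restrict_permutes[OF assms(2,3)] assms(1) by (intro exI[of _ Q] conjI)

lemma edge_sign_values: "edge_sign g Q = 1 \<or> edge_sign g Q = - 1"
  by (simp add: edge_sign_def sign_def)

lemma edge_sign_compose:
  assumes "finite Q" "inj g" "inj h" "(`) g ` Q = Q" "(`) h ` Q = Q"
  shows "edge_sign (g \<circ> h) Q = edge_sign g Q * edge_sign h Q"
proof -
  let ?e = "\<lambda>g e. if e \<in> Q then g ` e else e"
  note image_restrict_permutation[OF assms(1,2,4)] image_restrict_permutation[OF assms(1,3,5)]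
  moreover have "?e (g \<circ> h) = ?e g \<circ> ?e h" using assms(5) by (auto simp: fun_eq_iff image_comp)
  ultimately show ?thesis by (simp add: edge_sign_def sign_compose)
qed

text \<open>
  Extended by the identity, the permutations of \<open>Q\<close> and of its image under \<open>x\<close> are conjugate in the symmetric
  group of the power set of \<open>V\<close>, by the permutation that \<open>x\<close> induces there.
\<close>
lemma edge_sign_conj:
  assumes V: "finite V" and x: "x permutes V" and c: "c permutes V" and Q: "Q \<subseteq> Pow V" "(`) c ` ((`) x ` Q) = (`) x ` Q"
  shows "edge_sign (perm_inv x \<circ> c \<circ> x) Q = edge_sign c ((`) x ` Q)"
proof -
  let ?d = "perm_inv x \<circ> c \<circ> x"
  let ?e = "\<lambda>g Q e. if e \<in> Q then g ` e else e"
  have injx: "inj x" and injc: "inj c" using permutes_inj x c by auto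
  have injd: "inj ?d" using injx injc permutes_inj[OF permutes_inv[OF x]] by (simp add: inj_compose)
  have xd: "x \<circ> ?d = c \<circ> x" using permutes_inv_o(1)[OF x] by (simp add: o_assoc)
  have xd': "x ` (?d ` e) = c ` (x ` e)" for e using xd by (simp only: image_comp)
  have "(`) x ` ((`) ?d ` Q) = (`) x ` Q" using Q(2) xd' by (simp add: image_image)
  moreover have "inj ((`) x)" using injx by (simp add: inj_on_def inj_image_eq_iff)
  ultimately have dQ: "(`) ?d ` Q = Q" by (simp only: inj_image_eq_iff)
  have xV: "(`) x ` Pow V = Pow V" by (metis image_Pow_surj permutes_image x)
  have fin: "finite (Pow V)" "finite Q" "finite ((`) x ` Q)" using V Q(1) finite_subset[of Q "Pow V"] by auto
  have p1: "permutation (?e x (Pow V))" using image_restrict_permutation[OF fin(1) injx xV] .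
  have p2: "permutation (?e ?d Q)" using image_restrict_permutation[OF fin(2) injd dQ] .
  have p3: "permutation (?e c ((`) x ` Q))" using image_restrict_permutation[OF fin(3) injc Q(2)] .
  have pointwise: "?e x (Pow V) (?e ?d Q e) = ?e c ((`) x ` Q) (?e x (Pow V) e)" for e
  proof (cases "e \<in> Q")
    case True
    have "?d ` e \<in> Q" using imageI[OF True, of "(`) ?d"] unfolding dQ .
    then have "?d ` e \<in> Pow V" "e \<in> Pow V" "x ` e \<in> (`) x ` Q" using Q(1) True by blast+
    then show ?thesis using True xd'[of e] by (simp only: if_True)
  next
    case False
    show ?thesis
    proof (cases "e \<in> Pow V")
      case True
      have "x ` e \<notin> (`) x ` Q" using False injx by (auto simp: inj_image_eq_iff)
      then show ?thesis using True False by (simp only: if_True if_False)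
    next
      case False
      have "e \<notin> (`) x ` Q" using False Q(1) permutes_in_image[OF x] by auto
      then show ?thesis using False \<open>e \<notin> Q\<close> by (simp only: if_False)
    qed
  qed
  define X where "X = ?e x (Pow V)"
  define D where "D = ?e ?d Q"
  define C where "C = ?e c ((`) x ` Q)"
  have "X (D e) = C (X e)" for e unfolding X_def D_def C_def by (rule pointwise)
  then have XD: "X \<circ> D = C \<circ> X" by (simp add: fun_eq_iff)
  have "sign (X \<circ> D) = sign X * sign D" using p1 p2 unfolding X_def D_def by (rule sign_compose)
  moreover have "sign (C \<circ> X) = sign C * sign X" using p3 p1 unfolding X_def C_def by (rule sign_compose)
  ultimately have "sign X * sign D = sign C * sign X" using XD by simp
  then have "edge_sign ?d Q * sign X = edge_sign c ((`) x ` Q) * sign X"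
    unfolding edge_sign_def D_def C_def by (simp add: mult.commute)
  then show ?thesis by (simp only: mult_cancel_right) (simp add: sign_def split: if_splits)
qed

lemma two_three_number:
  assumes "n > (0::nat)" "\<And>p. prime p \<Longrightarrow> p dvd n \<Longrightarrow> p = 2 \<or> p = 3"
  obtains a b where "n = 2 ^ a * 3 ^ b"
proof -
  obtain k where k: "n = 2 ^ multiplicity 2 n * k" "\<not> 2 dvd k"
    using multiplicity_decompose'[of n 2] assms(1) by auto
  have "k \<noteq> 0" using k by (intro notI) simp
  then obtain l where l: "k = 3 ^ multiplicity 3 k * l" "\<not> 3 dvd l"
    using multiplicity_decompose'[of k 3] by auto
  have "l = 1"
  proof (rule ccontr)
    assume "l \<noteq> 1"
    then obtain p where p: "prime p" "p dvd l" using prime_factor_nat by blast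
    then have "p dvd k" using l(1) by (metis dvd_mult)
    moreover have "p dvd n" using k(1) \<open>p dvd k\<close> by (metis dvd_mult)
    ultimately show False using assms(2)[OF p(1)] p k(2) l(2) by blast
  qed
  then show ?thesis using that[of "multiplicity 2 n" "multiplicity 3 k"] k(1) l(1) by simp
qed

section \<open>Elusive actions on graphs of small valency\<close>

text \<open>
  A vertex-transitive group of automorphisms of a connected graph of valency at most four, the graph
  being given by its neighbourhoods.  Connectedness is used in the form that a nonempty set of
  vertices is everything if it is closed under taking neighbours.
\<close>
locale graph_action =
  fixes V :: "'a set" and nb :: "'a \<Rightarrow> 'a set" and G :: "('a \<Rightarrow> 'a) set"
  assumes finite_V: "finite V" and V_nonempty: "V \<noteq> {}"
    and nb_subset: "v \<in> V \<Longrightarrow> nb v \<subseteq> V" and nb_irrefl: "v \<in> V \<Longrightarrow> v \<notin> nb v"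
    and nb_sym: "u \<in> V \<Longrightarrow> v \<in> nb u \<Longrightarrow> u \<in> nb v"
    and valency: "v \<in> V \<Longrightarrow> card (nb v) \<le> 4"
    and connected: "S \<subseteq> V \<Longrightarrow> S \<noteq> {} \<Longrightarrow> (\<And>u. u \<in> S \<Longrightarrow> nb u \<subseteq> S) \<Longrightarrow> S = V"
    and permutes: "g \<in> G \<Longrightarrow> g permutes V"
    and nb_image: "g \<in> G \<Longrightarrow> v \<in> V \<Longrightarrow> nb (g v) = g ` nb v"
    and id_in: "id \<in> G" and comp_in: "g \<in> G \<Longrightarrow> h \<in> G \<Longrightarrow> g \<circ> h \<in> G"
    and inv_in: "g \<in> G \<Longrightarrow> perm_inv g \<in> G"
    and transitive: "u \<in> V \<Longrightarrow> v \<in> V \<Longrightarrow> \<exists>g\<in>G. g u = v"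
begin

lemma bij_G: "g \<in> G \<Longrightarrow> bij g" and inj_G: "g \<in> G \<Longrightarrow> inj g"
  using permutes permutes_bij permutes_inj by blast+

lemma closed_V: "g \<in> G \<Longrightarrow> g v \<in> V \<longleftrightarrow> v \<in> V"
  using permutes permutes_in_image by metis

lemma inv_apply [simp]: "g \<in> G \<Longrightarrow> perm_inv g (g v) = v" "g \<in> G \<Longrightarrow> g (perm_inv g v) = v"
  using permutes permutes_inverses by metis+

lemma group_G: "group (perm_group G)"
  by (rule group_perm_group) (auto simp: id_in comp_in inv_in bij_G)

lemma finite_G: "finite G"
  by (rule finite_subset[OF _ finite_permutations[OF finite_V]]) (auto simp: permutes)

lemma finite_nb: "v \<in> V \<Longrightarrow> finite (nb v)"
  using nb_subset finite_V finite_subset by metis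

lemma eq_idI: "g \<in> G \<Longrightarrow> (\<And>v. v \<in> V \<Longrightarrow> g v = v) \<Longrightarrow> g = id"
  using permutes permutes_not_in by (metis eq_id_iff)

lemma fixes_neighbours_imp_id:
  assumes h: "h \<in> G" and v: "v \<in> V" "h v = v"
    and step: "\<And>u w. u \<in> V \<Longrightarrow> h u = u \<Longrightarrow> w \<in> nb u \<Longrightarrow> h w = w"
  shows "h = id"
proof -
  have "{u \<in> V. h u = u} = V"
  proof (rule connected)
    show "{u \<in> V. h u = u} \<noteq> {}" using v by blast
    show "nb u \<subseteq> {u \<in> V. h u = u}" if "u \<in> {u \<in> V. h u = u}" for u
      using that step nb_subset by blast
  qed blast
  then show ?thesis using eq_idI[OF h] by blast
qed

lemma funpow_in: "g \<in> G \<Longrightarrow> g ^^ n \<in> G"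
  by (induction n) (simp_all add: id_in comp_in)

lemma nb_closed: "g \<in> G \<Longrightarrow> v \<in> V \<Longrightarrow> g v = v \<Longrightarrow> w \<in> nb v \<Longrightarrow> g w \<in> nb v"
  using nb_image by (metis imageI)

end

locale elusive_action = graph_action +
  assumes elusive: "g \<in> G \<Longrightarrow> prime p \<Longrightarrow> g ^^ p = id \<Longrightarrow> \<exists>v\<in>V. g v = v"
begin

text \<open>
  An element of prime order \<open>p\<close> that moves a neighbour of a fixed vertex moves it in a cycle of length
  \<open>p\<close> among the at most four neighbours.
\<close>
lemma prime_divisor:
  assumes p: "prime p" "p dvd card G"
  shows "p = 2 \<or> p = 3"
proof (rule ccontr)
  assume p23: "\<not> (p = 2 \<or> p = 3)"
  have p5: "p > 4"
  proof (rule ccontr)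
    assume "\<not> p > 4"
    then have "p \<in> {0,1,2,3,4}" by auto
    moreover have "\<not> prime (4::nat)" by (simp add: prime_nat_iff) (rule exI[of _ 2], simp)
    ultimately show False using p(1) p23 by auto
  qed
  obtain g where g: "g \<in> G" "g \<noteq> id" "g ^^ p = id"
    using perm_group_cauchy[OF group_G finite_G p] by blast
  obtain v where v: "v \<in> V" "g v = v" using elusive[OF g(1) p(1) g(3)] by blast
  have "g = id"
  proof (rule fixes_neighbours_imp_id[OF g(1) v])
    fix u w assume u: "u \<in> V" "g u = u" and w: "w \<in> nb u"
    show "g w = w"
    proof (rule ccontr)
      assume "g w \<noteq> w"
      then have "inj_on (\<lambda>i. (g ^^ i) w) {..<p}"
        using prime_period_distinct[OF p(1), of g w] g(3) inj_G[OF g(1)] by simp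
      moreover have "(g ^^ i) w \<in> nb u" for i
        by (induction i) (simp_all add: w nb_closed[OF g(1) u])
      ultimately have "card {..<p} \<le> card (nb u)"
        using finite_nb[OF u(1)] by (intro card_inj_on_le) auto
      then show False using valency[OF u(1)] p5 by simp
    qed
  qed
  with g(2) show False by blast
qed

text \<open>
  A central element with a fixed vertex fixes all vertices by transitivity.
\<close>
lemma central_eq_id:
  assumes z: "z \<in> G" "\<And>g. g \<in> G \<Longrightarrow> g \<circ> z = z \<circ> g" and p: "prime p" "z ^^ p = id"
  shows "z = id"
proof -
  obtain v where v: "v \<in> V" "z v = v" using elusive[OF z(1) p] by blast
  have "z u = u" if u: "u \<in> V" for u
  proof -
    obtain g where g: "g \<in> G" "g v = u" using transitive[OF v(1) u] by blast
    have "z (g v) = g (z v)" using fun_cong[OF z(2)[OF g(1)], of v] by simp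
    then show ?thesis using g v by simp
  qed
  then show ?thesis using eq_idI[OF z(1)] by blast
qed

text \<open>
  A nontrivial \<open>2\<close>-group has a nontrivial centre and hence a central involution, contrary to
  \<open>central_eq_id\<close>.
\<close>
lemma three_dvd:
  assumes "G \<noteq> {id}"
  shows "3 dvd card G"
proof (rule ccontr)
  assume no3: "\<not> 3 dvd card G"
  have cG: "card G > 0" using finite_G id_in by (auto simp: card_gt_0_iff)
  obtain a b where ab: "card G = 2 ^ a * 3 ^ b" using two_three_number[OF cG prime_divisor] by metis
  have "b = 0" using ab no3 by (cases b) auto
  then have card: "card G = 2 ^ a" using ab by simp
  interpret Gr: group "perm_group G" by (rule group_G)
  have "a \<noteq> 0"
  proof
    assume "a = 0"
    then have "card G = 1" using card by simp
    then show False using assms id_in by (auto simp: card_1_singleton_iff)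
  qed
  then have "\<not> 2 dvd Coset.order (perm_group G) - 1" using card by simp
  then obtain z where z: "z \<in> G" "z \<noteq> id" "\<not> 2 dvd card (Gr.conj_class z)"
    using Gr.class_equation_mod[of 2] finite_G by auto
  have "card (Gr.conj_class z) dvd 2 ^ a" using Gr.card_conj_class_dvd[of z] z card by simp
  then obtain k where "card (Gr.conj_class z) = 2 ^ k" using divides_primepow_nat[of 2] two_is_prime_nat by blast
  then have "card (Gr.conj_class z) = 1" using z(3) by (cases k) auto
  then have cl: "Gr.conj_class z = {z}" using Gr.mem_conj_class_self[of z] z(1) by (auto simp: card_1_singleton_iff)
  have comm: "g \<circ> z = z \<circ> g" if g: "g \<in> G" for g
  proof -
    have "g \<circ> z \<circ> inv\<^bsub>perm_group G\<^esub> g \<in> Gr.conj_class z"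
      unfolding Gr.conj_class_def using g by (intro image_eqI[of _ _ g]) simp_all
    then have "g \<circ> z \<circ> perm_inv g = z"
      unfolding cl perm_group_inv[OF group_G g bij_G[OF g] inv_in[OF g]] by simp
    then have "g \<circ> z \<circ> (perm_inv g \<circ> g) = z \<circ> g" by (simp add: o_assoc)
    then show ?thesis using bij_G[OF g] by (simp add: bij_is_inj)
  qed
  have pow: "z ^^ (2 ^ a) = id" using perm_group_lagrange[OF group_G z(1)] card by simp
  define j where "j = (LEAST j. z ^^ (2 ^ j) = id)"
  have j: "z ^^ (2 ^ j) = id" unfolding j_def using pow by (rule LeastI)
  have "j \<noteq> 0" using j z(2) by (intro notI) simp
  then obtain l where l: "j = Suc l" using not0_implies_Suc by blast
  have nl: "z ^^ (2 ^ l) \<noteq> id"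
  proof
    assume "z ^^ (2 ^ l) = id"
    then have "j \<le> l" unfolding j_def by (rule Least_le)
    then show False using l by simp
  qed
  have commp: "g \<circ> (z ^^ n) = (z ^^ n) \<circ> g" if g: "g \<in> G" for g n
  proof (induction n)
    case (Suc n)
    have "g \<circ> (z \<circ> z ^^ n) = (g \<circ> z) \<circ> z ^^ n" by (simp only: o_assoc)
    also have "\<dots> = z \<circ> (g \<circ> z ^^ n)" by (simp only: comm[OF g] o_assoc)
    also have "\<dots> = z \<circ> z ^^ n \<circ> g" by (simp only: Suc o_assoc)
    finally show ?case by (simp only: funpow.simps)
  qed simp
  have "(z ^^ (2 ^ l)) ^^ 2 = id" using j unfolding l by (simp add: funpow_mult mult.commute)
  then have "z ^^ (2 ^ l) = id"
    by (intro central_eq_id[OF funpow_in[OF z(1)] commp two_is_prime_nat])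
  with nl show False by blast
qed

lemma three_cycle:
  assumes v: "v \<in> V" and nontriv: "G \<noteq> {id}"
  obtains t w where "t \<in> G" "t v = v" "t ^^ 3 = id" "w \<in> nb v" "t w \<noteq> w"
proof -
  have p3: "prime (3::nat)" by simp
  obtain t where t: "t \<in> G" "t \<noteq> id" "t ^^ 3 = id"
    using perm_group_cauchy[OF group_G finite_G p3 three_dvd[OF nontriv]] by blast
  obtain u0 where u0: "u0 \<in> V" "t u0 = u0" using elusive[OF t(1) p3 t(3)] by blast
  obtain u w where uw: "u \<in> V" "t u = u" "w \<in> nb u" "t w \<noteq> w"
    using fixes_neighbours_imp_id[OF t(1) u0] t(2) by blast
  obtain g where g: "g \<in> G" "g u = v" using transitive[OF uw(1) v] by blast
  let ?t = "g \<circ> t \<circ> perm_inv g"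
  have "?t ^^ n = g \<circ> t ^^ n \<circ> perm_inv g" for n
  proof (induction n)
    case 0
    show ?case using g by (simp add: fun_eq_iff)
  next
    case (Suc n)
    then show ?case using g by (simp add: fun_eq_iff)
  qed
  then have 1: "?t ^^ 3 = id" using t(3) g by (simp add: fun_eq_iff)
  have "perm_inv g v = u" using inv_apply(1)[OF g(1), of u] g(2) by simp
  then have 2: "?t v = v" using uw g by simp
  have 3: "g w \<in> nb v" using nb_image[OF g(1) uw(1)] g(2) uw(3) by simp
  have 4: "?t (g w) \<noteq> g w" using g(1) uw(4) inj_G[OF g(1)] by (simp add: inj_eq)
  have "?t \<in> G" using g t by (simp add: comp_in inv_in)
  then show ?thesis using 2 1 3 4 by (rule that)
qed

end

section \<open>The local action of an abelian normal subgroup\<close>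

text \<open>
  \<open>N\<close> is a nontrivial abelian normal subgroup of exponent \<open>r\<close>.
\<close>
locale elusive_with_normal = elusive_action +
  fixes N :: "('a \<Rightarrow> 'a) set" and r :: nat
  assumes N_subset: "N \<subseteq> G" and N_nontriv: "N \<noteq> {id}" and r: "r = 2 \<or> r = 3"
    and N_id: "id \<in> N" and N_comp: "m \<in> N \<Longrightarrow> n \<in> N \<Longrightarrow> m \<circ> n \<in> N" and N_inv: "n \<in> N \<Longrightarrow> perm_inv n \<in> N"
    and N_conj: "g \<in> G \<Longrightarrow> n \<in> N \<Longrightarrow> g \<circ> n \<circ> perm_inv g \<in> N"
    and N_comm: "m \<in> N \<Longrightarrow> n \<in> N \<Longrightarrow> m \<circ> n = n \<circ> m" and N_exp: "n \<in> N \<Longrightarrow> n ^^ r = id"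
begin

lemma N_G: "n \<in> N \<Longrightarrow> n \<in> G" using N_subset by blast

lemma prime_r: "prime r" using r by auto

lemma N_comm_apply: "m \<in> N \<Longrightarrow> n \<in> N \<Longrightarrow> m (n u) = n (m u)"
  using N_comm by (metis o_apply)

lemma conj_apply: "g \<in> G \<Longrightarrow> (g \<circ> n \<circ> perm_inv g) (g u) = g (n u)"
  by simp

lemma N_has_fixed_point: "n \<in> N \<Longrightarrow> \<exists>v\<in>V. n v = v"
  using elusive[OF N_G prime_r N_exp] by blast

definition stab :: "'a \<Rightarrow> ('a \<Rightarrow> 'a) set" where
  "stab v = {n \<in> N. n v = v}"

lemma stab_conj: "g \<in> G \<Longrightarrow> n \<in> stab v \<Longrightarrow> g \<circ> n \<circ> perm_inv g \<in> stab (g v)"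
  by (simp add: stab_def N_conj)

lemma stab_nontriv:
  assumes v: "v \<in> V" shows "\<exists>n\<in>stab v. n \<noteq> id"
proof -
  obtain n where n: "n \<in> N" "n \<noteq> id" using N_nontriv N_id by blast
  obtain u where u: "u \<in> V" "n u = u" using N_has_fixed_point[OF n(1)] by blast
  obtain g where g: "g \<in> G" "g u = v" using transitive[OF u(1) v] by blast
  have "g \<circ> n \<circ> perm_inv g \<in> stab v" using stab_conj[OF g(1), of n u] n u g by (simp add: stab_def)
  moreover have "g \<circ> n \<circ> perm_inv g \<noteq> id"
  proof
    assume "g \<circ> n \<circ> perm_inv g = id"
    then have "g (n x) = g x" for x using conj_apply[OF g(1), of n x] by simp
    then have "n x = x" for x using inj_G[OF g(1)] by (simp add: inj_eq)
    then show False using n(2) by auto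
  qed
  ultimately show ?thesis by blast
qed

lemma stab_moves_neighbour:
  assumes v: "v \<in> V" shows "\<exists>n\<in>stab v. \<exists>w\<in>nb v. n w \<noteq> w"
proof -
  obtain h where h: "h \<in> stab v" "h \<noteq> id" using stab_nontriv[OF v] by blast
  have hN: "h \<in> N" "h v = v" using h(1) by (auto simp: stab_def)
  obtain u w where u: "u \<in> V" "h u = u" "w \<in> nb u" "h w \<noteq> w"
    using fixes_neighbours_imp_id[OF N_G[OF hN(1)] v hN(2)] h(2) by blast
  obtain g where g: "g \<in> G" "g u = v" using transitive[OF u(1) v] by blast
  have "g \<circ> h \<circ> perm_inv g \<in> stab v" using stab_conj[OF g(1), of h u] u hN g by (simp add: stab_def)
  moreover have "g w \<in> nb v" using nb_image[OF g(1) u(1)] g(2) u(3) by simp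
  moreover have "(g \<circ> h \<circ> perm_inv g) (g w) \<noteq> g w" using g(1) u(4) inj_G[OF g(1)] by (simp add: inj_eq)
  ultimately show ?thesis by blast
qed

text \<open>
  The orbit relation of the stabiliser of \<open>v\<close> in \<open>N\<close>.
\<close>
definition reach :: "'a \<Rightarrow> 'a \<Rightarrow> 'a \<Rightarrow> bool" where
  "reach v u w \<longleftrightarrow> (\<exists>n\<in>stab v. n u = w)"

lemma stab_id: "id \<in> stab v" by (simp add: stab_def N_id)
lemma stab_comp: "m \<in> stab v \<Longrightarrow> n \<in> stab v \<Longrightarrow> m \<circ> n \<in> stab v" by (simp add: stab_def N_comp)
lemma stab_inv: "n \<in> stab v \<Longrightarrow> perm_inv n \<in> stab v"
  using inv_apply(1)[of n v] by (auto simp: stab_def N_inv N_G)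

lemma reach_refl: "reach v u u" unfolding reach_def by (rule bexI[OF _ stab_id]) simp
lemma reach_sym: "reach v u w \<Longrightarrow> reach v w u"
  unfolding reach_def by (elim bexE, rule bexI[OF _ stab_inv]) (auto simp: stab_def N_G)
lemma reach_trans:
  assumes "reach v u w" "reach v w x" shows "reach v u x"
proof -
  obtain m n where "m \<in> stab v" "m u = w" "n \<in> stab v" "n w = x" using assms by (auto simp: reach_def)
  then show ?thesis unfolding reach_def by (intro bexI[OF _ stab_comp[of n v m]]) simp_all
qed
lemma reach_conj:
  assumes g: "g \<in> G" and "reach v u w" shows "reach (g v) (g u) (g w)"
proof -
  obtain n where n: "n \<in> stab v" "n u = w" using assms by (auto simp: reach_def)
  then show ?thesis unfolding reach_def
    by (intro bexI[OF _ stab_conj[OF g n(1)]]) (simp add: g)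
qed
lemma reach_stab: "n \<in> stab v \<Longrightarrow> reach v u (n u)" by (auto simp: reach_def)

definition locally_transitive :: "'a \<Rightarrow> bool" where
  "locally_transitive v \<longleftrightarrow> (\<forall>u\<in>nb v. \<forall>w\<in>nb v. reach v u w)"

lemma three_set:
  assumes v: "v \<in> V" and t: "t \<in> G" "t v = v" "t ^^ 3 = id" "w \<in> nb v" "t w \<noteq> w"
  shows "card {w, t w, t (t w)} = 3" "{w, t w, t (t w)} \<subseteq> nb v" "t (t (t w)) = w" "card (nb v - {w, t w, t (t w)}) \<le> 1"
proof -
  show t3: "t (t (t w)) = w" using fun_cong[OF t(3), of w] by (simp add: numeral_3_eq_3)
  have "t (t w) \<noteq> t w" using t(5) inj_G[OF t(1)] by (simp add: inj_eq)
  moreover have "t (t w) \<noteq> w"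
  proof
    assume "t (t w) = w"
    then have "t w = w" using t3 by simp
    then show False using t(5) by simp
  qed
  ultimately show c: "card {w, t w, t (t w)} = 3" using t(5) by auto
  show s: "{w, t w, t (t w)} \<subseteq> nb v" using nb_closed[OF t(1) v t(2)] t(4) by simp
  show "card (nb v - {w, t w, t (t w)}) \<le> 1"
    using card_Diff_subset[OF _ s] c valency[OF v] by simp
qed

lemma at_most_one: "card A \<le> 1 \<Longrightarrow> finite A \<Longrightarrow> a \<in> A \<Longrightarrow> b \<in> A \<Longrightarrow> a = b"
  using card_le_Suc0_iff_eq[of A] by simp

text \<open>
  An element \<open>t\<close> of order \<open>3\<close> permutes three neighbours of \<open>v\<close> cyclically and leaves at most one other
  neighbour \<open>e\<close>.  If \<open>N\<^sub>v\<close> moves \<open>e\<close>, its orbit contains an element of the \<open>3\<close>-cycle, and conjugation by \<open>t\<close>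
  shows that it contains all of them.  Otherwise some \<open>n \<in> N\<^sub>v\<close> induces a transposition on the three
  neighbours, and it does not commute with its conjugate by \<open>t\<close>.
\<close>
lemma locally_transitive_two:
  assumes v: "v \<in> V" and r2: "r = 2"
  shows "locally_transitive v"
proof -
  have "G \<noteq> {id}" using N_subset N_nontriv N_id by blast
  from three_cycle[OF v this] obtain t w where t: "t \<in> G" "t v = v" "t ^^ 3 = id" "w \<in> nb v" "t w \<noteq> w" by metis
  let ?A = "{w, t w, t (t w)}"
  note A = three_set[OF v t]
  have tA: "t a \<in> ?A" if "a \<in> ?A" for a using that A(3) by auto
  have finB: "finite (nb v - ?A)" using finite_nb[OF v] by simp
  have B1: "b = c" if "b \<in> nb v - ?A" "c \<in> nb v - ?A" for b c
    using at_most_one[OF A(4) finB] that by blast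
  have nG: "n \<in> G" "n v = v" "n (n u) = u" if "n \<in> stab v" for n u
    using that N_G N_exp[of n] r2 by (auto simp: stab_def numeral_2_eq_2 fun_eq_iff)
  have cycle: "reach v (t a) (t b)" if "reach v a b" for a b
    using reach_conj[OF t(1) that] t(2) by simp
  show ?thesis
  proof (cases "\<exists>n\<in>stab v. \<exists>e\<in>nb v - ?A. n e \<noteq> e")
    case True
    then obtain n e where n: "n \<in> stab v" "e \<in> nb v - ?A" "n e \<noteq> e" by blast
    have te: "t e = e"
    proof (rule B1[OF _ n(2)])
      have "t e \<in> nb v" using nb_closed[OF t(1) v t(2)] n(2) by blast
      moreover have "t e \<notin> ?A"
      proof
        assume "t e \<in> ?A"
        then have "t (t (t e)) \<in> ?A" using tA by blast
        moreover have "t (t (t e)) = e" using fun_cong[OF t(3), of e] by (simp add: numeral_3_eq_3)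
        ultimately show False using n(2) by simp
      qed
      ultimately show "t e \<in> nb v - ?A" by blast
    qed
    have "n e \<in> nb v" using nb_closed[OF nG(1)[OF n(1)] v nG(2)[OF n(1)]] n(2) by blast
    then have "n e \<in> ?A" using B1[OF _ n(2)] n(3) by blast
    have e0: "reach v e (n e)" using n(1) by (rule reach_stab)
    have e1: "reach v e (t (n e))" using cycle[OF e0] te by simp
    have e2: "reach v e (t (t (n e)))" using cycle[OF e1] te by simp
    have sub: "?A \<subseteq> {n e, t (n e), t (t (n e))}" using \<open>n e \<in> ?A\<close> A(3) by auto
    have eA: "reach v e a" if "a \<in> ?A" for a
    proof -
      have "a \<in> {n e, t (n e), t (t (n e))}" using sub that by (rule subsetD)
      then show ?thesis using e0 e1 e2 by (elim insertE emptyE) simp_all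
    qed
    have eall: "reach v e u" if u: "u \<in> nb v" for u
    proof (cases "u \<in> ?A")
      case True
      then show ?thesis by (rule eA)
    next
      case False
      then have "u = e" using B1[OF _ n(2), of u] u by blast
      then show ?thesis by (simp add: reach_refl)
    qed
    show ?thesis unfolding locally_transitive_def
    proof (intro ballI)
      fix a b assume "a \<in> nb v" "b \<in> nb v"
      then show "reach v a b" using reach_trans[OF reach_sym[OF eall] eall] by simp
    qed
  next
    case False
    obtain n u where n: "n \<in> stab v" "u \<in> nb v" "n u \<noteq> u" using stab_moves_neighbour[OF v] by blast
    have inA: "m a \<in> ?A" if "m \<in> stab v" "a \<in> ?A" for m a
    proof (rule ccontr)
      assume no: "m a \<notin> ?A"
      have "m a \<in> nb v" using nb_closed[OF nG(1)[OF that(1)] v nG(2)[OF that(1)]] that(2) A(2) by blast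
      then have "m (m a) = m a" using False that(1) no by blast
      then have "m a = a" using nG(3)[OF that(1), of a] by simp
      then show False using no that(2) by simp
    qed
    have u: "u \<in> ?A" using False n by blast
    obtain x where x: "x \<in> ?A" "n x = t x"
    proof -
      have "n u \<in> ?A" using inA[OF n(1) u] .
      then have "n u = t u \<or> u = t (n u)" using u n(3) A(3) by auto
      then show ?thesis
      proof
        assume "n u = t u" then show ?thesis using that u by blast
      next
        assume "u = t (n u)"
        then have "n (n u) = t (n u)" using nG(3)[OF n(1), of u] by simp
        then show ?thesis using that[of "n u"] inA[OF n(1) u] by blast
      qed
    qed
    have d: "x \<noteq> t x" "t x \<noteq> t (t x)" "x \<noteq> t (t x)" and eqA: "?A = {x, t x, t (t x)}" and t3x: "t (t (t x)) = x"
    proof -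
      show eqA: "?A = {x, t x, t (t x)}" using x(1) A(3) by auto
      have "card {x, t x, t (t x)} = 3" using A(1) eqA by simp
      then show "x \<noteq> t x" "t x \<noteq> t (t x)" "x \<noteq> t (t x)" by (auto simp: card_insert_if split: if_splits)
      show "t (t (t x)) = x" using fun_cong[OF t(3), of x] by (simp add: numeral_3_eq_3)
    qed
    have n1: "n (t x) = x" using nG(3)[OF n(1), of x] x(2) by simp
    have n2: "n (t (t x)) = t (t x)"
    proof -
      have "n (t (t x)) \<in> {x, t x, t (t x)}" using inA[OF n(1), of "t (t x)"] eqA by blast
      moreover have "n (t (t x)) \<noteq> x" using n1 d nG(3)[OF n(1)] by metis
      moreover have "n (t (t x)) \<noteq> t x" using x(2) d nG(3)[OF n(1)] by metis
      ultimately show ?thesis by blast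
    qed
    let ?m = "t \<circ> n \<circ> perm_inv t"
    have m: "?m \<in> N" using N_conj[OF t(1)] n(1) by (simp add: stab_def)
    have mt: "?m (t y) = t (n y)" for y using t(1) by simp
    have m1: "?m x = x" using mt[of "t (t x)"] n2 t3x by simp
    have m2: "?m (t x) = t (t x)" using mt[of x] x(2) by simp
    have "n \<in> N" using n(1) by (simp add: stab_def)
    with m have "?m (n x) = n (?m x)" by (rule N_comm_apply)
    then have "t (t x) = t x" by (simp only: x(2) m1 m2)
    then show ?thesis using d by simp
  qed
qed

text \<open>
  An element of order \<open>3\<close> in \<open>N\<^sub>v\<close> already permutes three neighbours cyclically; the only question is
  whether \<open>N\<^sub>v\<close> fixes the possible fourth one.
\<close>
lemma local_action_three:
  assumes v: "v \<in> V" and r3: "r = 3"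
  shows "locally_transitive v \<or> (\<exists>e\<in>nb v. card (nb v) = 4 \<and> (\<forall>n\<in>stab v. n e = e) \<and>
    (\<forall>u\<in>nb v - {e}. \<forall>w\<in>nb v - {e}. reach v u w))"
proof -
  obtain n w where n: "n \<in> stab v" "w \<in> nb v" "n w \<noteq> w" using stab_moves_neighbour[OF v] by blast
  have nG: "n \<in> G" "n v = v" "n ^^ 3 = id" using n(1) N_G N_exp[of n] r3 by (auto simp: stab_def)
  let ?A = "{w, n w, n (n w)}"
  note A = three_set[OF v nG n(2,3)]
  have finB: "finite (nb v - ?A)" using finite_nb[OF v] by simp
  have B1: "b = c" if "b \<in> nb v - ?A" "c \<in> nb v - ?A" for b c
    using at_most_one[OF A(4) finB] that by blast
  have wA: "reach v w a" if "a \<in> ?A" for a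
  proof -
    have 1: "reach v w (n w)" and 2: "reach v (n w) (n (n w))" using n(1) by (simp_all add: reach_stab)
    show ?thesis using that reach_refl[of v w] 1 reach_trans[OF 1 2] by auto
  qed
  have AA: "reach v a b" if "a \<in> ?A" "b \<in> ?A" for a b
    using reach_trans[OF reach_sym[OF wA[OF that(1)]] wA[OF that(2)]] .
  show ?thesis
  proof (cases "nb v - ?A = {}")
    case True
    then have "nb v = ?A" using A(2) by blast
    then show ?thesis unfolding locally_transitive_def using AA by simp
  next
    case False
    then obtain e where e: "e \<in> nb v - ?A" by blast
    have nb: "nb v = insert e ?A" using B1[OF _ e] e A(2) by blast
    show ?thesis
    proof (cases "\<forall>m\<in>stab v. m e = e")
      case True
      have "card (nb v) = 4" using nb A(1) e by simp
      moreover have "nb v - {e} = ?A" using nb e by blast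
      ultimately show ?thesis using True e AA by (intro disjI2 bexI[of _ e]) auto
    next
      case False
      then obtain m where m: "m \<in> stab v" "m e \<noteq> e" by blast
      have "m e \<in> nb v" using nb_closed[of m v e] m e v by (auto simp: stab_def N_G)
      then have "m e \<in> ?A" using nb m(2) by blast
      then have ew: "reach v e w"
        using reach_trans[OF reach_stab[OF m(1), of e]] AA by blast
      have wu: "reach v w u" if "u \<in> nb v" for u
        using that wA reach_sym[OF ew] unfolding nb by blast
      have "reach v a b" if "a \<in> nb v" "b \<in> nb v" for a b
        using reach_trans[OF reach_sym[OF wu[OF that(1)]] wu[OF that(2)]] .
      then show ?thesis unfolding locally_transitive_def by blast
    qed
  qed
qed

definition orb :: "'a \<Rightarrow> 'a set" where
  "orb v = (\<lambda>n. n v) ` N"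

lemma orb_self: "v \<in> orb v" unfolding orb_def by (rule image_eqI[OF _ N_id]) simp

lemma orb_eq: assumes "u \<in> orb v" shows "orb u = orb v"
proof -
  obtain n where n: "n \<in> N" "u = n v" using assms by (auto simp: orb_def)
  have "m u \<in> orb v" if "m \<in> N" for m
    unfolding orb_def by (rule image_eqI[OF _ N_comp[OF that n(1)]]) (simp add: n)
  moreover have "m v \<in> orb u" if "m \<in> N" for m
    unfolding orb_def by (rule image_eqI[OF _ N_comp[OF that N_inv[OF n(1)]]]) (simp add: n N_G)
  ultimately show ?thesis unfolding orb_def by blast
qed

lemma orb_subset: "v \<in> V \<Longrightarrow> orb v \<subseteq> V"
  unfolding orb_def using closed_V N_G by blast

lemma stab_fixes_orb: "n \<in> stab v \<Longrightarrow> u \<in> orb v \<Longrightarrow> n u = u"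
  unfolding orb_def stab_def using N_comm_apply by auto

text \<open>
  Transitivity on neighbourhoods makes the orbits of two adjacent vertices \<open>v\<close> and \<open>w\<close> cover the graph.
  For nontrivial \<open>x \<in> N\<^sub>v\<close> and \<open>y \<in> N\<^sub>w\<close> the product \<open>xy\<close> fixes some vertex \<open>u\<close>.  If \<open>u\<close> is in the orbit of \<open>v\<close>,
  then \<open>x\<close> and hence \<open>y\<close> fix \<open>u\<close>, so that \<open>y\<close> fixes both orbits pointwise; the other case is symmetric.
\<close>
lemma not_locally_transitive:
  assumes v: "v \<in> V" and "\<And>v. v \<in> V \<Longrightarrow> locally_transitive v"
  shows False
proof -
  obtain n0 w where w: "n0 \<in> stab v" "w \<in> nb v" "n0 w \<noteq> w" using stab_moves_neighbour[OF v] by blast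
  have wV: "w \<in> V" using w(2) nb_subset[OF v] by blast
  have one_orbit: "nb a \<subseteq> orb b" if a: "a \<in> V" "b \<in> nb a" for a b
  proof
    fix c assume "c \<in> nb a"
    then have "reach a b c" using assms(2)[OF a(1)] a(2) unfolding locally_transitive_def by blast
    then show "c \<in> orb b" by (auto simp: reach_def stab_def orb_def)
  qed
  have step: "nb u \<subseteq> orb b" if u: "u \<in> orb a" "a \<in> V" "b \<in> nb a" for u a b
  proof -
    obtain n where n: "n \<in> N" "u = n a" using u(1) by (auto simp: orb_def)
    have "nb u = n ` nb a" using nb_image[OF N_G[OF n(1)] u(2)] n(2) by simp
    also have "\<dots> \<subseteq> orb b"
    proof
      fix y assume "y \<in> n ` nb a"
      then obtain c where c: "c \<in> nb a" "y = n c" by blast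
      then obtain m where "m \<in> N" "c = m b" using one_orbit[OF u(2,3)] by (auto simp: orb_def)
      then show "y \<in> orb b" unfolding orb_def c(2) by (intro image_eqI[OF _ N_comp[OF n(1)]]) auto
    qed
    finally show ?thesis .
  qed
  have cover: "orb v \<union> orb w = V"
  proof (rule connected)
    show "orb v \<union> orb w \<subseteq> V" using orb_subset v wV by blast
    show "orb v \<union> orb w \<noteq> {}" using orb_self by blast
    show "nb u \<subseteq> orb v \<union> orb w" if "u \<in> orb v \<union> orb w" for u
      using that step[of u v w] step[of u w v] v wV w(2) nb_sym[OF v w(2)] by blast
  qed
  obtain x where x: "x \<in> stab v" "x \<noteq> id" using stab_nontriv[OF v] by blast
  obtain y where y: "y \<in> stab w" "y \<noteq> id" using stab_nontriv[OF wV] by blast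
  have xy: "x \<in> N" "y \<in> N" using x y by (auto simp: stab_def)
  obtain u where u: "u \<in> V" "x (y u) = u" using N_has_fixed_point[OF N_comp[OF xy]] by auto
  have fixes_all: "z = id" if "z \<in> N" "z v = v" "z w = w" for z
    using that stab_fixes_orb[of z v] stab_fixes_orb[of z w] cover by (intro eq_idI N_G) (auto simp: stab_def)
  consider "u \<in> orb v" | "u \<in> orb w" using u(1) cover by blast
  then show False
  proof cases
    case 1
    have "y u = y (x u)" using stab_fixes_orb[OF x(1) 1] by simp
    also have "\<dots> = u" using N_comm_apply[OF xy] u(2) by simp
    finally have "y \<in> stab u" using xy by (simp add: stab_def)
    then have "y v = v" using stab_fixes_orb orb_eq[OF 1] orb_self[of v] by metis
    then show False using fixes_all[OF xy(2)] y by (simp add: stab_def)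
  next
    case 2
    have "x u = x (y u)" using stab_fixes_orb[OF y(1) 2] by simp
    then have "x \<in> stab u" using xy u(2) by (simp add: stab_def)
    then have "x w = w" using stab_fixes_orb orb_eq[OF 2] orb_self[of w] by metis
    then show False using fixes_all[OF xy(1)] x by (simp add: stab_def)
  qed
qed

end

section \<open>Mates and triples\<close>

context elusive_with_normal
begin

lemma locally_transitive_conj:
  assumes g: "g \<in> G" and v: "v \<in> V" and lt: "locally_transitive v"
  shows "locally_transitive (g v)"
  unfolding locally_transitive_def nb_image[OF g v]
proof (intro ballI)
  fix a b assume "a \<in> g ` nb v" "b \<in> g ` nb v"
  then obtain c d where "c \<in> nb v" "d \<in> nb v" "a = g c" "b = g d" by blast
  then show "reach (g v) a b" using lt reach_conj[OF g] unfolding locally_transitive_def by simp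
qed

lemma no_locally_transitive: "v \<in> V \<Longrightarrow> \<not> locally_transitive v"
  using not_locally_transitive locally_transitive_conj transitive by metis

lemma exponent_three: "r = 3"
  using r V_nonempty locally_transitive_two no_locally_transitive by blast

definition is_mate :: "'a \<Rightarrow> 'a \<Rightarrow> bool" where
  "is_mate v e \<longleftrightarrow> e \<in> nb v \<and> card (nb v) = 4 \<and> (\<forall>n\<in>stab v. n e = e) \<and>
    (\<forall>u\<in>nb v - {e}. \<forall>w\<in>nb v - {e}. reach v u w)"

definition mate :: "'a \<Rightarrow> 'a" where
  "mate v = (SOME e. is_mate v e)"

definition triple :: "'a \<Rightarrow> 'a set" where
  "triple v = nb v - {mate v}"

lemma mate:
  assumes v: "v \<in> V"
  shows "mate v \<in> nb v" "card (triple v) = 3" "n \<in> stab v \<Longrightarrow> n (mate v) = mate v"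
    "u \<in> triple v \<Longrightarrow> w \<in> triple v \<Longrightarrow> reach v u w"
proof -
  have "\<exists>e. is_mate v e"
    using local_action_three[OF v exponent_three] no_locally_transitive[OF v] unfolding is_mate_def by blast
  then have "is_mate v (mate v)" unfolding mate_def by (rule someI_ex)
  then show "mate v \<in> nb v" "card (triple v) = 3" "n \<in> stab v \<Longrightarrow> n (mate v) = mate v"
    "u \<in> triple v \<Longrightarrow> w \<in> triple v \<Longrightarrow> reach v u w"
    unfolding is_mate_def triple_def using finite_nb[OF v] by simp_all
qed

lemma mate_V: "v \<in> V \<Longrightarrow> mate v \<in> V" and triple_V: "v \<in> V \<Longrightarrow> triple v \<subseteq> V"
  using mate(1) nb_subset by (auto simp: triple_def)

lemma finite_triple: "v \<in> V \<Longrightarrow> finite (triple v)"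
  using finite_nb by (simp add: triple_def)

lemma triple_other: "v \<in> V \<Longrightarrow> \<exists>u\<in>triple v. u \<noteq> e"
proof (rule ccontr)
  assume v: "v \<in> V" and "\<not> (\<exists>u\<in>triple v. u \<noteq> e)"
  then have "triple v \<subseteq> {e}" by blast
  then have "card (triple v) \<le> card {e}" by (intro card_mono) simp_all
  then show False using mate(2)[OF v] by simp
qed

lemma triple_moved: "v \<in> V \<Longrightarrow> e \<in> triple v \<Longrightarrow> \<exists>n\<in>stab v. n e \<noteq> e"
  using triple_other[of v e] mate(4)[of v e] unfolding reach_def by metis

lemma mate_unique:
  assumes v: "v \<in> V" and e: "e \<in> nb v" "\<And>n. n \<in> stab v \<Longrightarrow> n e = e"
  shows "mate v = e"
  using triple_moved[OF v, of e] e by (auto simp: triple_def)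

lemma mate_image:
  assumes g: "g \<in> G" and v: "v \<in> V" shows "mate (g v) = g (mate v)"
proof (rule mate_unique)
  show "g v \<in> V" using closed_V[OF g] v by simp
  show "g (mate v) \<in> nb (g v)" unfolding nb_image[OF g v] using mate(1)[OF v] by (rule imageI)
  fix n assume "n \<in> stab (g v)"
  from stab_conj[OF inv_in[OF g] this] have "perm_inv g \<circ> n \<circ> g \<in> stab v"
    using g bij_G[OF g] by (simp add: inv_inv_eq)
  from mate(3)[OF v this] have "perm_inv g (n (g (mate v))) = mate v" by simp
  then have "g (perm_inv g (n (g (mate v)))) = g (mate v)" by (rule arg_cong)
  then show "n (g (mate v)) = g (mate v)" using g by simp
qed

lemma finite_N: "finite N" using finite_subset[OF N_subset finite_G] .
lemma finite_stab: "finite (stab v)" using finite_N by (simp add: stab_def)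

lemma card_stab_le:
  assumes g: "g \<in> G" shows "card (stab v) \<le> card (stab (g v))"
proof (rule card_inj_on_le)
  show "inj_on (\<lambda>n. g \<circ> n \<circ> perm_inv g) (stab v)"
  proof (rule inj_onI, rule ext)
    fix m n x assume "g \<circ> m \<circ> perm_inv g = g \<circ> n \<circ> perm_inv g"
    then have "g (m x) = g (n x)" using conj_apply[OF g, of m x] conj_apply[OF g, of n x] by simp
    then show "m x = n x" using inj_G[OF g] by (simp add: inj_eq)
  qed
  show "(\<lambda>n. g \<circ> n \<circ> perm_inv g) ` stab v \<subseteq> stab (g v)" using stab_conj[OF g] by blast
qed (rule finite_stab)

text \<open>
  The stabiliser of \<open>v\<close> fixes its mate, and all stabilisers have the same size.  This makes the mate
  relation symmetric.
\<close>
lemma stab_mate: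
  assumes v: "v \<in> V" shows "stab (mate v) = stab v"
proof -
  have sub: "stab v \<subseteq> stab (mate v)" using mate(3)[OF v] by (auto simp: stab_def)
  obtain g where "g \<in> G" "g (mate v) = v" using transitive[OF mate_V[OF v] v] by blast
  then have "card (stab (mate v)) \<le> card (stab v)" using card_stab_le by metis
  then show ?thesis using card_seteq[OF finite_stab sub] by simp
qed

lemma mate_mate: assumes v: "v \<in> V" shows "mate (mate v) = v"
proof (rule mate_unique[OF mate_V[OF v] nb_sym[OF v mate(1)[OF v]]])
  fix n assume "n \<in> stab (mate v)"
  then have "n \<in> stab v" by (simp only: stab_mate[OF v])
  then show "n v = v" by (simp add: stab_def)
qed

lemma triple_sym:
  assumes v: "v \<in> V" and w: "w \<in> triple v" shows "v \<in> triple w"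
proof -
  have "v \<in> nb w" using nb_sym[OF v] w by (simp add: triple_def)
  moreover have "w \<in> V" using triple_V[OF v] w by blast
  then have "v \<noteq> mate w" using mate_mate[of w] w by (auto simp: triple_def)
  ultimately show ?thesis by (simp add: triple_def)
qed

lemma triple_image:
  assumes g: "g \<in> G" and v: "v \<in> V" shows "triple (g v) = g ` triple v"
  using inj_G[OF g] by (simp add: triple_def nb_image[OF g v] mate_image[OF g v] image_set_diff)

lemma triple_orb: "v \<in> V \<Longrightarrow> w \<in> triple v \<Longrightarrow> u \<in> triple v \<Longrightarrow> u \<in> orb w"
  using mate(4)[of v w u] by (auto simp: reach_def stab_def orb_def)

lemma triple_not_orb: "v \<in> V \<Longrightarrow> w \<in> triple v \<Longrightarrow> w \<notin> orb v"
  using triple_moved stab_fixes_orb by metis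

lemma odd_card_subgroup:
  assumes "H \<subseteq> N" "id \<in> H" "\<And>g h. g \<in> H \<Longrightarrow> h \<in> H \<Longrightarrow> g \<circ> h \<in> H" "\<And>g. g \<in> H \<Longrightarrow> perm_inv g \<in> H"
  shows "odd (card H)"
proof
  assume ev: "even (card H)"
  have "group (perm_group H)"
    using assms by (intro group_perm_group) (auto simp: bij_G N_G subset_iff)
  from perm_group_cauchy[OF this finite_subset[OF assms(1) finite_N] two_is_prime_nat ev]
  obtain x where x: "x \<in> H" "x \<noteq> id" "x ^^ 2 = id" by blast
  have "x ^^ 3 = id" using N_exp[of x] x(1) assms(1) exponent_three by auto
  then have "x \<circ> x ^^ 2 = id" by (simp add: numeral_3_eq_3 numeral_2_eq_2)
  then show False using x by simp
qed

lemma card_stab_coset: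
  assumes p: "p \<in> N" shows "card {n \<in> N. n v = p v} = card (stab v)"
proof (rule bij_betw_same_card)
  show "bij_betw (\<lambda>n. perm_inv p \<circ> n) {n \<in> N. n v = p v} (stab v)"
    by (rule bij_betw_byWitness[where f' = "\<lambda>n. p \<circ> n"])
      (use p N_G[OF p] in \<open>auto simp: stab_def N_comp N_inv fun_eq_iff\<close>)
qed

lemma odd_card_stab: "odd (card (stab v))"
  by (rule odd_card_subgroup) (auto simp: stab_id stab_comp stab_inv, simp add: stab_def)

lemma odd_card_orb: "odd (card (orb v))"
proof -
  have "card N = (\<Sum>n\<in>N. 1)" by simp
  also have "\<dots> = (\<Sum>u\<in>orb v. \<Sum>n\<in>{n \<in> N. n v = u}. 1)"
    unfolding orb_def by (rule sum.image_gen[OF finite_N])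
  also have "\<dots> = (\<Sum>u\<in>orb v. card (stab v))"
    by (rule sum.cong[OF refl]) (auto simp: orb_def card_stab_coset)
  finally have "card N = card (orb v) * card (stab v)" by simp
  moreover have "odd (card N)" by (rule odd_card_subgroup) (simp_all add: N_id N_comp N_inv)
  ultimately show ?thesis by simp
qed

lemma orb_N:
  assumes n: "n \<in> N" and u: "u \<in> orb v" shows "n u \<in> orb v"
proof -
  obtain m where m: "m \<in> N" "u = m v" using u by (auto simp: orb_def)
  show ?thesis unfolding orb_def by (rule image_eqI[OF _ N_comp[OF n m(1)]]) (simp add: m(2))
qed

lemma orb_image:
  assumes g: "g \<in> G" shows "orb (g v) = g ` orb v"
proof
  show "g ` orb v \<subseteq> orb (g v)"
  proof
    fix x assume "x \<in> g ` orb v"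
    then obtain n where n: "n \<in> N" "x = g (n v)" by (auto simp: orb_def)
    then show "x \<in> orb (g v)" unfolding orb_def
      by (intro image_eqI[OF _ N_conj[OF g n(1)]]) (simp add: g)
  qed
  show "orb (g v) \<subseteq> g ` orb v"
  proof
    fix x assume "x \<in> orb (g v)"
    then obtain n where n: "n \<in> N" "x = n (g v)" by (auto simp: orb_def)
    have "perm_inv g \<circ> n \<circ> perm_inv (perm_inv g) \<in> N" by (rule N_conj[OF inv_in[OF g] n(1)])
    then have "perm_inv g \<circ> n \<circ> g \<in> N" using bij_G[OF g] by (simp add: inv_inv_eq)
    then have "perm_inv g (n (g v)) \<in> orb v" unfolding orb_def by (rule image_eqI[rotated]) simp
    then have "g (perm_inv g (n (g v))) \<in> g ` orb v" by (rule imageI)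
    then show "x \<in> g ` orb v" using g n by simp
  qed
qed

text \<open>
  Otherwise the mate relation would be a perfect matching of an orbit, which has odd size.
\<close>
lemma mate_not_orb:
  assumes v: "v \<in> V" shows "mate v \<notin> orb v"
proof
  assume m: "mate v \<in> orb v"
  have closed: "mate e \<in> orb v" if e: "e \<in> orb v" for e
  proof -
    obtain n where n: "n \<in> N" "e = n v" using e by (auto simp: orb_def)
    then show ?thesis using orb_N[OF n(1) m] mate_image[OF N_G[OF n(1)] v] by simp
  qed
  have "mate (mate e) = e" if "e \<in> orb v" for e using mate_mate orb_subset[OF v] that by blast
  then obtain e where e: "e \<in> orb v" "mate e = e"
    using involution_fixed_point[of "orb v" mate, OF finite_subset[OF orb_subset[OF v] finite_V] odd_card_orb closed] by blast
  then have "e \<in> V" using orb_subset[OF v] by blast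
  then show False using mate(1)[of e] nb_irrefl[of e] e(2) by simp
qed

text \<open>
  The kernel of the action of \<open>G\<close> on the set of \<open>N\<close>-orbits.
\<close>
definition kernel :: "('a \<Rightarrow> 'a) set" where
  "kernel = {c \<in> G. \<forall>u\<in>V. c u \<in> orb u}"

text \<open>
  An element preserving one orbit preserves all of them: the orbits adjacent to a given one are those
  of the mates and of the triples, and this distinction is \<open>G\<close>-invariant.
\<close>
lemma kernelI:
  assumes c: "c \<in> G" and v: "v \<in> V" "c v \<in> orb v" shows "c \<in> kernel"
proof -
  have "{u \<in> V. c u \<in> orb u} = V"
  proof (rule connected)
    show "{u \<in> V. c u \<in> orb u} \<noteq> {}" using v by blast
    fix u assume "u \<in> {u \<in> V. c u \<in> orb u}"
    then have u: "u \<in> V" "c u \<in> orb u" by auto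
    then obtain n where n: "n \<in> N" "c u = n u" by (auto simp: orb_def)
    show "nb u \<subseteq> {u \<in> V. c u \<in> orb u}"
    proof
      fix w assume w: "w \<in> nb u"
      have wV: "w \<in> V" using nb_subset[OF u(1)] w by blast
      have "c w \<in> orb w"
      proof (cases "w = mate u")
        case True
        have "c w = n w" using mate_image[OF c u(1)] mate_image[OF N_G[OF n(1)] u(1)] n(2) True by simp
        then show ?thesis using n(1) by (simp add: orb_def)
      next
        case False
        then have w3: "w \<in> triple u" using w by (simp add: triple_def)
        then have "c w \<in> triple (c u)" unfolding triple_image[OF c u(1)] by (rule imageI)
        then have "c w \<in> n ` triple u" unfolding n(2) triple_image[OF N_G[OF n(1)] u(1)] .
        then obtain w' where w': "c w = n w'" "w' \<in> triple u" by (rule imageE)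
        show ?thesis using orb_N[OF n(1) triple_orb[OF u(1) w3 w'(2)]] w'(1) by simp
      qed
      then show "w \<in> {u \<in> V. c u \<in> orb u}" using wV by simp
    qed
  qed blast
  then show ?thesis using c by (auto simp: kernel_def)
qed

lemma kernelD: "c \<in> kernel \<Longrightarrow> c \<in> G" "c \<in> kernel \<Longrightarrow> u \<in> V \<Longrightarrow> c u \<in> orb u"
  by (auto simp: kernel_def)

lemma kernel_orb: "c \<in> kernel \<Longrightarrow> u \<in> V \<Longrightarrow> c ` orb u = orb u"
  using orb_image[of c u] orb_eq[of "c u" u] kernelD by metis

lemma kernel_id: "id \<in> kernel" by (simp add: kernel_def id_in orb_self)

lemma kernel_comp:
  assumes c: "c \<in> kernel" and d: "d \<in> kernel" shows "c \<circ> d \<in> kernel"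
proof -
  obtain v where v: "v \<in> V" using V_nonempty by blast
  have dv: "d v \<in> orb v" "d v \<in> V" using kernelD[OF d] v closed_V by simp_all
  have "(c \<circ> d) v \<in> orb v" using kernelD(2)[OF c dv(2)] orb_eq[OF dv(1)] by simp
  then show ?thesis by (rule kernelI[OF comp_in[OF kernelD(1)[OF c] kernelD(1)[OF d]] v])
qed

lemma kernel_conj:
  assumes c: "c \<in> kernel" and g: "g \<in> G" shows "perm_inv g \<circ> c \<circ> g \<in> kernel"
proof -
  obtain v where v: "v \<in> V" using V_nonempty by blast
  have "c (g v) \<in> g ` orb v" using kernelD(2)[OF c, of "g v"] closed_V[OF g] v orb_image[OF g] by simp
  then have "perm_inv g (c (g v)) \<in> orb v" using g by auto
  then show ?thesis using kernelI[OF comp_in[OF comp_in[OF inv_in[OF g] kernelD(1)[OF c]] g] v] by simp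
qed

lemma kernel_inv:
  assumes c: "c \<in> kernel" shows "perm_inv c \<in> kernel"
proof -
  obtain v where v: "v \<in> V" using V_nonempty by blast
  have cG: "c \<in> G" using kernelD(1)[OF c] .
  let ?u = "perm_inv c v"
  have u: "?u \<in> V" using closed_V[OF inv_in[OF cG]] v by simp
  have "v \<in> orb ?u" using kernelD(2)[OF c u] cG by simp
  then have "?u \<in> orb v" using orb_eq orb_self by metis
  then show ?thesis by (rule kernelI[OF inv_in[OF cG] v])
qed

text \<open>
  An involution fixes a vertex and hence its orbit.
\<close>
lemma involution_in_kernel:
  assumes g: "g \<in> G" "g \<circ> g = id" shows "g \<in> kernel"
proof -
  obtain v where v: "v \<in> V" "g v = v" using elusive[OF g(1) two_is_prime_nat] g(2) by (auto simp: numeral_2_eq_2)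
  then show ?thesis using kernelI[OF g(1) v(1)] orb_self[of v] by simp
qed

definition mate_edges :: "'a set \<Rightarrow> 'a set set" where
  "mate_edges A = (\<lambda>u. {u, mate u}) ` A"

definition triple_edges :: "'a set \<Rightarrow> 'a set set" where
  "triple_edges A = (\<lambda>(u, w). {u, w}) ` (SIGMA u:A. triple u)"

lemma mate_edges_image:
  assumes "g \<in> G" "A \<subseteq> V" shows "(`) g ` mate_edges A = mate_edges (g ` A)"
  unfolding mate_edges_def image_image
  by (rule image_cong[OF refl]) (use assms mate_image in auto)

lemma triple_edges_alt: "triple_edges A = (\<Union>u\<in>A. (\<lambda>w. {u, w}) ` triple u)"
  by (auto simp: triple_edges_def)

lemma triple_edges_image:
  assumes g: "g \<in> G" and A: "A \<subseteq> V" shows "(`) g ` triple_edges A = triple_edges (g ` A)"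
proof -
  have "(\<Union>u\<in>A. (\<lambda>w. {g u, g w}) ` triple u) = (\<Union>u\<in>A. (\<lambda>w. {g u, w}) ` triple (g u))"
  proof (rule SUP_cong[OF refl])
    fix u assume "u \<in> A"
    then have "triple (g u) = g ` triple u" using A by (intro triple_image[OF g]) blast
    then show "(\<lambda>w. {g u, g w}) ` triple u = (\<lambda>w. {g u, w}) ` triple (g u)" by (simp only: image_image)
  qed
  then show ?thesis by (simp add: triple_edges_alt image_UN image_image)
qed

text \<open>
  Conjugation by \<open>f\<close> is an involution on the set of all \<open>p \<in> N\<close> with \<open>p u = a\<close>.  This set is a coset of a
  stabiliser in the \<open>3\<close>-group \<open>N\<close>, so it has odd size and the involution has a fixed point.
\<close>
lemma commuting_translation:
  assumes f: "f \<in> kernel" "f \<circ> f = id" and u: "u \<in> V" "f u = u" and a: "a \<in> orb u" "f a = a"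
  obtains p where "p \<in> N" "p u = a" "\<And>x. f (p x) = p (f x)"
proof -
  have fG: "f \<in> G" using kernelD(1)[OF f(1)] .
  have ff: "f (f x) = x" for x using fun_cong[OF f(2), of x] by simp
  have finv: "perm_inv f = f" using inv_unique_comp[OF f(2) f(2)] .
  obtain q where q: "q \<in> N" "a = q u" using a(1) by (auto simp: orb_def)
  let ?P = "{p \<in> N. p u = q u}"
  have "\<exists>p\<in>?P. f \<circ> p \<circ> f = p"
  proof (rule involution_fixed_point)
    show "finite ?P" using finite_N by simp
    show "odd (card ?P)" using card_stab_coset[OF q(1), of u] odd_card_stab by simp
    fix p assume p: "p \<in> ?P"
    show "f \<circ> p \<circ> f \<in> ?P" using N_conj[OF fG, of p] p u(2) a(2) q(2) by (simp add: finv)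
    show "f \<circ> (f \<circ> p \<circ> f) \<circ> f = p" by (simp add: fun_eq_iff ff)
  qed
  then obtain p where p: "p \<in> N" "p u = q u" "f \<circ> p \<circ> f = p" by blast
  show ?thesis
  proof (rule that[OF p(1)])
    show "p u = a" using p(2) q(2) by simp
    fix x
    have "f (p x) = f (f (p (f x)))" using fun_cong[OF p(3), of x] by simp
    then show "f (p x) = p (f x)" by (simp add: ff)
  qed
qed

text \<open>
  Suppose that \<open>f\<close> moves a neighbour of \<open>u\<close> in the triple, and let \<open>F\<close> be the set of fixed points of \<open>f\<close> in
  the orbit \<open>A\<close> of \<open>u\<close>.  By \<open>commuting_translation\<close> \<open>f\<close> acts in the same way on the triples of all \<open>a \<in> F\<close>:
  it fixes one of the three elements.  So \<open>f\<close> fixes \<open>\<bar>F\<bar>\<close> of the \<open>\<bar>A\<bar>\<close> mate edges at \<open>A\<close> and \<open>\<bar>F\<bar>\<close> of the \<open>3\<bar>A\<bar>\<close>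
  triple edges.  The numbers of transpositions therefore differ by \<open>\<bar>A\<bar>\<close>, which is odd, and the two signs
  are different.
\<close>
lemma involution_fixes_triple:
  assumes f: "f \<in> kernel" "f \<circ> f = id" and u: "u \<in> V" "f u = u"
    and sgn: "edge_sign f (mate_edges (orb u)) = edge_sign f (triple_edges (orb u))"
    and w: "w \<in> nb u"
  shows "f w = w"
proof (cases "w = mate u")
  case True
  then show ?thesis using mate_image[OF kernelD(1)[OF f(1)] u(1)] u(2) by simp
next
  case False
  then have w3: "w \<in> triple u" using w by (simp add: triple_def)
  show ?thesis
  proof (rule ccontr)
    assume moved: "f w \<noteq> w"
    let ?A = "orb u"
    have fG: "f \<in> G" using kernelD(1)[OF f(1)] .
    have ff: "f (f x) = x" for x using fun_cong[OF f(2), of x] by simp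
    have AV: "?A \<subseteq> V" using orb_subset[OF u(1)] .
    have finA: "finite ?A" using finite_subset[OF AV finite_V] .
    have fA: "f a \<in> ?A" if "a \<in> ?A" for a using kernel_orb[OF f(1) u(1)] that by blast
    define F where "F = {a \<in> ?A. f a = a}"
    have one_fixed: "card {b \<in> triple a. f b = b} = 1" if a: "a \<in> F" for a
    proof -
      obtain p where p: "p \<in> N" "p u = a" "\<And>x. f (p x) = p (f x)"
        using commuting_translation[OF f u, of a] a unfolding F_def by blast
      have "triple a = p ` triple u" using triple_image[OF N_G[OF p(1)] u(1)] p(2) by simp
      then have "{b \<in> triple a. f b = b} = p ` {b \<in> triple u. f b = b}"
        using p(3) inj_G[OF N_G[OF p(1)]] by (auto simp: inj_eq)
      then have "card {b \<in> triple a. f b = b} = card {b \<in> triple u. f b = b}"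
        using inj_G[OF N_G[OF p(1)]] by (simp add: card_image inj_on_def)
      moreover have "f b \<in> triple u" if "b \<in> triple u" for b
        using imageI[OF that, of f] triple_image[OF fG u(1)] u(2) by simp
      then obtain m where m: "card (triple u) = card {b \<in> triple u. f b = b} + 2 * m"
        using involution_parity[OF finite_triple[OF u(1)], of f] ff by blast
      have "card {b \<in> triple u. f b = b} < card (triple u)"
        using w3 moved by (intro psubset_card_mono finite_triple u(1)) blast
      then have "card {b \<in> triple u. f b = b} = 1" using m mate(2)[OF u(1)] by presburger
      ultimately show ?thesis by simp
    qed
    have injM: "inj_on (\<lambda>a. {a, mate a}) ?A"
    proof (rule inj_onI)
      fix a b assume ab: "a \<in> ?A" "b \<in> ?A" "{a, mate a} = {b, mate b}"
      have "mate b \<notin> ?A" using mate_not_orb[of b] AV ab(2) orb_eq[OF ab(2)] by auto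
      then show "a = b" using ab by (auto simp: doubleton_eq_iff)
    qed
    have injE: "inj_on (\<lambda>(a, b). {a, b}) (SIGMA a:?A. triple a)"
    proof (rule inj_onI)
      fix p q assume pq: "p \<in> (SIGMA a:?A. triple a)" "q \<in> (SIGMA a:?A. triple a)"
        "(\<lambda>(a, b). {a, b}) p = (\<lambda>(a, b). {a, b}) q"
      obtain a b c d where e: "p = (a, b)" "q = (c, d)" by (cases p, cases q)
      have "d \<notin> ?A" using triple_not_orb[of c d] pq(2) AV orb_eq[of c u] by (auto simp: e)
      then show "p = q" using pq by (auto simp: e doubleton_eq_iff)
    qed
    have fM: "f ` {a, mate a} = {f a, mate (f a)}" if "a \<in> ?A" for a
      using mate_image[OF fG] AV that by auto
    have fixM: "{e \<in> mate_edges ?A. f ` e = e} = (\<lambda>a. {a, mate a}) ` F"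
    proof -
      have "f ` {a, mate a} = {a, mate a} \<longleftrightarrow> f a = a" if "a \<in> ?A" for a
        unfolding fM[OF that] using inj_onD[OF injM _ fA[OF that] that] by auto
      then show ?thesis by (auto simp: mate_edges_def F_def)
    qed
    have cardM1: "card (mate_edges ?A) = card ?A" unfolding mate_edges_def using injM by (rule card_image)
    have cardM2: "card {e \<in> mate_edges ?A. f ` e = e} = card F"
      unfolding fixM by (rule card_image, rule inj_on_subset[OF injM]) (auto simp: F_def)
    have finM: "finite (mate_edges ?A)" using finA by (simp add: mate_edges_def)
    have imM: "f ` e \<in> mate_edges ?A" if "e \<in> mate_edges ?A" for e
      using imageI[OF that, of "(`) f"] unfolding mate_edges_image[OF fG AV] kernel_orb[OF f(1) u(1)] .
    obtain m1 where m1: "card (mate_edges ?A) = card {e \<in> mate_edges ?A. f ` e = e} + 2 * m1"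
      "edge_sign f (mate_edges ?A) = (-1) ^ m1"
      using involution_parity[of "mate_edges ?A" "(`) f", OF finM imM] unfolding edge_sign_def
      by (auto simp: image_image ff)
    have fixE: "{e \<in> triple_edges ?A. f ` e = e} = (\<lambda>(a, b). {a, b}) ` (SIGMA a:F. {b \<in> triple a. f b = b})"
    proof -
      have "f ` {a, b} = {a, b} \<longleftrightarrow> f a = a \<and> f b = b" if "a \<in> ?A" "b \<in> triple a" for a b
      proof -
        have "b \<notin> ?A" using triple_not_orb[of a b] that AV orb_eq[OF that(1)] by auto
        then show ?thesis using fA[OF that(1)] by (auto simp: doubleton_eq_iff)
      qed
      then show ?thesis by (auto simp: triple_edges_def F_def image_iff)
    qed
    have cardE1: "card (triple_edges ?A) = 3 * card ?A"
    proof -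
      have "card (triple_edges ?A) = card (SIGMA a:?A. triple a)"
        unfolding triple_edges_def using injE by (rule card_image)
      also have "\<dots> = (\<Sum>a\<in>?A. card (triple a))"
        using finA finite_triple AV by (intro card_SigmaI) blast+
      also have "\<dots> = (\<Sum>a\<in>?A. 3)" by (rule sum.cong[OF refl]) (use mate(2) AV in blast)
      finally show ?thesis by simp
    qed
    have cardE2: "card {e \<in> triple_edges ?A. f ` e = e} = card F"
    proof -
      have "card {e \<in> triple_edges ?A. f ` e = e} = card (SIGMA a:F. {b \<in> triple a. f b = b})"
        unfolding fixE by (rule card_image, rule inj_on_subset[OF injE]) (auto simp: F_def)
      also have "\<dots> = (\<Sum>a\<in>F. card {b \<in> triple a. f b = b})"
        using finA finite_triple AV by (intro card_SigmaI) (auto simp: F_def)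
      also have "\<dots> = (\<Sum>a\<in>F. 1)" by (rule sum.cong[OF refl]) (rule one_fixed)
      finally show ?thesis by simp
    qed
    have finE: "finite (triple_edges ?A)"
      unfolding triple_edges_alt using finA finite_triple AV by (intro finite_UN_I finite_imageI) blast+
    have imE: "f ` e \<in> triple_edges ?A" if "e \<in> triple_edges ?A" for e
      using imageI[OF that, of "(`) f"] unfolding triple_edges_image[OF fG AV] kernel_orb[OF f(1) u(1)] .
    obtain m2 where m2: "card (triple_edges ?A) = card {e \<in> triple_edges ?A. f ` e = e} + 2 * m2"
      "edge_sign f (triple_edges ?A) = (-1) ^ m2"
      using involution_parity[of "triple_edges ?A" "(`) f", OF finE imE] unfolding edge_sign_def
      by (auto simp: image_image ff)
    have "m2 = m1 + card ?A" using m1(1) m2(1) cardM1 cardM2 cardE1 cardE2 by linarith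
    then have "(-1::int) ^ m2 = - ((-1) ^ m1)" using odd_card_orb[of u] by (simp add: power_add)
    then show False using sgn m1(2) m2(2) by simp
  qed
qed

end

section \<open>The cycle of orbits and its signs\<close>

context elusive_with_normal
begin

definition orbs :: "'a set set" where "orbs = orb ` V"

definition mate_set :: "'a set \<Rightarrow> 'a set" where "mate_set A = mate ` A"

definition triple_set :: "'a set \<Rightarrow> 'a set" where "triple_set A = (\<Union>u\<in>A. triple u)"

lemma mate_set_orb: assumes u: "u \<in> V" shows "mate_set (orb u) = orb (mate u)"
  unfolding mate_set_def orb_def image_image
  by (rule image_cong[OF refl]) (simp add: mate_image[OF N_G u])

lemma triple_set_orb:
  assumes u: "u \<in> V" and w: "w \<in> triple u" shows "triple_set (orb u) = orb w"
proof
  show "triple_set (orb u) \<subseteq> orb w"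
  proof
    fix c assume "c \<in> triple_set (orb u)"
    then obtain n where n: "n \<in> N" "c \<in> triple (n u)" by (auto simp: triple_set_def orb_def)
    then obtain b where b: "b \<in> triple u" "c = n b" using triple_image[OF N_G[OF n(1)] u] by auto
    show "c \<in> orb w" unfolding b(2) by (rule orb_N[OF n(1) triple_orb[OF u w b(1)]])
  qed
  show "orb w \<subseteq> triple_set (orb u)"
  proof
    fix c assume "c \<in> orb w"
    then obtain n where n: "n \<in> N" "c = n w" by (auto simp: orb_def)
    have "c \<in> triple (n u)" unfolding triple_image[OF N_G[OF n(1)] u] n(2) using w by (rule imageI)
    moreover have "n u \<in> orb u" using n(1) by (auto simp: orb_def)
    ultimately show "c \<in> triple_set (orb u)" unfolding triple_set_def by (rule UN_I[rotated])
  qed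
qed

lemma orbsE: assumes "A \<in> orbs" obtains u w where "u \<in> V" "A = orb u" "w \<in> triple u" "w \<in> V"
proof -
  obtain u where u: "u \<in> V" "A = orb u" using assms by (auto simp: orbs_def)
  obtain w where "w \<in> triple u" using triple_other[OF u(1)] by blast
  then show ?thesis using that u triple_V[OF u(1)] by blast
qed

lemma orbs_subset: "A \<in> orbs \<Longrightarrow> A \<subseteq> V"
  using orb_subset by (auto simp: orbs_def)

lemma orbs_involutions:
  assumes "A \<in> orbs"
  shows "mate_set A \<in> orbs" "triple_set A \<in> orbs" "mate_set (mate_set A) = A" "triple_set (triple_set A) = A"
    "mate_set A \<noteq> A" "triple_set A \<noteq> A"
proof -
  obtain u w where u: "u \<in> V" "A = orb u" "w \<in> triple u" "w \<in> V" using assms by (rule orbsE)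
  have M: "mate_set A = orb (mate u)" unfolding u(2) by (rule mate_set_orb[OF u(1)])
  have E: "triple_set A = orb w" unfolding u(2) by (rule triple_set_orb[OF u(1,3)])
  show "mate_set A \<in> orbs" "triple_set A \<in> orbs" unfolding M E orbs_def using u(4) mate_V[OF u(1)] by simp_all
  have "mate_set (mate_set A) = mate_set (orb (mate u))" by (simp only: M)
  then show "mate_set (mate_set A) = A" by (simp only: mate_set_orb[OF mate_V[OF u(1)]] mate_mate[OF u(1)] u(2))
  have "triple_set (triple_set A) = triple_set (orb w)" by (simp only: E)
  then show "triple_set (triple_set A) = A" by (simp only: triple_set_orb[OF u(4) triple_sym[OF u(1,3)]] u(2))
  have "orb (mate u) \<noteq> orb u" using mate_not_orb[OF u(1)] orb_self[of "mate u"] by metis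
  then show "mate_set A \<noteq> A" by (simp only: M) (simp only: u(2) not_False_eq_True)
  have "orb w \<noteq> orb u" using triple_not_orb[OF u(1,3)] orb_self[of w] by metis
  then show "triple_set A \<noteq> A" by (simp only: E) (simp only: u(2) not_False_eq_True)
qed

lemma orbs_image:
  assumes g: "g \<in> G" and A: "A \<in> orbs"
  shows "g ` mate_set A = mate_set (g ` A)" "g ` triple_set A = triple_set (g ` A)"
proof -
  have V: "u \<in> V" if "u \<in> A" for u using orbs_subset[OF A] that by blast
  show "g ` mate_set A = mate_set (g ` A)"
    unfolding mate_set_def image_image by (rule image_cong[OF refl]) (simp add: mate_image[OF g V])
  have "g ` triple_set A = (\<Union>u\<in>A. g ` triple u)" by (simp add: triple_set_def image_UN)
  also have "\<dots> = (\<Union>u\<in>A. triple (g u))" by (rule SUP_cong[OF refl]) (simp add: triple_image[OF g V])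
  finally show "g ` triple_set A = triple_set (g ` A)" by (simp add: triple_set_def)
qed

lemma mate_edges_mate_set: assumes A: "A \<in> orbs" shows "mate_edges (mate_set A) = mate_edges A"
  unfolding mate_edges_def mate_set_def image_image
proof (rule image_cong[OF refl])
  fix u assume "u \<in> A"
  then have "mate (mate u) = u" using orbs_subset[OF A] by (intro mate_mate) blast
  then show "{mate u, mate (mate u)} = {u, mate u}" by auto
qed

lemma triple_edges_triple_set: assumes A: "A \<in> orbs" shows "triple_edges (triple_set A) = triple_edges A"
proof -
  have sub: "triple_edges (triple_set B) \<subseteq> triple_edges B" if B: "B \<in> orbs" for B
  proof
    fix e assume "e \<in> triple_edges (triple_set B)"
    then obtain x w where e: "x \<in> triple_set B" "w \<in> triple x" "e = {x, w}" by (auto simp: triple_edges_def)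
    have xV: "x \<in> V" using e(1) orbs_subset[OF orbs_involutions(2)[OF B]] by blast
    have "w \<in> triple_set (triple_set B)" unfolding triple_set_def[of "triple_set B"] using e(1,2) by (rule UN_I)
    then have "w \<in> B" unfolding orbs_involutions(4)[OF B] .
    moreover have "x \<in> triple w" by (rule triple_sym[OF xV e(2)])
    moreover have "e = {w, x}" using e(3) by auto
    ultimately show "e \<in> triple_edges B" unfolding triple_edges_def by (intro image_eqI[of _ _ "(w, x)"]) auto
  qed
  have "triple_edges A \<subseteq> triple_edges (triple_set A)"
    using sub[OF orbs_involutions(2)[OF A]] unfolding orbs_involutions(4)[OF A] .
  then show ?thesis using sub[OF A] by blast
qed

end

text \<open>
  \<open>x\<close> and \<open>y\<close> exchange the orbit \<open>A0\<close> with its two adjacent orbits.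
\<close>
locale orbit_cycle = elusive_with_normal +
  fixes A0 :: "'a set" and x y :: "'a \<Rightarrow> 'a"
  assumes A0: "A0 \<in> orbs" and x: "x \<in> G" "x ` A0 = mate_set A0" and y: "y \<in> G" "y ` A0 = triple_set A0"
begin

text \<open>
  Every second orbit on the cycle, starting from \<open>A0\<close> and going round indefinitely in both directions.
  The orbit between \<open>walk j\<close> and \<open>walk (j + 1)\<close> is the one adjacent to \<open>walk j\<close> along triples.
\<close>
definition walk :: "int \<Rightarrow> 'a set" where
  "walk j = (if 0 \<le> j then ((\<lambda>A. mate_set (triple_set A)) ^^ nat j) A0
    else ((\<lambda>A. triple_set (mate_set A)) ^^ nat (- j)) A0)"

lemma walk_orbs: "walk j \<in> orbs"
proof -
  have "((\<lambda>A. mate_set (triple_set A)) ^^ n) A0 \<in> orbs" "((\<lambda>A. triple_set (mate_set A)) ^^ n) A0 \<in> orbs" for n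
    by (induction n) (simp_all add: A0 orbs_involutions(1,2))
  then show ?thesis by (simp add: walk_def)
qed

lemma walk_0: "walk 0 = A0" by (simp add: walk_def)

lemma walk_plus: "walk (j + 1) = mate_set (triple_set (walk j))"
proof (cases "0 \<le> j")
  case True
  then have "nat (j + 1) = Suc (nat j)" by simp
  then show ?thesis using True by (simp add: walk_def)
next
  case False
  then have n: "nat (- j) = Suc (nat (- (j + 1)))" by simp
  have "walk j = triple_set (mate_set (walk (j + 1)))"
  proof (cases "j + 1 = 0")
    case True
    then have "j = - 1" by simp
    then show ?thesis by (simp add: walk_def)
  next
    case nz: False
    then have "\<not> 0 \<le> j + 1" using False by simp
    then show ?thesis using False unfolding walk_def n by (simp only: if_False funpow.simps o_apply)
  qed
  then show ?thesis using orbs_involutions[OF walk_orbs[of "j + 1"]]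
    by (simp add: orbs_involutions(4))
qed

lemma walk_minus: "walk (j - 1) = triple_set (mate_set (walk j))"
proof -
  have "walk j = mate_set (triple_set (walk (j - 1)))" using walk_plus[of "j - 1"] by simp
  then show ?thesis by (simp add: orbs_involutions walk_orbs)
qed

lemma x_walk: "x ` walk j = mate_set (walk (- j))"
proof (induction j rule: int_induct[where k = 0])
  case base
  then show ?case by (simp add: walk_0 x)
next
  case (step1 j)
  have "x ` walk (j + 1) = mate_set (triple_set (x ` walk j))"
    by (simp add: walk_plus orbs_image x(1) orbs_involutions walk_orbs)
  also have "\<dots> = mate_set (walk (- j - 1))" by (simp only: step1 walk_minus)
  finally show ?case by simp
next
  case (step2 j)
  have "x ` walk (j - 1) = triple_set (mate_set (x ` walk j))"
    by (simp add: walk_minus orbs_image x(1) orbs_involutions walk_orbs)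
  also have "\<dots> = mate_set (walk (- j + 1))"
    by (simp only: step2 walk_plus orbs_involutions walk_orbs)
  finally show ?case by (simp add: algebra_simps)
qed

lemma y_walk: "y ` walk j = triple_set (walk (- j))"
proof (induction j rule: int_induct[where k = 0])
  case base
  then show ?case by (simp add: walk_0 y)
next
  case (step1 j)
  have "y ` walk (j + 1) = mate_set (triple_set (y ` walk j))"
    by (simp add: walk_plus orbs_image y(1) orbs_involutions walk_orbs)
  also have "\<dots> = triple_set (walk (- j - 1))"
    by (simp only: step1 walk_minus orbs_involutions walk_orbs)
  finally show ?case by simp
next
  case (step2 j)
  have "y ` walk (j - 1) = triple_set (mate_set (y ` walk j))"
    by (simp add: walk_minus orbs_image y(1) orbs_involutions walk_orbs)
  also have "\<dots> = triple_set (walk (- j + 1))" by (simp only: step2 walk_plus)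
  finally show ?case by (simp add: algebra_simps)
qed

text \<open>
  The consecutive edge sets on the cycle.  The orbit \<open>walk j\<close> lies between the positions \<open>2 j\<close> and \<open>2 j + 1\<close>;
  mate edges have even positions.
\<close>
definition edges :: "int \<Rightarrow> 'a set set" where
  "edges i = (if even i then mate_edges (walk (i div 2)) else triple_edges (walk (i div 2)))"

lemma edges_even: "edges (2 * j) = mate_edges (walk j)"
  and edges_odd: "edges (2 * j + 1) = triple_edges (walk j)"
  by (simp_all add: edges_def)

lemma int_parity: obtains j :: int where "i = 2 * j" | j :: int where "i = 2 * j + 1"
  by (cases "even i") (auto elim: evenE oddE)

text \<open>
  Since \<open>x\<close> exchanges the two ends of the mate edges at \<open>A0\<close>, it reflects the cycle in position \<open>0\<close>, and in the
  same way \<open>y\<close> reflects it in position \<open>1\<close>.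
\<close>
lemma x_edges: "(`) x ` edges i = edges (- i)"
proof (rule int_parity[of i])
  fix j assume i: "i = 2 * j"
  have "(`) x ` edges i = mate_edges (mate_set (walk (- j)))"
    unfolding i edges_even by (simp only: mate_edges_image[OF x(1) orbs_subset[OF walk_orbs]] x_walk)
  also have "\<dots> = edges (2 * (- j))" by (simp only: mate_edges_mate_set[OF walk_orbs] edges_even)
  finally show ?thesis by (simp add: i)
next
  fix j assume i: "i = 2 * j + 1"
  have "(`) x ` edges i = triple_edges (mate_set (walk (- j)))"
    unfolding i edges_odd by (simp only: triple_edges_image[OF x(1) orbs_subset[OF walk_orbs]] x_walk)
  also have "\<dots> = triple_edges (walk (- j - 1))"
    by (simp only: walk_minus triple_edges_triple_set[OF orbs_involutions(1)[OF walk_orbs]])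
  also have "\<dots> = edges (2 * (- j - 1) + 1)" by (simp only: edges_odd)
  also have "2 * (- j - 1) + 1 = - i" by (simp add: i)
  finally show ?thesis .
qed

lemma y_edges: "(`) y ` edges i = edges (2 - i)"
proof (rule int_parity[of i])
  fix j assume i: "i = 2 * j"
  have "(`) y ` edges i = mate_edges (triple_set (walk (- j)))"
    unfolding i edges_even by (simp only: mate_edges_image[OF y(1) orbs_subset[OF walk_orbs]] y_walk)
  also have "\<dots> = mate_edges (walk (- j + 1))"
    by (simp only: walk_plus mate_edges_mate_set[OF orbs_involutions(2)[OF walk_orbs]])
  also have "\<dots> = edges (2 * (- j + 1))" by (simp only: edges_even)
  also have "2 * (- j + 1) = 2 - i" by (simp add: i)
  finally show ?thesis .
next
  fix j assume i: "i = 2 * j + 1"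
  have "(`) y ` edges i = triple_edges (triple_set (walk (- j)))"
    unfolding i edges_odd by (simp only: triple_edges_image[OF y(1) orbs_subset[OF walk_orbs]] y_walk)
  also have "\<dots> = edges (2 * (- j) + 1)" by (simp only: triple_edges_triple_set[OF walk_orbs] edges_odd)
  also have "2 * (- j) + 1 = 2 - i" by (simp add: i)
  finally show ?thesis .
qed

lemma kernel_edges: assumes c: "c \<in> kernel" shows "(`) c ` edges i = edges i"
proof -
  have cA: "c ` A = A" if "A \<in> orbs" for A using that kernel_orb[OF c] by (auto simp: orbs_def)
  show ?thesis
    by (rule int_parity[of i]) (simp_all only: edges_even edges_odd
      mate_edges_image[OF kernelD(1)[OF c] orbs_subset[OF walk_orbs]]
      triple_edges_image[OF kernelD(1)[OF c] orbs_subset[OF walk_orbs]] cA[OF walk_orbs])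
qed

lemma edges_Pow: "edges i \<subseteq> Pow V"
proof (rule int_parity[of i])
  fix j assume i: "i = 2 * j"
  show ?thesis unfolding i edges_even mate_edges_def using orbs_subset[OF walk_orbs[of j]] mate_V by auto
next
  fix j assume i: "i = 2 * j + 1"
  show ?thesis unfolding i edges_odd triple_edges_alt using orbs_subset[OF walk_orbs[of j]] triple_V by auto
qed

lemma finite_edges: "finite (edges i)"
  using finite_subset[OF edges_Pow] finite_V by simp

definition signs :: "('a \<Rightarrow> 'a) \<Rightarrow> int \<Rightarrow> int" where
  "signs c i = edge_sign c (edges i)"

lemma signs_comp:
  assumes "c \<in> kernel" "d \<in> kernel" shows "signs (c \<circ> d) i = signs c i * signs d i"
  unfolding signs_def using assms
  by (intro edge_sign_compose finite_edges inj_G kernel_edges kernelD(1))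

lemma signs_square: "signs c i * signs c i = 1"
  unfolding signs_def using edge_sign_values[of c "edges i"] by auto

lemma signs_id: "signs id i = 1"
  using signs_comp[OF kernel_id kernel_id, of i] signs_square[of id i] by simp

lemma signs_conj_x: "c \<in> kernel \<Longrightarrow> signs (perm_inv x \<circ> c \<circ> x) i = signs c (- i)"
  unfolding signs_def x_edges[symmetric]
  by (intro edge_sign_conj[OF finite_V] permutes x(1) kernelD(1) edges_Pow) (simp_all add: x_edges kernel_edges)

lemma signs_conj_y: "c \<in> kernel \<Longrightarrow> signs (perm_inv y \<circ> c \<circ> y) i = signs c (2 - i)"
  unfolding signs_def y_edges[symmetric]
  by (intro edge_sign_conj[OF finite_V] permutes y(1) kernelD(1) edges_Pow) (simp_all add: y_edges kernel_edges)

lemma orbit_on_walk: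
  assumes u: "u \<in> V" shows "\<exists>j. orb u = walk j \<or> orb u = triple_set (walk j)"
proof -
  let ?S = "{u \<in> V. \<exists>j. orb u = walk j \<or> orb u = triple_set (walk j)}"
  have "?S = V"
  proof (rule connected)
    obtain a b where "a \<in> V" "A0 = orb a" using A0 by (rule orbsE)
    then have "a \<in> ?S" using walk_0 by (metis (mono_tags, lifting) mem_Collect_eq)
    then show "?S \<noteq> {}" by blast
    fix a assume "a \<in> ?S"
    then obtain j where a: "a \<in> V" "orb a = walk j \<or> orb a = triple_set (walk j)" by blast
    show "nb a \<subseteq> ?S"
    proof
      fix w assume w: "w \<in> nb a"
      have wV: "w \<in> V" using w nb_subset[OF a(1)] by blast
      have "\<exists>j. orb w = walk j \<or> orb w = triple_set (walk j)"
      proof (cases "w = mate a")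
        case True
        then have M: "orb w = mate_set (orb a)" using mate_set_orb[OF a(1)] by simp
        show ?thesis
        proof (rule disjE[OF a(2)])
          assume "orb a = walk j"
          then have "orb w = triple_set (walk (j - 1))"
            by (simp add: M walk_minus orbs_involutions walk_orbs)
          then show ?thesis by blast
        next
          assume "orb a = triple_set (walk j)"
          then have "orb w = walk (j + 1)" by (simp add: M walk_plus)
          then show ?thesis by blast
        qed
      next
        case False
        then have "w \<in> triple a" using w by (simp add: triple_def)
        then have E: "orb w = triple_set (orb a)" using triple_set_orb[OF a(1)] by simp
        show ?thesis
        proof (rule disjE[OF a(2)])
          assume "orb a = walk j"
          then show ?thesis using E by metis
        next
          assume "orb a = triple_set (walk j)"
          then have "orb w = walk j" by (simp add: E orbs_involutions walk_orbs)
          then show ?thesis by blast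
        qed
      qed
      then show "w \<in> ?S" using wV by simp
    qed
  qed blast
  then show ?thesis using u by blast
qed

text \<open>
  A fixed vertex exists because orbits have odd size.  At any fixed vertex the two adjacent edge sets
  have equal signs, so \<open>involution_fixes_triple\<close> applies and the fixed points spread over the graph.
\<close>
lemma constant_signs_involution:
  assumes f: "f \<in> kernel" "f \<circ> f = id" and const: "\<And>i. signs f i = s"
  shows "f = id"
proof -
  have ff: "f (f z) = z" for z using fun_cong[OF f(2), of z] by simp
  obtain v where v: "v \<in> V" using V_nonempty by blast
  have "\<exists>e\<in>orb v. f e = e"
    by (rule involution_fixed_point[OF finite_subset[OF orb_subset[OF v] finite_V] odd_card_orb])
      (use kernel_orb[OF f(1) v] ff in auto)
  then obtain e where e: "e \<in> V" "f e = e" using orb_subset[OF v] by blast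
  show ?thesis
  proof (rule fixes_neighbours_imp_id[OF kernelD(1)[OF f(1)] e])
    fix u w assume u: "u \<in> V" "f u = u" and w: "w \<in> nb u"
    obtain j where "orb u = walk j \<or> orb u = triple_set (walk j)" using orbit_on_walk[OF u(1)] by blast
    then have "edge_sign f (mate_edges (orb u)) = s \<and> edge_sign f (triple_edges (orb u)) = s"
    proof
      assume "orb u = walk j"
      then show ?thesis using const[of "2 * j"] const[of "2 * j + 1"] by (simp only: signs_def edges_even edges_odd)
    next
      assume E: "orb u = triple_set (walk j)"
      have "mate_edges (orb u) = edges (2 * (j + 1))"
        by (simp only: E edges_even walk_plus mate_edges_mate_set[OF orbs_involutions(2)[OF walk_orbs]])
      moreover have "triple_edges (orb u) = edges (2 * j + 1)"
        by (simp only: E edges_odd triple_edges_triple_set[OF walk_orbs])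
      ultimately show ?thesis using const[of "2 * (j + 1)"] const[of "2 * j + 1"] by (simp only: signs_def)
    qed
    then show "f w = w" by (intro involution_fixes_triple[OF f u _ w]) simp
  qed
qed

definition even_kernel :: "('a \<Rightarrow> 'a) set" where
  "even_kernel = {d \<in> kernel. \<forall>i. signs d i = 1}"

lemma even_kernel_group: "group (perm_group even_kernel)"
proof (rule group_perm_group)
  show "id \<in> even_kernel" by (simp add: even_kernel_def kernel_id signs_id)
  show "g \<circ> h \<in> even_kernel" if "g \<in> even_kernel" "h \<in> even_kernel" for g h
    using that by (simp add: even_kernel_def kernel_comp signs_comp)
  show "perm_inv g \<in> even_kernel" if g: "g \<in> even_kernel" for g
  proof -
    have gk: "g \<in> kernel" and s: "signs g i = 1" for i using g by (simp_all add: even_kernel_def)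
    have "perm_inv g \<circ> g = id" using kernelD(1)[OF gk] by (simp add: fun_eq_iff)
    then have "signs (perm_inv g) i = 1" for i
      using signs_comp[OF kernel_inv[OF gk] gk, of i] signs_id[of i] s[of i] by simp
    then show ?thesis using kernel_inv[OF gk] by (simp add: even_kernel_def)
  qed
  show "bij g" if "g \<in> even_kernel" for g using that by (simp add: even_kernel_def bij_G kernelD(1))
qed

lemma finite_kernel: "finite kernel" using finite_subset[OF _ finite_G, of kernel] by (auto simp: kernel_def)

text \<open>
  An involution in this group would have constant signs.
\<close>
lemma odd_card_even_kernel: "odd (card even_kernel)"
proof
  assume ev: "even (card even_kernel)"
  have "finite even_kernel" using finite_kernel by (simp add: even_kernel_def)
  from perm_group_cauchy[OF even_kernel_group this two_is_prime_nat ev]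
  obtain f where f: "f \<in> even_kernel" "f \<noteq> id" "f ^^ 2 = id" by blast
  have "f = id"
    by (rule constant_signs_involution[of f 1]) (use f in \<open>auto simp: even_kernel_def numeral_2_eq_2\<close>)
  with f(2) show False ..
qed

lemma kernel_funpow: "c \<in> kernel \<Longrightarrow> c ^^ n \<in> kernel"
  by (induction n) (simp_all add: kernel_id kernel_comp)

text \<open>
  For odd \<open>k = 2l + 1\<close> the power \<open>h\<^sup>k\<close> has square \<open>1\<close> and so belongs to the kernel, and \<open>h = h\<^sup>k(h\<^sup>2)\<^sup>-\<^sup>l\<close>.
\<close>
lemma square_in_even_kernel:
  assumes h: "h \<in> G" "h \<circ> h \<in> even_kernel" shows "h \<in> kernel"
proof -
  let ?k = "card even_kernel"
  have pow2: "(h \<circ> h) ^^ n = h ^^ (2 * n)" for n by (induction n) (simp_all add: o_assoc)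
  have "h ^^ (2 * ?k) = id" using perm_group_lagrange[OF even_kernel_group h(2)] pow2 by simp
  then have "h ^^ ?k \<circ> h ^^ ?k = id" by (simp add: funpow_add[symmetric] mult_2)
  then have hk: "h ^^ ?k \<in> kernel" by (rule involution_in_kernel[OF funpow_in[OF h(1)]])
  obtain l where l: "?k = 2 * l + 1" using odd_card_even_kernel by (rule oddE)
  have d: "(h \<circ> h) ^^ l \<in> kernel" using h(2) by (intro kernel_funpow) (simp add: even_kernel_def)
  have "h ^^ ?k = h \<circ> (h \<circ> h) ^^ l" unfolding l pow2 by simp
  then have "h = h ^^ ?k \<circ> perm_inv ((h \<circ> h) ^^ l)" using kernelD(1)[OF d] by (simp add: fun_eq_iff)
  then show ?thesis using kernel_comp[OF hk kernel_inv[OF d]] by simp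
qed

text \<open>
  The assumption says that \<open>(hc)\<^sup>2 = h\<^sup>2(h\<^sup>-\<^sup>1ch)c\<close> has trivial signs.
\<close>
lemma twisted_square:
  assumes c: "c \<in> kernel" and h: "h \<in> G" "h \<notin> kernel" and hh: "h \<circ> h \<in> kernel"
    and eq: "\<And>i. signs (h \<circ> h) i = signs c i * signs (perm_inv h \<circ> c \<circ> h) i"
  shows False
proof -
  have conj: "perm_inv h \<circ> c \<circ> h \<in> kernel" by (rule kernel_conj[OF c h(1)])
  have "(h \<circ> c) \<circ> (h \<circ> c) = (h \<circ> h) \<circ> ((perm_inv h \<circ> c \<circ> h) \<circ> c)"
    using h(1) by (simp add: fun_eq_iff)
  moreover have "signs ((h \<circ> h) \<circ> ((perm_inv h \<circ> c \<circ> h) \<circ> c)) i = 1" for i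
  proof -
    have "signs ((h \<circ> h) \<circ> ((perm_inv h \<circ> c \<circ> h) \<circ> c)) i
        = signs (h \<circ> h) i * (signs (perm_inv h \<circ> c \<circ> h) i * signs c i)"
      by (simp only: signs_comp[OF hh kernel_comp[OF conj c]] signs_comp[OF conj c])
    also have "\<dots> = (signs c i * signs c i) * (signs (perm_inv h \<circ> c \<circ> h) i * signs (perm_inv h \<circ> c \<circ> h) i)"
      by (simp only: eq ac_simps)
    finally show ?thesis by (simp only: signs_square mult_1)
  qed
  moreover have "(h \<circ> h) \<circ> ((perm_inv h \<circ> c \<circ> h) \<circ> c) \<in> kernel" by (intro kernel_comp hh conj c)
  ultimately have "(h \<circ> c) \<circ> (h \<circ> c) \<in> even_kernel" by (simp add: even_kernel_def)
  then have "h \<circ> c \<in> kernel" by (rule square_in_even_kernel[OF comp_in[OF h(1) kernelD(1)[OF c]]])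
  then have "(h \<circ> c) \<circ> perm_inv c \<in> kernel" by (rule kernel_comp[OF _ kernel_inv[OF c]])
  moreover have "(h \<circ> c) \<circ> perm_inv c = h" using kernelD(1)[OF c] by (simp add: fun_eq_iff)
  ultimately show False using h(2) by simp
qed

lemma swap_kernel:
  assumes g: "g \<in> G" and "g ` A0 \<noteq> A0" "g ` (g ` A0) = A0"
  shows "g \<notin> kernel" "g \<circ> g \<in> kernel"
proof -
  obtain u where u: "u \<in> V" "A0 = orb u" using A0 by (auto simp: orbs_def)
  show "g \<notin> kernel" using kernel_orb[of g u] u assms(2) by auto
  have "g (g u) \<in> g ` (g ` A0)" using orb_self[of u] u(2) by simp
  then show "g \<circ> g \<in> kernel" using assms(3) u kernelI[OF comp_in[OF g g] u(1)] by simp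
qed

lemma x_swap: "x \<notin> kernel" "x \<circ> x \<in> kernel"
  using swap_kernel[OF x(1)] orbs_involutions[OF A0] orbs_image[OF x(1) A0] x(2) by simp_all

lemma y_swap: "y \<notin> kernel" "y \<circ> y \<in> kernel"
  using swap_kernel[OF y(1)] orbs_involutions[OF A0] orbs_image[OF y(1) A0] y(2) by simp_all

lemma square_sign:
  assumes "g \<in> G" "(`) g ` edges i = edges i" shows "signs (g \<circ> g) i = 1"
  using edge_sign_compose[OF finite_edges inj_G[OF assms(1)] inj_G[OF assms(1)] assms(2,2)] signs_square[of g i]
  by (simp add: signs_def)

text \<open>
  The signs of the kernel form a dihedral code.  It does not contain the constant \<open>-1\<close>: if \<open>c\<close> had these
  signs, so would its odd power \<open>c\<^sup>k\<close>, where \<open>k\<close> is the order of the even kernel; but \<open>c\<^sup>k\<close> has square \<open>1\<close>, so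
  it is the identity by \<open>constant_signs_involution\<close>.
\<close>
lemma contradiction: False
proof -
  interpret code: dihedral_code "signs ` kernel"
  proof
    show "(\<lambda>_. 1) \<in> signs ` kernel" by (rule image_eqI[OF _ kernel_id]) (simp add: fun_eq_iff signs_id)
    fix f assume "f \<in> signs ` kernel"
    then obtain c where c: "f = signs c" "c \<in> kernel" by (rule imageE)
    show "f i * f i = 1" for i unfolding c(1) by (rule signs_square)
    show "(\<lambda>i. f (- i)) \<in> signs ` kernel"
      by (rule image_eqI[OF _ kernel_conj[OF c(2) x(1)]]) (simp add: fun_eq_iff c signs_conj_x)
    show "(\<lambda>i. f (2 - i)) \<in> signs ` kernel"
      by (rule image_eqI[OF _ kernel_conj[OF c(2) y(1)]]) (simp add: fun_eq_iff c signs_conj_y)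
    fix g assume "g \<in> signs ` kernel"
    then obtain d where d: "g = signs d" "d \<in> kernel" by (rule imageE)
    show "(\<lambda>i. f i * g i) \<in> signs ` kernel"
      by (rule image_eqI[OF _ kernel_comp[OF c(2) d(2)]]) (simp add: fun_eq_iff c d signs_comp)
  qed
  have no: "(\<lambda>_. - 1) \<notin> signs ` kernel"
  proof
    assume "(\<lambda>_. - 1) \<in> signs ` kernel"
    then obtain c where c: "(\<lambda>_. - 1) = signs c" "c \<in> kernel" by (rule imageE)
    have s: "signs c i = - 1" for i using fun_cong[OF c(1), of i] by simp
    have cc: "c \<circ> c \<in> even_kernel" using c(2) s by (simp add: even_kernel_def kernel_comp signs_comp)
    let ?k = "card even_kernel"
    have pow: "signs (c ^^ n) i = (-1) ^ n" for n i
    proof (induction n)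
      case 0
      show ?case by (simp only: funpow.simps power_0 signs_id)
    next
      case (Suc n)
      have "signs (c ^^ Suc n) i = signs c i * signs (c ^^ n) i"
        by (simp only: funpow.simps signs_comp[OF c(2) kernel_funpow[OF c(2)]])
      then show ?case by (simp only: Suc s power_Suc)
    qed
    have pow2: "(c \<circ> c) ^^ n = c ^^ (2 * n)" for n by (induction n) (simp_all add: o_assoc)
    have "c ^^ (2 * ?k) = id" using perm_group_lagrange[OF even_kernel_group cc] pow2 by simp
    then have "c ^^ ?k \<circ> c ^^ ?k = id" by (simp add: funpow_add[symmetric] mult_2)
    then have "c ^^ ?k = id"
      by (rule constant_signs_involution[OF kernel_funpow[OF c(2)]]) (rule pow)
    then have "(-1::int) ^ ?k = 1" using pow[of ?k 0] signs_id[of 0] by simp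
    then show False using odd_card_even_kernel by simp
  qed
  have xx: "perm_inv x \<circ> (x \<circ> x) \<circ> x = x \<circ> x" and yy: "perm_inv y \<circ> (y \<circ> y) \<circ> y = y \<circ> y"
    using x(1) y(1) by (simp_all add: fun_eq_iff)
  \<comment> \<open>x commutes with its square and maps the edges at position 0 to themselves, where the sign of its square is 1\<close>
  have qx: "signs (x \<circ> x) (- i) = signs (x \<circ> x) i" for i using signs_conj_x[OF x_swap(2), of i] unfolding xx by simp
  have py: "signs (y \<circ> y) (2 - i) = signs (y \<circ> y) i" for i using signs_conj_y[OF y_swap(2), of i] unfolding yy by simp
  have q0: "signs (x \<circ> x) 0 = 1" by (rule square_sign[OF x(1)]) (simp add: x_edges)
  have p1: "signs (y \<circ> y) 1 = 1" by (rule square_sign[OF y(1)]) (simp add: y_edges)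
  have "\<exists>f\<in>signs ` kernel. (\<forall>i. signs (x \<circ> x) i = f i * f (- i)) \<or> (\<forall>i. signs (y \<circ> y) i = f i * f (2 - i))"
    by (rule code.symmetric_is_norm[OF finite_imageI[OF finite_kernel] no imageI[OF x_swap(2)] qx q0 imageI[OF y_swap(2)] py p1])
  then obtain c where c: "c \<in> kernel"
    "(\<forall>i. signs (x \<circ> x) i = signs c i * signs c (- i)) \<or> (\<forall>i. signs (y \<circ> y) i = signs c i * signs c (2 - i))"
    by blast
  from c(2) show False
  proof
    assume "\<forall>i. signs (x \<circ> x) i = signs c i * signs c (- i)"
    then show False by (intro twisted_square[OF c(1) x(1) x_swap]) (simp add: signs_conj_x[OF c(1)])
  next
    assume "\<forall>i. signs (y \<circ> y) i = signs c i * signs c (2 - i)"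
    then show False by (intro twisted_square[OF c(1) y(1) y_swap]) (simp add: signs_conj_y[OF c(1)])
  qed
qed

end

lemma (in elusive_with_normal) absurd: False
proof -
  obtain v where v: "v \<in> V" using V_nonempty by blast
  obtain w where w: "w \<in> triple v" using triple_other[OF v] by blast
  have wV: "w \<in> V" using triple_V[OF v] w by blast
  obtain x where x: "x \<in> G" "x v = mate v" using transitive[OF v mate_V[OF v]] by blast
  obtain y where y: "y \<in> G" "y v = w" using transitive[OF v wV] by blast
  interpret orbit_cycle V nb G N r "orb v" x y
  proof
    show "orb v \<in> orbs" unfolding orbs_def using v by (rule imageI)
    show "x ` orb v = mate_set (orb v)" using orb_image[OF x(1), of v] mate_set_orb[OF v] x(2) by simp
    show "y ` orb v = triple_set (orb v)" using orb_image[OF y(1), of v] triple_set_orb[OF v w] y(2) by simp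
  qed (rule x(1) y(1))+
  show False by (rule contradiction)
qed

lemma (in elusive_action) trivial_group: "G = {id}"
proof (rule ccontr)
  assume nontriv: "G \<noteq> {id}"
  have "card G > 0" using finite_G id_in by (auto simp: card_gt_0_iff)
  then obtain a b where ab: "card G = 2 ^ a * 3 ^ b"
    by (rule two_three_number[OF _ prime_divisor])
  interpret Gr: group "perm_group G" by (rule group_G)
  have "prime (3::nat)" by simp
  show False
  proof (rule Gr.two_prime_group_abelian_normal[OF two_is_prime_nat \<open>prime 3\<close>, of a b])
    show "Coset.order (perm_group G) = 2 ^ a * 3 ^ b" using ab by simp
    show "carrier (perm_group G) \<noteq> {\<one>\<^bsub>perm_group G\<^esub>}" using nontriv by simp
    fix N :: "('a \<Rightarrow> 'a) set" and r :: nat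
    assume N: "N \<lhd> perm_group G" "N \<noteq> {\<one>\<^bsub>perm_group G\<^esub>}" and r: "r = 2 \<or> r = 3"
      and comm: "\<And>x y. x \<in> N \<Longrightarrow> y \<in> N \<Longrightarrow> x \<otimes>\<^bsub>perm_group G\<^esub> y = y \<otimes>\<^bsub>perm_group G\<^esub> x"
      and exp: "\<And>x. x \<in> N \<Longrightarrow> x [^]\<^bsub>perm_group G\<^esub> r = \<one>\<^bsub>perm_group G\<^esub>"
    interpret N: normal N "perm_group G" by (rule N(1))
    have sub: "N \<subseteq> G" using N.subset by simp
    have inv: "inv\<^bsub>perm_group G\<^esub> g = perm_inv g" if "g \<in> G" for g
      by (rule perm_group_inv[OF group_G that bij_G[OF that] inv_in[OF that]])
    interpret elusive_with_normal V nb G N r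
    proof
      show "N \<noteq> {id}" using N(2) by simp
      show "id \<in> N" using N.one_closed by simp
      show "m \<circ> n \<in> N" if "m \<in> N" "n \<in> N" for m n using N.m_closed[OF that] by simp
      show "perm_inv n \<in> N" if "n \<in> N" for n
        using N.m_inv_closed[OF that] by (simp only: inv[OF subsetD[OF sub that]])
      show "g \<circ> n \<circ> perm_inv g \<in> N" if "g \<in> G" "n \<in> N" for g n
        using N.inv_op_closed2[of g n] that inv[of g] by simp
      show "m \<circ> n = n \<circ> m" if "m \<in> N" "n \<in> N" for m n using comm[OF that] by simp
      show "n ^^ r = id" if "n \<in> N" for n using exp[OF that] by simp
    qed (rule sub r)+
    show False by (rule absurd)
  qed
qed

section \<open>Graphs and their automorphism groups\<close>

lemma pair_graph_arcs:
  assumes "pair_graph \<Gamma>"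
  shows "finite (parcs \<Gamma>)" "(u, v) \<in> parcs \<Gamma> \<Longrightarrow> u \<in> pverts \<Gamma>" "(u, v) \<in> parcs \<Gamma> \<Longrightarrow> v \<in> pverts \<Gamma>"
    "(v, v) \<notin> parcs \<Gamma>" "(u, v) \<in> parcs \<Gamma> \<Longrightarrow> (v, u) \<in> parcs \<Gamma>" "finite (pverts \<Gamma>)"
proof -
  interpret pair_graph \<Gamma> by (rule assms)
  show "finite (parcs \<Gamma>)" by (rule pair_finite_arcs)
  show "finite (pverts \<Gamma>)" by (rule pair_finite_verts)
  show "u \<in> pverts \<Gamma>" "v \<in> pverts \<Gamma>" if "(u, v) \<in> parcs \<Gamma>" using that by (rule in_arcsD1 in_arcsD2)+
  show "(v, v) \<notin> parcs \<Gamma>" using pair_no_loops by force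
  show "(v, u) \<in> parcs \<Gamma>" if "(u, v) \<in> parcs \<Gamma>" using that pair_sym_arcs
    by (auto simp: symmetric_def sym_def arcs_ends_def arc_to_ends_def)
qed

lemma automorphism_nb_image:
  assumes "pair_graph \<Gamma>" "f \<in> automorphisms \<Gamma>" "v \<in> pverts \<Gamma>"
  shows "{w. (f v, w) \<in> parcs \<Gamma>} = f ` {w. (v, w) \<in> parcs \<Gamma>}"
proof -
  note P = pair_graph_arcs[OF assms(1)]
  have f: "f permutes pverts \<Gamma>" and arcs: "\<And>u v. u \<in> pverts \<Gamma> \<Longrightarrow> v \<in> pverts \<Gamma> \<Longrightarrow>
      (f u, f v) \<in> parcs \<Gamma> \<longleftrightarrow> (u, v) \<in> parcs \<Gamma>"
    using assms(2) by (auto simp: automorphisms_def)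
  show ?thesis
  proof (intro equalityI subsetI)
    fix w assume "w \<in> {w. (f v, w) \<in> parcs \<Gamma>}"
    then have w: "(f v, w) \<in> parcs \<Gamma>" by simp
    then have "w \<in> f ` pverts \<Gamma>" using P(3) permutes_image[OF f] by simp
    then obtain u where "u \<in> pverts \<Gamma>" "w = f u" by (rule imageE)
    then show "w \<in> f ` {w. (v, w) \<in> parcs \<Gamma>}" using w arcs[OF assms(3)] by simp
  next
    fix w assume "w \<in> f ` {w. (v, w) \<in> parcs \<Gamma>}"
    then obtain u where u: "w = f u" "(v, u) \<in> parcs \<Gamma>" by auto
    then show "w \<in> {w. (f v, w) \<in> parcs \<Gamma>}" using arcs[OF assms(3) P(3)[OF u(2)]] by simp
  qed
qed

lemma connected_closed_set:
  assumes "pair_graph \<Gamma>" "Digraph_Component.connected (with_proj \<Gamma>)"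
    and S: "S \<subseteq> pverts \<Gamma>" "S \<noteq> {}" and cl: "\<And>u w. u \<in> S \<Longrightarrow> (u, w) \<in> parcs \<Gamma> \<Longrightarrow> w \<in> S"
  shows "S = pverts \<Gamma>"
proof -
  note P = pair_graph_arcs[OF assms(1)]
  have "w \<in> S" if w: "w \<in> pverts \<Gamma>" for w
  proof -
    interpret pair_graph \<Gamma> by (rule assms(1))
    obtain u where u: "u \<in> S" using S(2) by blast
    have "u \<rightarrow>\<^sup>*\<^bsub>with_proj (mk_symmetric (with_proj \<Gamma>))\<^esub> w"
      using assms(2) u w S(1) by (auto simp: Digraph_Component.connected_def strongly_connected_def)
    then have "u \<rightarrow>\<^sup>*\<^bsub>with_proj \<Gamma>\<^esub> w" by (simp only: reachable_mk_symmetric_eq[OF sym_arcs])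
    then show "w \<in> S"
    proof (induction rule: reachable_induct)
      case base
      show ?case by (rule u)
    next
      case (step x y)
      have "(x, y) \<in> parcs \<Gamma>" using step(2) by simp
      then show ?case by (rule cl[OF step(3)])
    qed
  qed
  then show ?thesis using S(1) by blast
qed

lemma card_nb_eq_out_degree:
  assumes "pair_graph \<Gamma>"
  shows "card {w. (v, w) \<in> parcs \<Gamma>} = out_degree (with_proj \<Gamma>) v"
proof -
  have "out_arcs (with_proj \<Gamma>) v = Pair v ` {w. (v, w) \<in> parcs \<Gamma>}" by (auto simp: out_arcs_def)
  then show ?thesis by (simp add: out_degree_def card_image inj_on_def)
qed

lemma subgroup_Aut:
  assumes "subgroup G (Aut \<Gamma>)"
  shows "g \<in> G \<Longrightarrow> g \<in> automorphisms \<Gamma>" "id \<in> G" "g \<in> G \<Longrightarrow> h \<in> G \<Longrightarrow> g \<circ> h \<in> G"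
    "g \<in> G \<Longrightarrow> perm_inv g \<in> G"
proof -
  interpret subgroup G "Aut \<Gamma>" by (rule assms)
  show aut: "g \<in> automorphisms \<Gamma>" if "g \<in> G" for g using subset that by (auto simp: Aut_def)
  show "id \<in> G" using one_closed by (simp add: Aut_def)
  show "g \<circ> h \<in> G" if "g \<in> G" "h \<in> G" using m_closed[OF that] by (simp add: Aut_def)
  show "perm_inv g \<in> G" if g: "g \<in> G"
  proof -
    let ?h = "inv\<^bsub>Aut \<Gamma>\<^esub> g"
    have h: "?h \<in> G" using g by (rule m_inv_closed)
    have "g \<in> carrier (Aut \<Gamma>)" using g by (rule mem_carrier)
    then have "?h \<circ> g = id" "g \<circ> ?h = id" 
      using group.l_inv[OF group_Aut] group.r_inv[OF group_Aut] by (metis Aut_def monoid.simps(1,2))+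
    then have "perm_inv g = ?h" by (intro inv_unique_comp)
    then show ?thesis using h by simp
  qed
qed

theorem theorem1p1:
  fixes \<Gamma> :: "'a pair_pre_digraph" and G :: "('a \<Rightarrow> 'a) set"
  assumes "pair_graph \<Gamma>"
    and "Digraph_Component.connected (with_proj \<Gamma>)"
    and "card (pverts \<Gamma>) \<ge> 2"
    and "\<forall>v \<in> pverts \<Gamma>. out_degree (with_proj \<Gamma>) v \<le> 4"
    and "subgroup G (Aut \<Gamma>)"
    and "transitive_on (pverts \<Gamma>) G"
  shows "\<exists>g \<in> G. g \<noteq> id \<and> semiregular_on (pverts \<Gamma>) g"
proof (rule ccontr)
  assume no: "\<not> (\<exists>g \<in> G. g \<noteq> id \<and> semiregular_on (pverts \<Gamma>) g)"
  note P = pair_graph_arcs[OF assms(1)] and A = subgroup_Aut[OF assms(5)]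
  have nonempty: "pverts \<Gamma> \<noteq> {}" using assms(3) by auto
  have perm: "g permutes pverts \<Gamma>" if "g \<in> G" for g using A(1)[OF that] by (simp add: automorphisms_def)
  interpret elusive_action "pverts \<Gamma>" "\<lambda>v. {w. (v, w) \<in> parcs \<Gamma>}" G
  proof
    show "finite (pverts \<Gamma>)" "pverts \<Gamma> \<noteq> {}" "id \<in> G" by (rule P nonempty A)+
    show "{w. (v, w) \<in> parcs \<Gamma>} \<subseteq> pverts \<Gamma>" "v \<notin> {w. (v, w) \<in> parcs \<Gamma>}" for v using P by auto
    show "u \<in> {w. (v, w) \<in> parcs \<Gamma>}" if "v \<in> {w. (u, w) \<in> parcs \<Gamma>}" for u v using that P(5) by simp
    show "card {w. (v, w) \<in> parcs \<Gamma>} \<le> 4" if "v \<in> pverts \<Gamma>" for v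
      using assms(4) that by (simp add: card_nb_eq_out_degree[OF assms(1)])
    show "S = pverts \<Gamma>" if S: "S \<subseteq> pverts \<Gamma>" "S \<noteq> {}" "\<And>u. u \<in> S \<Longrightarrow> {w. (u, w) \<in> parcs \<Gamma>} \<subseteq> S" for S
      by (rule connected_closed_set[OF assms(1,2) S(1,2)]) (use S(3) in blast)
    show "g permutes pverts \<Gamma>" "perm_inv g \<in> G" if "g \<in> G" for g using that by (rule perm A(4))+
    show "g \<circ> h \<in> G" if "g \<in> G" "h \<in> G" for g h using that by (rule A(3))
    show "{w. (g v, w) \<in> parcs \<Gamma>} = g ` {w. (v, w) \<in> parcs \<Gamma>}" if "g \<in> G" "v \<in> pverts \<Gamma>" for g v
      by (rule automorphism_nb_image[OF assms(1) A(1)[OF that(1)] that(2)])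
    show "\<exists>g\<in>G. g u = v" if "u \<in> pverts \<Gamma>" "v \<in> pverts \<Gamma>" for u v
      using assms(6) that by (auto simp: transitive_on_def)
    fix g and p :: nat assume g: "g \<in> G" "prime p" "g ^^ p = id"
    show "\<exists>v\<in>pverts \<Gamma>. g v = v"
    proof (rule ccontr)
      assume free: "\<not> (\<exists>v\<in>pverts \<Gamma>. g v = v)"
      then have "g \<noteq> id" using nonempty by auto
      moreover have "semiregular_on (pverts \<Gamma>) g"
        by (rule prime_order_semiregular[OF perm[OF g(1)] g(2,3)]) (use free in blast)
      ultimately show False using no g(1) by blast
    qed
  qed
  have "\<not> card (pverts \<Gamma>) \<le> 1" using assms(3) by simp
  then obtain u v where uv: "u \<in> pverts \<Gamma>" "v \<in> pverts \<Gamma>" "u \<noteq> v"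
    using card_le_Suc0_iff_eq[OF P(6)] by auto
  then obtain g where "g \<in> G" "g u = v" using assms(6) by (auto simp: transitive_on_def)
  then show False using trivial_group uv(3) by simp
qed

end
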